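(* Let $2\le k\le n$, $\sigma\in S^k_n$, $C\in\mathbb{S}^{k-1,\sigma}_{>0}$, and consider the $\mathcal{M}^C_{k,\sigma}$-leaf parametric normal form with $s=3$, i.e. with amplitude dynamics $\dot\rho_{\sigma(k)}=\rho_{\sigma(k)}(\nu_0+\nu_1\rho_{\sigma(k)}^2+\nu_2\rho_{\sigma(k)}^4+a_3\rho_{\sigma(k)}^6)$, $a_3\neq0$. A $k$-hypertorus bifurcates from the origin at the $\mathcal{M}^C_{k,\sigma}$-leaf bifurcation varieties $$T_{Psup}=\{(\nu_0,\nu_1,\nu_2):\nu_0=0\text{ and either }\nu_1<0\text{ or }(\nu_1=0,\ \nu_2<0)\},$$ $$T_{Psub}=\{(\nu_0,\nu_1,\nu_2):\nu_0=0\text{ and either }\nu_1>0\text{ or }(\nu_1=0,\ \nu_2>0)\}.$$ This hypertorus is unstable when $\nu_1>0$, and stable for $\nu_1<0$. There is a double saddle-node bifurcation variety of hypertori at $$T_{2SN}=\Big\{(\nu_0,\nu_1,\nu_2):\ D=0\text{ and either }\Big(\frac{\nu_2}{a_3}<0,\ \frac{\nu_1}{a_3}>0\Big)\text{ or }\Big(\frac{\nu_0}{a_3}>0,\ \frac{\nu_1}{a_3}\le0\Big)\Big\},$$ where $$D=4\Big(\frac{\nu_1}{a_3}-\frac{\nu_2^2}{3a_3^2}\Big)^3+27\Big(\frac{2\nu_2^3}{27a_3^3}-\frac{\nu_2\nu_1}{3a_3^2}+\frac{\nu_0}{a_3}\Big)^2.$$ These bifurcations are seven-determined.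
   Context: $S^k_n$ is the set of permutations $\sigma$ of $\{1,\dots,n\}$ with $\sigma(i)<\sigma(j)$ for $i<j\le k$ and for $k<i<j\le n$. $\mathbb{S}^{k-1,\sigma}_{>0}=\{(c_1,\dots,c_n):\sum_{i\le k}c_{\sigma(i)}^2=1,\ c_{\sigma(i)}>0\ (i\le k),\ c_{\sigma(i)}=0\ (i>k)\}$. With $(\rho_i,\theta_i)$ polar coordinates of $(x_i,y_i)$, the leaf $\mathcal{M}^C_{k,\sigma}\subset\mathbb{R}^{2n}$ is the set where $\rho_{\sigma(i)}=\frac{c_{\sigma(i)}}{c_{\sigma(k)}}\rho_{\sigma(k)}>0$ for $i\le k$ and $(x_{\sigma(i)},y_{\sigma(i)})=0$ for $i>k$ (its closure contains the origin); it is homeomorphic to $\mathbb{T}_k\times\mathbb{R}^+$. For a natural number $s$, the leaf parametric normal form on $\mathcal{M}^C_{k,\sigma}$ is the system, for $1\le i\le k$, $$\dot\rho_{\sigma(i)}=\rho_{\sigma(i)}\sum_{j=0}^{s}\nu_j\rho_{\sigma(k)}^{2j},\qquad \dot\theta_{\sigma(i)}=\omega_{\sigma(i)}+\sum_{j=0}^s\hat b^i_j\,\rho_{\sigma(k)}^{2j},$$ where $\nu_s=a_s\ne0$ is constant, $\nu_0,\dots,\nu_{s-1}$ are small real unfolding parameters (the coefficients $\hat a_j(\mu,C)$, vanishing at $\mu=0$), $\hat b^i_j$ depend on the parameters with $\hat b^i_0=0$ at $\mu=0$, all $\omega_i\neq 0$ and $\omega_i/\omega_j\notin\mathbb{Q}$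 for $i<j$. An invariant $k$-hypertorus on the leaf is $\{\rho_{\sigma(k)}=r\}$ with $r>0$ a zero of the amplitude equation. Stability refers to the dynamics on the leaf. Leaf bifurcation varieties are the sets of parameters where the qualitative dynamics on the leaf changes. A "double saddle-node" refers to the saddle-node occurring simultaneously at the two points $\pm r$ of the $\mathbb{Z}_2$-equivariant amplitude equation. A bifurcation is $m$-determined if the qualitative local dynamics of the amplitude equation is determined by its terms of degree $\le m$ in $\rho_{\sigma(k)}$. *)

theory Defs
  imports "HOL-Analysis.Analysis"
begin

section \<open>The leaves\<close>

text \<open>Indices are the natural numbers \<open>1, \<dots>, n\<close>. A point of \<open>2n\<close>-space is an extensional function
  on \<open>{1..n}\<close> with values \<open>(x\<^sub>i, y\<^sub>i)\<close>, so that \<open>\<rho>\<^sub>i = norm (p i)\<close>.\<close>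

definition shuffles_kn :: "nat \<Rightarrow> nat \<Rightarrow> (nat \<Rightarrow> nat) set" where
  "shuffles_kn k n = {\<sigma>. \<sigma> permutes {1..n} \<and>
     (\<forall>i j. 1 \<le> i \<and> i < j \<and> j \<le> k \<longrightarrow> \<sigma> i < \<sigma> j) \<and>
     (\<forall>i j. k < i \<and> i < j \<and> j \<le> n \<longrightarrow> \<sigma> i < \<sigma> j)}"

definition pos_sphere :: "nat \<Rightarrow> nat \<Rightarrow> (nat \<Rightarrow> nat) \<Rightarrow> (nat \<Rightarrow> real) set" where
  "pos_sphere k n \<sigma> = {c. (\<Sum>i=1..k. (c (\<sigma> i))\<^sup>2) = 1 \<and>
     (\<forall>i\<in>{1..k}. c (\<sigma> i) > 0) \<and> (\<forall>i\<in>{k<..n}. c (\<sigma> i) = 0)}"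

type_synonym state = "nat \<Rightarrow> real \<times> real"

definition state_dist :: "nat \<Rightarrow> state \<Rightarrow> state \<Rightarrow> real" where
  "state_dist n p q = L2_set (\<lambda>i. dist (p i) (q i)) {1..n}"

definition leaf :: "nat \<Rightarrow> nat \<Rightarrow> (nat \<Rightarrow> nat) \<Rightarrow> (nat \<Rightarrow> real) \<Rightarrow> state set" where
  "leaf n k \<sigma> c = {p \<in> {1..n} \<rightarrow>\<^sub>E UNIV.
     (\<forall>i\<in>{1..k}. norm (p (\<sigma> i)) = c (\<sigma> i) / c (\<sigma> k) * norm (p (\<sigma> k)) \<and> norm (p (\<sigma> i)) > 0) \<and>
     (\<forall>i\<in>{k<..n}. p (\<sigma> i) = (0, 0))}"

definition hypertorus :: "nat \<Rightarrow> nat \<Rightarrow> (nat \<Rightarrow> nat) \<Rightarrow> (nat \<Rightarrow> real) \<Rightarrow> real \<Rightarrow> state set" where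
  "hypertorus n k \<sigma> c r = {p \<in> leaf n k \<sigma> c. norm (p (\<sigma> k)) = r}"


section \<open>The leaf parametric normal form\<close>

definition amplitude :: "nat \<Rightarrow> (nat \<Rightarrow> real) \<Rightarrow> real \<Rightarrow> real" where
  "amplitude s a r = r * (\<Sum>j\<le>s. a j * r ^ (2 * j))"

text \<open>Trajectories on the time interval \<open>J\<close> of the normal form with amplitude coefficients \<open>a j\<close>
  and phase coefficients \<open>b i j\<close>; \<open>\<theta>\<close> is a continuous choice of the angles along the curve.\<close>

definition leaf_trajectory ::
  "nat \<Rightarrow> nat \<Rightarrow> (nat \<Rightarrow> nat) \<Rightarrow> (nat \<Rightarrow> real) \<Rightarrow> nat \<Rightarrow> (nat \<Rightarrow> real) \<Rightarrow> (nat \<Rightarrow> real) \<Rightarrow>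
   (nat \<Rightarrow> nat \<Rightarrow> real) \<Rightarrow> real set \<Rightarrow> (real \<Rightarrow> state) \<Rightarrow> bool" where
  "leaf_trajectory n k \<sigma> c s a \<omega> b J p \<longleftrightarrow>
     (\<forall>t\<in>J. p t \<in> leaf n k \<sigma> c) \<and>
     (\<exists>\<rho> \<theta> :: nat \<Rightarrow> real \<Rightarrow> real. \<forall>i\<in>{1..k}. \<forall>t\<in>J.
        \<rho> (\<sigma> i) t > 0 \<and>
        p t (\<sigma> i) = (\<rho> (\<sigma> i) t * cos (\<theta> (\<sigma> i) t), \<rho> (\<sigma> i) t * sin (\<theta> (\<sigma> i) t)) \<and>
        (\<rho> (\<sigma> i) has_real_derivative \<rho> (\<sigma> i) t * (\<Sum>j\<le>s. a j * \<rho> (\<sigma> k) t ^ (2 * j)))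
          (at t within J) \<and>
        (\<theta> (\<sigma> i) has_real_derivative \<omega> (\<sigma> i) + (\<Sum>j\<le>s. b i j * \<rho> (\<sigma> k) t ^ (2 * j)))
          (at t within J))"

text \<open>Radii of the invariant hypertori.\<close>

definition hypertorus_radii :: "nat \<Rightarrow> (nat \<Rightarrow> real) \<Rightarrow> real set" where
  "hypertorus_radii s a = {r. r > 0 \<and> amplitude s a r = 0}"

definition solution_on :: "(real \<Rightarrow> real) \<Rightarrow> real set \<Rightarrow> real set \<Rightarrow> (real \<Rightarrow> real) \<Rightarrow> bool" where
  "solution_on f U J \<phi> \<longleftrightarrow>
     (\<forall>t\<in>J. \<phi> t \<in> U \<and> (\<phi> has_real_derivative f (\<phi> t)) (at t within J))"


section \<open>Stability of a set\<close>

text \<open>Here \<open>tr J p\<close> means that \<open>p\<close> is a trajectory on \<open>J\<close>, and \<open>d\<close> is the distance of the phase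
  space. Lyapunov stability quantifies over trajectories on compact intervals, because a trajectory
  that leaves a neighbourhood may blow up in finite time.\<close>

definition dist_to_set :: "('s \<Rightarrow> 's \<Rightarrow> real) \<Rightarrow> 's \<Rightarrow> 's set \<Rightarrow> real" where
  "dist_to_set d x A = (INF y\<in>A. d x y)"

definition lyapunov_stable ::
  "(real set \<Rightarrow> (real \<Rightarrow> 's) \<Rightarrow> bool) \<Rightarrow> ('s \<Rightarrow> 's \<Rightarrow> real) \<Rightarrow> 's set \<Rightarrow> bool" where
  "lyapunov_stable tr d A \<longleftrightarrow>
     (\<forall>\<epsilon>>0. \<exists>\<delta>>0. \<forall>T\<ge>0. \<forall>p. tr {0..T} p \<and> dist_to_set d (p 0) A < \<delta> \<longrightarrow>
        (\<forall>t\<in>{0..T}. dist_to_set d (p t) A < \<epsilon>))"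

definition asymptotically_stable ::
  "(real set \<Rightarrow> (real \<Rightarrow> 's) \<Rightarrow> bool) \<Rightarrow> ('s \<Rightarrow> 's \<Rightarrow> real) \<Rightarrow> 's set \<Rightarrow> bool" where
  "asymptotically_stable tr d A \<longleftrightarrow> lyapunov_stable tr d A \<and>
     (\<exists>\<delta>>0. \<forall>p. tr {0..} p \<and> dist_to_set d (p 0) A < \<delta> \<longrightarrow>
        ((\<lambda>t. dist_to_set d (p t) A) \<longlongrightarrow> 0) at_top)"

definition stable_equilibria :: "(real \<Rightarrow> real) \<Rightarrow> real set" where
  "stable_equilibria f = {x. f x = 0 \<and> asymptotically_stable (solution_on f UNIV) dist {x}}"

definition unstable_equilibria :: "(real \<Rightarrow> real) \<Rightarrow> real set" where
  "unstable_equilibria f = {x. f x = 0 \<and> \<not> lyapunov_stable (solution_on f UNIV) dist {x}}"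


section \<open>Qualitative equivalence of amplitude equations\<close>

definition forward_orbit :: "real set \<Rightarrow> (real \<Rightarrow> real) \<Rightarrow> real \<Rightarrow> real set" where
  "forward_orbit U f x =
     {y. \<exists>T\<ge>0. \<exists>\<phi>. solution_on f U {0..T} \<phi> \<and> \<phi> 0 = x \<and> \<phi> T = y}"

text \<open>A \<open>\<int>\<^sub>2\<close>-equivariant homeomorphism that carries orbits to orbits and keeps the direction of time.
  \<open>U\<close> and \<open>V\<close> are meant to be symmetric about \<open>0\<close>.\<close>

definition orbit_equivalent ::
  "real set \<Rightarrow> real set \<Rightarrow> (real \<Rightarrow> real) \<Rightarrow> (real \<Rightarrow> real) \<Rightarrow> bool" where
  "orbit_equivalent U V f g \<longleftrightarrow>
     (\<exists>h h'. homeomorphism U V h h' \<and> (\<forall>x\<in>U. h (- x) = - h x) \<and>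
        (\<forall>x\<in>U. h ` forward_orbit U f x = forward_orbit V g (h x)))"

text \<open>Equivalence, near \<open>\<nu> = 0\<close> and \<open>\<rho> = 0\<close>, of two families of amplitude equations: a homeomorphism of the
  parameters and, for each parameter, an equivalence of the phase portraits. The phase
  neighbourhoods must not depend on \<open>\<nu>\<close>; otherwise they could be chosen so small that they miss the
  nonzero equilibria.\<close>

definition locally_equivalent_families ::
  "('p::real_normed_vector \<Rightarrow> real \<Rightarrow> real) \<Rightarrow> ('p \<Rightarrow> real \<Rightarrow> real) \<Rightarrow> bool" where
  "locally_equivalent_families F G \<longleftrightarrow>
     (\<exists>N M \<psi> \<psi>' \<epsilon> \<eta>. open N \<and> 0 \<in> N \<and> open M \<and> 0 \<in> M \<and>
        homeomorphism N M \<psi> \<psi>' \<and> \<psi> 0 = 0 \<and> \<epsilon> > 0 \<and> \<eta> > 0 \<and>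
        (\<forall>\<nu>\<in>N. orbit_equivalent {-\<epsilon><..<\<epsilon>} {-\<eta><..<\<eta>} (F \<nu>) (G (\<psi> \<nu>))))"


section \<open>Determinacy\<close>

text \<open>The \<open>\<int>\<^sub>2\<close>-equivariant amplitude equation with coefficients \<open>\<beta> j \<nu>\<close> of \<open>\<rho> ^ (2 * j + 1)\<close>.\<close>

definition amplitude_series :: "(nat \<Rightarrow> 'p \<Rightarrow> real) \<Rightarrow> 'p \<Rightarrow> real \<Rightarrow> real" where
  "amplitude_series \<beta> \<nu> r = r * (\<Sum>j. \<beta> j \<nu> * r ^ (2 * j))"

text \<open>The coefficients are continuously differentiable in the parameters, and the series of the
  coefficients and of their gradients converge uniformly on \<open>N\<close> near \<open>\<rho> = 0\<close>.\<close>

definition admissible_coeffs :: "'p::real_inner set \<Rightarrow> (nat \<Rightarrow> 'p \<Rightarrow> real) \<Rightarrow> bool" where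
  "admissible_coeffs N \<beta> \<longleftrightarrow>
     (\<exists>K R. R > 0 \<and> (\<exists>d. \<forall>j. continuous_on N (d j) \<and>
        (\<forall>\<nu>\<in>N. (GDERIV (\<beta> j) \<nu> :> d j \<nu>) \<and> \<bar>\<beta> j \<nu>\<bar> * R ^ j \<le> K \<and> norm (d j \<nu>) * R ^ j \<le> K)))"

definition determined :: "nat \<Rightarrow> (nat \<Rightarrow> 'p::real_inner \<Rightarrow> real) \<Rightarrow> bool" where
  "determined m \<alpha> \<longleftrightarrow>
     (\<forall>\<beta> N. open N \<and> 0 \<in> N \<and> admissible_coeffs N \<beta> \<and>
        (\<forall>\<nu>\<in>N. \<forall>j. 2 * j + 1 \<le> m \<longrightarrow> \<beta> j \<nu> = \<alpha> j \<nu>) \<longrightarrow>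
        locally_equivalent_families (amplitude_series \<alpha>) (amplitude_series \<beta>))"


section \<open>The family with \<open>s = 3\<close>\<close>

type_synonym param = "real \<times> real \<times> real"

definition coeffs3 :: "real \<Rightarrow> nat \<Rightarrow> param \<Rightarrow> real" where
  "coeffs3 a3 j = (\<lambda>(\<nu>0, \<nu>1, \<nu>2).
     if j = 0 then \<nu>0 else if j = 1 then \<nu>1 else if j = 2 then \<nu>2 else if j = 3 then a3 else 0)"

definition amp3 :: "real \<Rightarrow> param \<Rightarrow> real \<Rightarrow> real" where
  "amp3 a3 \<nu> = amplitude 3 (\<lambda>j. coeffs3 a3 j \<nu>)"

definition radii3 :: "real \<Rightarrow> param \<Rightarrow> real set" where
  "radii3 a3 \<nu> = hypertorus_radii 3 (\<lambda>j. coeffs3 a3 j \<nu>)"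

definition trajectory3 ::
  "nat \<Rightarrow> nat \<Rightarrow> (nat \<Rightarrow> nat) \<Rightarrow> (nat \<Rightarrow> real) \<Rightarrow> real \<Rightarrow> (nat \<Rightarrow> real) \<Rightarrow>
   (nat \<Rightarrow> nat \<Rightarrow> param \<Rightarrow> real) \<Rightarrow> param \<Rightarrow> real set \<Rightarrow> (real \<Rightarrow> state) \<Rightarrow> bool" where
  "trajectory3 n k \<sigma> c a3 \<omega> b \<nu> =
     leaf_trajectory n k \<sigma> c 3 (\<lambda>j. coeffs3 a3 j \<nu>) \<omega> (\<lambda>i j. b i j \<nu>)"

definition stable_hypertorus ::
  "nat \<Rightarrow> nat \<Rightarrow> (nat \<Rightarrow> nat) \<Rightarrow> (nat \<Rightarrow> real) \<Rightarrow> real \<Rightarrow> (nat \<Rightarrow> real) \<Rightarrow>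
   (nat \<Rightarrow> nat \<Rightarrow> param \<Rightarrow> real) \<Rightarrow> param \<Rightarrow> real \<Rightarrow> bool" where
  "stable_hypertorus n k \<sigma> c a3 \<omega> b \<nu> r \<longleftrightarrow> r \<in> radii3 a3 \<nu> \<and>
     asymptotically_stable (trajectory3 n k \<sigma> c a3 \<omega> b \<nu>) (state_dist n) (hypertorus n k \<sigma> c r)"

definition unstable_hypertorus ::
  "nat \<Rightarrow> nat \<Rightarrow> (nat \<Rightarrow> nat) \<Rightarrow> (nat \<Rightarrow> real) \<Rightarrow> real \<Rightarrow> (nat \<Rightarrow> real) \<Rightarrow>
   (nat \<Rightarrow> nat \<Rightarrow> param \<Rightarrow> real) \<Rightarrow> param \<Rightarrow> real \<Rightarrow> bool" where
  "unstable_hypertorus n k \<sigma> c a3 \<omega> b \<nu> r \<longleftrightarrow> r \<in> radii3 a3 \<nu> \<and>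
     \<not> lyapunov_stable (trajectory3 n k \<sigma> c a3 \<omega> b \<nu>) (state_dist n) (hypertorus n k \<sigma> c r)"


section \<open>Bifurcations\<close>

text \<open>Parameters where the qualitative dynamics changes. The equivalence is that of the amplitude
  equations: orbit equivalence of the whole leaf systems would also see the rotation numbers on the
  hypertori.\<close>

definition leaf_bifurcation_params :: "real \<Rightarrow> param set" where
  "leaf_bifurcation_params a3 =
     {\<nu>. \<forall>\<delta>>0. \<exists>\<nu>'. dist \<nu>' \<nu> < \<delta> \<and> \<not> orbit_equivalent UNIV UNIV (amp3 a3 \<nu>) (amp3 a3 \<nu>')}"

text \<open>When the parameter passes through \<open>\<nu>\<close> in the direction \<open>v\<close>, a hypertorus, of radius \<open>r t\<close> at
  \<open>\<nu> + t v\<close>, is born at the origin.\<close>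

definition bifurcates_from_origin :: "real \<Rightarrow> param \<Rightarrow> param \<Rightarrow> (real \<Rightarrow> real) \<Rightarrow> bool" where
  "bifurcates_from_origin a3 \<nu> v r \<longleftrightarrow> (r \<longlongrightarrow> 0) (at_right 0) \<and>
     (\<exists>\<epsilon>>0. \<exists>\<tau>>0.
        (\<forall>t\<in>{0<..<\<tau>}. radii3 a3 (\<nu> + t *\<^sub>R v) \<inter> {0<..<\<epsilon>} = {r t}) \<and>
        (\<forall>t\<in>{0..<\<tau>}. radii3 a3 (\<nu> - t *\<^sub>R v) \<inter> {0<..<\<epsilon>} = {}))"

text \<open>A pair consisting of a stable and an unstable object is born at \<open>x\<close> when the parameter passes
  through \<open>\<nu>\<close> in the direction \<open>v\<close>. It is the differences of the numbers on the two sides that are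
  prescribed, so that points where a further object passes through \<open>x\<close> are included.\<close>

definition pair_creation ::
  "(param \<Rightarrow> real set) \<Rightarrow> (param \<Rightarrow> real set) \<Rightarrow> param \<Rightarrow> param \<Rightarrow> real \<Rightarrow> bool" where
  "pair_creation Ss Us \<nu> v x \<longleftrightarrow>
     (\<exists>\<epsilon>\<^sub>0>0. \<forall>\<epsilon>. 0 < \<epsilon> \<and> \<epsilon> < \<epsilon>\<^sub>0 \<longrightarrow> (\<exists>\<tau>>0. \<forall>t\<in>{0<..<\<tau>}.
        card (Ss (\<nu> + t *\<^sub>R v) \<inter> {x-\<epsilon><..<x+\<epsilon>}) = card (Ss (\<nu> - t *\<^sub>R v) \<inter> {x-\<epsilon><..<x+\<epsilon>}) + 1 \<and>
        card (Us (\<nu> + t *\<^sub>R v) \<inter> {x-\<epsilon><..<x+\<epsilon>}) = card (Us (\<nu> - t *\<^sub>R v) \<inter> {x-\<epsilon><..<x+\<epsilon>}) + 1))"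

text \<open>The saddle-node occurs at \<open>r\<close> and \<open>-r\<close> for the amplitude equation, and for the hypertori of the
  leaf at radius \<open>r\<close>, in one and the same one-parameter subfamily.\<close>

definition double_saddle_node ::
  "nat \<Rightarrow> nat \<Rightarrow> (nat \<Rightarrow> nat) \<Rightarrow> (nat \<Rightarrow> real) \<Rightarrow> real \<Rightarrow> (nat \<Rightarrow> real) \<Rightarrow>
   (nat \<Rightarrow> nat \<Rightarrow> param \<Rightarrow> real) \<Rightarrow> param \<Rightarrow> real \<Rightarrow> bool" where
  "double_saddle_node n k \<sigma> c a3 \<omega> b \<nu> r \<longleftrightarrow> r \<in> radii3 a3 \<nu> \<and>
     (\<exists>v. (\<forall>x\<in>{r, -r}. pair_creation (\<lambda>\<mu>. stable_equilibria (amp3 a3 \<mu>))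
                          (\<lambda>\<mu>. unstable_equilibria (amp3 a3 \<mu>)) \<nu> v x) \<and>
          pair_creation (\<lambda>\<mu>. {q. stable_hypertorus n k \<sigma> c a3 \<omega> b \<mu> q})
                        (\<lambda>\<mu>. {q. unstable_hypertorus n k \<sigma> c a3 \<omega> b \<mu> q}) \<nu> v r)"

text \<open>The usual nondegeneracy and transversality conditions for a saddle-node.\<close>

definition nondegenerate_saddle_node :: "(param \<Rightarrow> real \<Rightarrow> real) \<Rightarrow> param \<Rightarrow> real \<Rightarrow> bool" where
  "nondegenerate_saddle_node F \<nu> x \<longleftrightarrow>
     F \<nu> x = 0 \<and> deriv (F \<nu>) x = 0 \<and> deriv (deriv (F \<nu>)) x \<noteq> 0 \<and>
     (\<exists>v d. ((\<lambda>t. F (\<nu> + t *\<^sub>R v) x) has_real_derivative d) (at 0) \<and> d \<noteq> 0)"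


section \<open>The varieties\<close>

definition T_Psup :: "param set" where
  "T_Psup = {(\<nu>0, \<nu>1, \<nu>2). \<nu>0 = 0 \<and> (\<nu>1 < 0 \<or> (\<nu>1 = 0 \<and> \<nu>2 < 0))}"

definition T_Psub :: "param set" where
  "T_Psub = {(\<nu>0, \<nu>1, \<nu>2). \<nu>0 = 0 \<and> (\<nu>1 > 0 \<or> (\<nu>1 = 0 \<and> \<nu>2 > 0))}"

definition Delta :: "real \<Rightarrow> param \<Rightarrow> real" where
  "Delta a3 = (\<lambda>(\<nu>0, \<nu>1, \<nu>2).
     4 * (\<nu>1 / a3 - \<nu>2\<^sup>2 / (3 * a3\<^sup>2)) ^ 3 +
     27 * (2 * \<nu>2 ^ 3 / (27 * a3 ^ 3) - \<nu>2 * \<nu>1 / (3 * a3\<^sup>2) + \<nu>0 / a3)\<^sup>2)"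

definition T_2SN :: "real \<Rightarrow> param set" where
  "T_2SN a3 = {(\<nu>0, \<nu>1, \<nu>2). Delta a3 (\<nu>0, \<nu>1, \<nu>2) = 0 \<and>
     ((\<nu>2 / a3 < 0 \<and> \<nu>1 / a3 > 0) \<or> (\<nu>0 / a3 > 0 \<and> \<nu>1 / a3 \<le> 0))}"

end

theory Submission
  imports Defs "HOL-Probability.Discrete_Topology"
begin

text \<open>
  In the variable \<open>u = \<rho>\<^sup>2\<close> the amplitude equation is governed by the cubic
  \<open>P(u) = \<nu>\<^sub>0 + \<nu>\<^sub>1 u + \<nu>\<^sub>2 u\<^sup>2 + a\<^sub>3 u\<^sup>3\<close>, and every claim reduces to a statement about its nonnegative roots and its signs.

  A scalar flow is known, up to the speed, from the signs of its field: \<open>y\<close> is reached from \<open>x\<close> iff the field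
  does not vanish between them and points from \<open>x\<close> to \<open>y\<close> (\<open>forward_orbit_iff\<close>). Therefore fields with equal signs
  are orbit equivalent through the identity, orbit equivalences preserve the number of equilibria, and an
  isolated equilibrium is asymptotically stable if the field points towards it on both sides and not even
  Lyapunov stable otherwise (\<open>stable_equilibria_eq\<close>). On the leaf the distance of a state from the hypertorus of radius \<open>r\<close>
  is \<open>\<bar>\<rho> - r\<bar> / c\<^bsub>\<sigma>(k)\<^esub>\<close>, since the squares of the entries of \<open>c\<close> add up to 1, and amplitude solutions lift to the leaf.
  So hypertori and equilibria have the same stability (\<open>stable_hypertorus_iff\<close>).

  On \<open>T_Psup\<close> the cubic vanishes at 0 and decreases afterwards, so adding a small positive constant creates
  exactly one small root, with negative slope (\<open>bifurcates_at_T_Psup\<close>). Changing the sign of \<open>a\<^sub>3\<close> and \<open>\<nu>\<close> gives the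
  result for \<open>T_Psub\<close>.

  The equation \<open>D = 0\<close> says that \<open>P = a\<^sub>3 (u - u\<^sub>2) (u - u\<^sub>1)\<^sup>2\<close> for some real roots, and the sign conditions in
  \<open>T_2SN\<close> say that \<open>u\<^sub>1 > 0\<close> (\<open>T_2SN_eq\<close>). In the direction \<open>- a\<^sub>3 (u - u\<^sub>2)\<close> the cubic becomes
  \<open>a\<^sub>3 (u - u\<^sub>2) ((u - u\<^sub>1)\<^sup>2 - t)\<close>, which creates a stable and an unstable equilibrium near the square root of \<open>u\<^sub>1\<close>,
  even when \<open>u\<^sub>2 = u\<^sub>1\<close> (\<open>pair_creation_at_double_root\<close>). Conversely, two distinct zeros that merge at \<open>r\<close> make the
  derivative of \<open>P\<close> vanish at \<open>r\<^sup>2\<close> (\<open>pair_creation_imp_double_root\<close>).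

  Seven-determinacy is a Weierstrass preparation argument (\<open>determined_coeffs3\<close>). For a perturbed series \<open>G\<^sub>\<nu>\<close> and
  every small \<open>\<mu>\<close> there is a parameter \<open>\<nu> = \<psi>(\<mu>)\<close> such that the cubic \<open>P\<^sub>\<mu>\<close> divides \<open>G\<^sub>\<nu>\<close> with a quotient that is positive
  near 0. Thus both amplitude fields have the same signs on a common neighbourhood of the origin. The
  quotient is the fixed point of a contraction in a space of bounded sequences, and \<open>\<psi>\<close> is continuous and
  injective, hence a homeomorphism onto an open set by invariance of domain.
\<close>

section \<open>Orbits of scalar equations\<close>

text \<open>The difference quotient of \<open>f\<close> at the zero \<open>z\<close>, completed at \<open>z\<close> by the derivative, is continuous
  and hence bounded on compact sets.\<close>

lemma linear_bound_at_zero: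
  fixes f :: "real \<Rightarrow> real"
  assumes diff: "\<And>x. x \<in> U \<Longrightarrow> f differentiable (at x)"
    and S: "compact S" "S \<subseteq> U" and z: "z \<in> U" "f z = 0"
  obtains L where "\<And>w. w \<in> S \<Longrightarrow> \<bar>f w\<bar> \<le> L * \<bar>w - z\<bar>"
proof -
  obtain D where "(f has_real_derivative D) (at z)"
    using diff[OF z(1)] by (auto simp: real_differentiable_def)
  then obtain q where q: "\<And>w. f w - f z = q w * (w - z)" and qz: "isCont q z"
    unfolding CARAT_DERIV by blast
  have "isCont q w" if w: "w \<in> U" for w
  proof (cases "w = z")
    case False
    have "isCont (\<lambda>w. f w / (w - z)) w"
      using False diff[OF w] by (intro continuous_intros differentiable_imp_continuous_within) auto
    moreover have "\<forall>\<^sub>F v in nhds w. q v = f v / (v - z)"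
      using t1_space_nhds[OF False] by eventually_elim (use q z in auto)
    ultimately show ?thesis
      by (metis isCont_cong)
  qed (use qz in simp)
  then have "continuous_on S q"
    using S by (intro continuous_at_imp_continuous_on) auto
  then have "bounded (q ` S)"
    using S compact_continuous_image compact_imp_bounded by blast
  then obtain L where L: "\<And>w. w \<in> S \<Longrightarrow> \<bar>q w\<bar> \<le> L"
    by (auto simp: bounded_iff)
  show thesis
    by (rule that[of L]) (use L q z in \<open>auto simp: abs_mult intro!: mult_right_mono\<close>)
qed

lemma solution_continuous: "solution_on f U J \<phi> \<Longrightarrow> continuous_on J \<phi>"
  unfolding solution_on_def
  by (auto intro!: DERIV_continuous_on)

lemma solution_subset: "solution_on f U J \<phi> \<Longrightarrow> I \<subseteq> J \<Longrightarrow> solution_on f U I \<phi>"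
  unfolding solution_on_def by (meson has_field_derivative_subset subset_iff)

text \<open>Uniqueness at equilibria, forwards and backwards in time. With the linear bound \<open>L\<close> of \<open>f\<close> on the compact
  range of the solution, Gronwall's argument applies to the squared distance from the equilibrium.\<close>

lemma solution_through_zero_constant:
  assumes sol: "solution_on f U {0..T} \<phi>" and diff: "\<And>x. x \<in> U \<Longrightarrow> f differentiable (at x)"
    and s: "s \<in> {0..T}" "f (\<phi> s) = 0" and t: "t \<in> {0..T}"
  shows "\<phi> t = \<phi> s"
proof -
  have cont: "continuous_on {0..T} \<phi>"
    using sol by (rule solution_continuous)
  have inU: "\<phi> \<tau> \<in> U" if "\<tau> \<in> {0..T}" for \<tau>
    using sol that by (auto simp: solution_on_def)
  obtain L where L: "\<And>w. w \<in> \<phi> ` {0..T} \<Longrightarrow> \<bar>f w\<bar> \<le> L * \<bar>w - \<phi> s\<bar>"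
    using linear_bound_at_zero[of U f "\<phi> ` {0..T}" "\<phi> s"] diff inU s cont
    by (metis compact_Icc compact_continuous_image image_subsetI)
  have der: "(\<phi> has_real_derivative f (\<phi> \<tau>)) (at \<tau>)" if "0 < \<tau>" "\<tau> < T" for \<tau>
    using sol that by (auto simp: solution_on_def at_within_Icc_at dest!: bspec[of _ _ \<tau>])
  have bd: "\<bar>(\<phi> \<tau> - \<phi> s) * f (\<phi> \<tau>)\<bar> \<le> L * (\<phi> \<tau> - \<phi> s)\<^sup>2" if "0 \<le> \<tau>" "\<tau> \<le> T" for \<tau>
    using mult_left_mono[OF L[of "\<phi> \<tau>"], of "\<bar>\<phi> \<tau> - \<phi> s\<bar>"] that
    by (auto simp: abs_mult power2_eq_square algebra_simps simp flip: abs_mult)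
  have E: "(\<phi> t - \<phi> s)\<^sup>2 = 0"
  proof (cases "s \<le> t")
    case True
    have "(\<phi> t - \<phi> s)\<^sup>2 * exp (- 2 * L * t) \<le> (\<phi> s - \<phi> s)\<^sup>2 * exp (- 2 * L * s)"
    proof (rule DERIV_nonpos_imp_decreasing_open[OF True])
      fix \<tau> assume \<tau>: "s < \<tau>" "\<tau> < t"
      have "((\<lambda>\<tau>. (\<phi> \<tau> - \<phi> s)\<^sup>2 * exp (- 2 * L * \<tau>)) has_real_derivative
          2 * ((\<phi> \<tau> - \<phi> s) * f (\<phi> \<tau>) - L * (\<phi> \<tau> - \<phi> s)\<^sup>2) * exp (- 2 * L * \<tau>)) (at \<tau>)"
        using \<tau> s t by (auto intro!: derivative_eq_intros der simp: algebra_simps power2_eq_square)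
      moreover have "2 * ((\<phi> \<tau> - \<phi> s) * f (\<phi> \<tau>) - L * (\<phi> \<tau> - \<phi> s)\<^sup>2) * exp (- 2 * L * \<tau>) \<le> 0"
        using abs_le_D1[OF bd[of \<tau>]] \<tau> s t by (simp add: mult_le_0_iff)
      ultimately show "\<exists>y. ((\<lambda>\<tau>. (\<phi> \<tau> - \<phi> s)\<^sup>2 * exp (- 2 * L * \<tau>)) has_real_derivative y) (at \<tau>) \<and> y \<le> 0"
        by blast
    next
      show "continuous_on {s..t} (\<lambda>\<tau>. (\<phi> \<tau> - \<phi> s)\<^sup>2 * exp (- 2 * L * \<tau>))"
        using s t by (intro continuous_intros continuous_on_subset[OF cont]) auto
    qed
    then show ?thesis by (simp add: mult_le_0_iff not_le)
  next
    case False
    then have "t \<le> s" by simp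
    then have "(\<phi> t - \<phi> s)\<^sup>2 * exp (2 * L * t) \<le> (\<phi> s - \<phi> s)\<^sup>2 * exp (2 * L * s)"
    proof (rule DERIV_nonneg_imp_increasing_open)
      fix \<tau> assume \<tau>: "t < \<tau>" "\<tau> < s"
      have "((\<lambda>\<tau>. (\<phi> \<tau> - \<phi> s)\<^sup>2 * exp (2 * L * \<tau>)) has_real_derivative
          2 * ((\<phi> \<tau> - \<phi> s) * f (\<phi> \<tau>) + L * (\<phi> \<tau> - \<phi> s)\<^sup>2) * exp (2 * L * \<tau>)) (at \<tau>)"
        using \<tau> s t by (auto intro!: derivative_eq_intros der simp: algebra_simps power2_eq_square)
      moreover have "2 * ((\<phi> \<tau> - \<phi> s) * f (\<phi> \<tau>) + L * (\<phi> \<tau> - \<phi> s)\<^sup>2) * exp (2 * L * \<tau>) \<ge> 0"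
        using abs_le_D2[OF bd[of \<tau>]] \<tau> s t by simp
      ultimately show "\<exists>y. ((\<lambda>\<tau>. (\<phi> \<tau> - \<phi> s)\<^sup>2 * exp (2 * L * \<tau>)) has_real_derivative y) (at \<tau>) \<and> y \<ge> 0"
        by blast
    next
      show "continuous_on {t..s} (\<lambda>\<tau>. (\<phi> \<tau> - \<phi> s)\<^sup>2 * exp (2 * L * \<tau>))"
        using s t by (intro continuous_intros continuous_on_subset[OF cont]) auto
    qed
    then show ?thesis by (simp add: mult_le_0_iff not_le)
  qed
  then show ?thesis by simp
qed

lemma forward_orbitD:
  assumes y: "y \<in> forward_orbit U f x" and diff: "\<And>x. x \<in> U \<Longrightarrow> f differentiable (at x)"
  shows "y = x \<or> (x < y \<and> (\<forall>z\<in>{x..y}. z \<in> U \<and> f z > 0)) \<or> (y < x \<and> (\<forall>z\<in>{y..x}. z \<in> U \<and> f z < 0))"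
proof -
  obtain T \<phi> where T: "T \<ge> 0" and sol: "solution_on f U {0..T} \<phi>" and x: "\<phi> 0 = x" and y: "\<phi> T = y"
    using y by (auto simp: forward_orbit_def)
  have cont: "continuous_on {0..T} \<phi>"
    using sol by (rule solution_continuous)
  have inU: "\<phi> \<tau> \<in> U" if "\<tau> \<in> {0..T}" for \<tau>
    using sol that by (auto simp: solution_on_def)
  have der: "(\<phi> has_real_derivative f (\<phi> \<tau>)) (at \<tau>)" if "0 < \<tau>" "\<tau> < T" for \<tau>
    using sol that by (auto simp: solution_on_def at_within_Icc_at dest!: bspec[of _ _ \<tau>])
  have contf: "continuous_on {0..T} (\<lambda>t. f (\<phi> t))"
    using diff inU
    by (intro continuous_on_compose2[OF _ cont, of U] continuous_at_imp_continuous_on)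
       (auto intro: differentiable_imp_continuous_within)
  show ?thesis
  proof (cases "\<exists>s\<in>{0..T}. f (\<phi> s) = 0")
    case True
    then obtain s where "s \<in> {0..T}" "f (\<phi> s) = 0" by blast
    then have "\<phi> T = \<phi> s" "\<phi> 0 = \<phi> s"
      using T by (auto intro!: solution_through_zero_constant[OF sol diff])
    then show ?thesis using x y by simp
  next
    case False
    \<comment> \<open>The velocity keeps its sign along the solution, which is therefore monotone and attains every
      value between its ends.\<close>
    have attained: "\<exists>t\<in>{0..T}. \<phi> t = z" if "z \<in> {x..y} \<or> z \<in> {y..x}" for z
      using that
    proof
      assume "z \<in> {x..y}"
      then have "\<exists>t\<ge>0. t \<le> T \<and> \<phi> t = z" using T cont x y by (intro IVT') auto
      then show ?thesis by auto
    next
      assume "z \<in> {y..x}"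
      then have "\<exists>t\<ge>0. t \<le> T \<and> \<phi> t = z" using T cont x y by (intro IVT2') auto
      then show ?thesis by auto
    qed
    show ?thesis
    proof (cases "f x > 0")
      case pos: True
      have P: "f (\<phi> t) > 0" if t: "t \<in> {0..T}" for t
      proof (rule ccontr)
        assume "\<not> f (\<phi> t) > 0"
        then have "\<exists>s\<ge>0. s \<le> t \<and> f (\<phi> s) = 0"
          using t pos x by (intro IVT2') (auto intro: continuous_on_subset[OF contf])
        then show False using False t by auto
      qed
      have "x \<le> y"
        unfolding x[symmetric] y[symmetric]
      proof (rule DERIV_nonneg_imp_increasing_open[OF T _ cont])
        fix t assume "0 < t" "t < T"
        then show "\<exists>v. (\<phi> has_real_derivative v) (at t) \<and> 0 \<le> v"
          using der[of t] P[of t] by (intro exI[of _ "f (\<phi> t)"]) simp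
      qed
      moreover have "z \<in> U \<and> f z > 0" if "z \<in> {x..y}" for z
        using attained[of z] that P inU by blast
      ultimately show ?thesis by force
    next
      case neg: False
      then have neg: "f x < 0" using False T x by (metis atLeastAtMost_iff order_refl linorder_neqE)
      have P: "f (\<phi> t) < 0" if t: "t \<in> {0..T}" for t
      proof (rule ccontr)
        assume "\<not> f (\<phi> t) < 0"
        then have "\<exists>s\<ge>0. s \<le> t \<and> f (\<phi> s) = 0"
          using t neg x by (intro IVT') (auto intro: continuous_on_subset[OF contf])
        then show False using False t by auto
      qed
      have "y \<le> x"
        unfolding x[symmetric] y[symmetric]
      proof (rule DERIV_nonpos_imp_decreasing_open[OF T _ cont])
        fix t assume "0 < t" "t < T"
        then show "\<exists>v. (\<phi> has_real_derivative v) (at t) \<and> v \<le> 0"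
          using der[of t] P[of t] by (intro exI[of _ "f (\<phi> t)"]) simp
      qed
      moreover have "z \<in> U \<and> f z < 0" if "z \<in> {y..x}" for z
        using attained[of z] that P inU by blast
      ultimately show ?thesis by force
    qed
  qed
qed

text \<open>Where \<open>f\<close> is positive, the time needed to get from \<open>x\<close> to \<open>w\<close> is the integral of \<open>1 / f\<close>; the solution
  is the inverse of this function.\<close>

lemma solution_upward:
  fixes f :: "real \<Rightarrow> real"
  assumes xy: "x < y" and cont: "continuous_on {x..y} f" and pos: "\<And>z. z \<in> {x..y} \<Longrightarrow> f z > 0"
  obtains T \<phi> where "T \<ge> 0" "solution_on f {x..y} {0..T} \<phi>" "\<phi> 0 = x" "\<phi> T = y"
proof -
  \<comment> \<open>Outside \<open>{x..y}\<close> the field is continued constantly, so that \<open>x\<close> and \<open>y\<close> become interior points and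
    the inverse function theorem applies there, too.\<close>
  define F where "F w = f (max x (min y w))" for w
  have F: "F w > 0" "w \<in> {x..y} \<Longrightarrow> F w = f w" for w
    using xy pos by (auto simp: F_def)
  have contF: "continuous_on A F" for A
    unfolding F_def using xy by (intro continuous_on_compose2[OF cont] continuous_intros) auto
  have "continuous_on {x-1..y+1} (\<lambda>w. 1 / F w)"
    using F(1) by (intro continuous_intros contF) (metis less_irrefl)
  then obtain g where g: "\<And>w. w \<in> {x-1..y+1} \<Longrightarrow> (g has_vector_derivative 1 / F w) (at w within {x-1..y+1})"
    using antiderivative_continuous by metis
  define G where "G w = g w - g x" for w
  have G: "(G has_real_derivative 1 / F w) (at w)" if "w \<in> {x-1<..<y+1}" for w
  proof -
    have "(g has_real_derivative 1 / F w) (at w)"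
      using g[of w] that by (simp add: at_within_Icc_at has_real_derivative_iff_has_vector_derivative)
    then show ?thesis unfolding G_def by (auto intro!: derivative_eq_intros)
  qed
  have contG: "continuous_on {x-1<..<y+1} G"
    using G by (meson DERIV_isCont continuous_at_imp_continuous_on)
  have mono: "G v < G w" if "v < w" "v \<in> {x-1<..<y+1}" "w \<in> {x-1<..<y+1}" for v w
  proof (rule DERIV_pos_imp_increasing[OF that(1)])
    fix u assume "v \<le> u" "u \<le> w"
    then show "\<exists>D. (G has_real_derivative D) (at u) \<and> 0 < D"
      using G[of u] F(1)[of u] that by (intro exI[of _ "1 / F u"]) auto
  qed
  then have inj: "inj_on G {x-1<..<y+1}"
    unfolding inj_on_def by (metis linorder_neqE less_irrefl)
  define \<phi> where "\<phi> = inv_into {x-1<..<y+1} G"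
  have \<phi>G: "\<phi> (G w) = w" if "w \<in> {x-1<..<y+1}" for w
    unfolding \<phi>_def using inj that by (rule inv_into_f_f)
  have G0: "G x = 0" by (simp add: G_def)
  have "G x < G y" by (rule mono) (use xy in auto)
  have sol: "\<phi> t \<in> {x..y} \<and> (\<phi> has_real_derivative f (\<phi> t)) (at t within {0..G y})"
    if t: "t \<in> {0..G y}" for t
  proof -
    have "\<exists>w\<ge>x. w \<le> y \<and> G w = t"
      by (rule IVT') (use t G0 xy in \<open>auto intro: continuous_on_subset[OF contG]\<close>)
    then obtain w where w: "w \<in> {x..y}" "G w = t" by auto
    have "(\<phi> has_derivative (\<lambda>v. F w * v)) (at (G w))"
    proof (rule has_derivative_inverse_strong[OF _ _ contG])
      have "w \<in> {x-1<..<y+1}" using w by auto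
      then show "(G has_derivative (*) (1 / F w)) (at w)"
        using G by (simp only: has_field_derivative_def)
      show "(*) (1 / F w) \<circ> (\<lambda>v. F w * v) = id"
        using F(1)[of w] by (auto simp: fun_eq_iff)
    qed (use w \<phi>G in auto)
    then have "(\<phi> has_real_derivative F w) (at (G w))"
      by (simp add: has_field_derivative_def)
    then show ?thesis
      using w \<phi>G[of w] F(2) by (auto intro: has_field_derivative_at_within)
  qed
  show thesis
  proof (rule that)
    show "solution_on f {x..y} {0..G y} \<phi>" using sol by (simp add: solution_on_def)
    show "\<phi> 0 = x" using \<phi>G[of x] xy G0 by simp
    show "\<phi> (G y) = y" using \<phi>G[of y] xy by simp
    show "0 \<le> G y" using \<open>G x < G y\<close> G0 by simp
  qed
qed

lemma forward_orbit_upward: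
  assumes "x < y" "continuous_on {x..y} f" "\<And>z. z \<in> {x..y} \<Longrightarrow> z \<in> U \<and> f z > 0"
  shows "y \<in> forward_orbit U f x"
proof -
  obtain T \<phi> where *: "T \<ge> 0" "solution_on f {x..y} {0..T} \<phi>" "\<phi> 0 = x" "\<phi> T = y"
    using solution_upward[OF assms(1,2)] assms(3) by blast
  then have "solution_on f U {0..T} \<phi>"
    using assms(3) by (auto simp: solution_on_def)
  then show ?thesis using * unfolding forward_orbit_def by blast
qed

lemma forward_orbit_uminus:
  assumes "y \<in> forward_orbit U f x"
  shows "- y \<in> forward_orbit (uminus ` U) (\<lambda>z. - f (- z)) (- x)"
proof -
  obtain T \<phi> where *: "T \<ge> 0" "solution_on f U {0..T} \<phi>" "\<phi> 0 = x" "\<phi> T = y"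
    using assms unfolding forward_orbit_def by blast
  then have "solution_on (\<lambda>z. - f (- z)) (uminus ` U) {0..T} (\<lambda>t. - \<phi> t)"
    by (auto simp: solution_on_def intro!: derivative_intros)
  then show ?thesis using * unfolding forward_orbit_def by blast
qed

lemma forward_orbit_downward:
  assumes "y < x" "continuous_on {y..x} f" "\<And>z. z \<in> {y..x} \<Longrightarrow> z \<in> U \<and> f z < 0"
  shows "y \<in> forward_orbit U f x"
proof -
  have "- y \<in> forward_orbit (uminus ` U) (\<lambda>z. - f (- z)) (- x)"
  proof (rule forward_orbit_upward)
    show "continuous_on {- x..- y} (\<lambda>z. - f (- z))"
      by (intro continuous_intros continuous_on_compose2[OF assms(2)]) auto
    fix z assume "z \<in> {- x..- y}"
    then have "- z \<in> {y..x}" by auto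
    from assms(3)[OF this] show "z \<in> uminus ` U \<and> - f (- z) > 0" by force
  qed (use assms in auto)
  from forward_orbit_uminus[OF this] show ?thesis by (simp add: image_image)
qed

text \<open>The orbits of a scalar equation depend only on the signs of the field. This is the key to all statements
  about orbit equivalence and stability below.\<close>

lemma forward_orbit_iff:
  assumes diff: "\<And>x. x \<in> U \<Longrightarrow> f differentiable (at x)"
  shows "y \<in> forward_orbit U f x \<longleftrightarrow> (y = x \<and> x \<in> U) \<or>
    (x < y \<and> (\<forall>z\<in>{x..y}. z \<in> U \<and> f z > 0)) \<or> (y < x \<and> (\<forall>z\<in>{y..x}. z \<in> U \<and> f z < 0))"
    (is "_ \<longleftrightarrow> ?R")
proof
  assume y: "y \<in> forward_orbit U f x"
  then have "y \<in> U" by (auto simp: forward_orbit_def solution_on_def)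
  then show ?R using forward_orbitD[OF y diff] by blast
next
  have cont: "continuous_on S f" if "S \<subseteq> U" for S
    using that diff
    by (intro continuous_at_imp_continuous_on) (auto intro: differentiable_imp_continuous_within)
  assume ?R
  then show "y \<in> forward_orbit U f x"
  proof (elim disjE conjE)
    assume "y = x" "x \<in> U"
    then show ?thesis
      unfolding forward_orbit_def solution_on_def
      by (auto intro!: exI[of _ 0] exI[of _ "\<lambda>_. x"] simp: has_field_derivative_iff at_within_def)
  qed (intro forward_orbit_upward forward_orbit_downward cont, auto)+
qed

lemma forward_orbit_cong_sgn:
  assumes "\<And>x. x \<in> U \<Longrightarrow> f differentiable (at x)" "\<And>x. x \<in> U \<Longrightarrow> g differentiable (at x)"
    and "\<And>x. x \<in> U \<Longrightarrow> sgn (f x) = sgn (g x)"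
  shows "forward_orbit U f x = forward_orbit U g x"
proof -
  have *: "z \<in> U \<and> f z > 0 \<longleftrightarrow> z \<in> U \<and> g z > 0" "z \<in> U \<and> f z < 0 \<longleftrightarrow> z \<in> U \<and> g z < 0" for z
    using assms(3)[of z] by (metis sgn_greater, metis sgn_less)
  have "y \<in> forward_orbit U f x \<longleftrightarrow> y \<in> forward_orbit U g x" for y
    by (simp only: forward_orbit_iff[OF assms(1)] forward_orbit_iff[OF assms(2)] *)
  then show ?thesis by blast
qed

lemma orbit_equivalent_if_same_sgn:
  assumes "\<And>x. x \<in> U \<Longrightarrow> f differentiable (at x)" "\<And>x. x \<in> U \<Longrightarrow> g differentiable (at x)"
    and "\<And>x. x \<in> U \<Longrightarrow> sgn (f x) = sgn (g x)"
  shows "orbit_equivalent U U f g"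
  unfolding orbit_equivalent_def
  using forward_orbit_cong_sgn[OF assms, of U]
  by (intro exI[of _ "\<lambda>x. x"]) (auto simp: homeomorphism_def forward_orbit_cong_sgn[OF assms])

lemma orbit_equivalent_sym:
  assumes "orbit_equivalent UNIV UNIV f g"
  shows "orbit_equivalent UNIV UNIV g f"
proof -
  obtain h h' where h: "homeomorphism UNIV UNIV h h'" "\<And>x. h (- x) = - h x"
      "\<And>x. h ` forward_orbit UNIV f x = forward_orbit UNIV g (h x)"
    using assms unfolding orbit_equivalent_def by auto
  have inv: "h' (h x) = x" "h (h' x) = x" for x
    using h(1) by (auto simp: homeomorphism_def)
  have "h' (- x) = - h' x" for x
    by (metis inv h(2))
  moreover have "h' ` forward_orbit UNIV g x = forward_orbit UNIV f (h' x)" for x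
    using arg_cong[OF h(3)[of "h' x"], of "image h'"] by (simp add: inv image_image)
  ultimately show ?thesis
    unfolding orbit_equivalent_def using h(1) homeomorphism_sym by blast
qed

lemma forward_orbit_singleton_iff:
  fixes f :: "real \<Rightarrow> real"
  assumes diff: "\<And>x. f differentiable (at x)"
  shows "forward_orbit UNIV f x = {x} \<longleftrightarrow> f x = 0"
proof
  assume *: "forward_orbit UNIV f x = {x}"
  have cont: "isCont f x" using diff by (rule differentiable_imp_continuous_within)
  show "f x = 0"
  proof (rule ccontr)
    assume "f x \<noteq> 0"
    then consider "f x > 0" | "f x < 0" by linarith
    then show False
    proof cases
      case 1
      then obtain d where d: "d > 0" "\<And>z. dist z x < d \<Longrightarrow> f z > 0"
        using order_tendstoD(1)[OF cont[unfolded isCont_def] 1] 1 unfolding eventually_at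
        by (metis UNIV_I)
      then have "x + d/2 \<in> forward_orbit UNIV f x"
        unfolding forward_orbit_iff[OF diff] by (auto simp: dist_real_def)
      then show False using * d by simp
    next
      case 2
      then obtain d where d: "d > 0" "\<And>z. dist z x < d \<Longrightarrow> f z < 0"
        using order_tendstoD(2)[OF cont[unfolded isCont_def] 2] 2 unfolding eventually_at
        by (metis UNIV_I)
      then have "x - d/2 \<in> forward_orbit UNIV f x"
        unfolding forward_orbit_iff[OF diff] by (auto simp: dist_real_def)
      then show False using * d by simp
    qed
  qed
next
  assume "f x = 0"
  then show "forward_orbit UNIV f x = {x}"
    by (auto simp: forward_orbit_iff[of UNIV f _ x] diff)
       (metis atLeastAtMost_iff less_irrefl less_imp_le order_refl)+
qed

text \<open>Equilibria are the points whose forward orbit is a singleton, so an orbit equivalence carries them to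
  equilibria.\<close>

lemma orbit_equivalent_card_zeros:
  assumes oe: "orbit_equivalent UNIV UNIV f g"
    and diff: "\<And>x. f differentiable (at x)" "\<And>x. g differentiable (at x)"
  shows "card {x. f x = 0} = card {x. g x = 0}"
proof -
  obtain h h' where h: "homeomorphism UNIV UNIV h h'"
      "\<And>x. h ` forward_orbit UNIV f x = forward_orbit UNIV g (h x)"
    using oe unfolding orbit_equivalent_def by auto
  have inv: "h' (h x) = x" "h (h' x) = x" for x
    using h(1) by (auto simp: homeomorphism_def)
  have inj: "inj h" by (metis inv(1) injI)
  have "f x = 0 \<longleftrightarrow> g (h x) = 0" for x
  proof -
    have "f x = 0 \<longleftrightarrow> h ` forward_orbit UNIV f x = h ` {x}"
      using forward_orbit_singleton_iff[OF diff(1)] inj by (metis inj_image_eq_iff)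
    then show ?thesis
      by (simp add: h(2) forward_orbit_singleton_iff[OF diff(2)])
  qed
  then have "bij_betw h {x. f x = 0} {x. g x = 0}"
    using inv by (intro bij_betwI[where g = h']) auto
  then show ?thesis by (rule bij_betw_same_card)
qed

text \<open>An odd homeomorphism fixes the origin. The orbit of a small positive point accumulates at the origin under
  \<open>f\<close>, while no orbit of \<open>g\<close> that starts elsewhere does.\<close>

lemma not_orbit_equivalent_if_origin_differs:
  assumes diff: "\<And>x. f differentiable (at x)" "\<And>x. g differentiable (at x)"
    and f: "d > 0" "\<And>x. 0 < x \<Longrightarrow> x < d \<Longrightarrow> f x < 0"
    and g: "g 0 = 0" "e > 0" "\<And>x. 0 < \<bar>x\<bar> \<Longrightarrow> \<bar>x\<bar> < e \<Longrightarrow> g x * x > 0"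
  shows "\<not> orbit_equivalent UNIV UNIV f g"
proof
  assume "orbit_equivalent UNIV UNIV f g"
  then obtain h h' where h: "homeomorphism UNIV UNIV h h'" "\<And>x. h (- x) = - h x"
      "\<And>x. h ` forward_orbit UNIV f x = forward_orbit UNIV g (h x)"
    unfolding orbit_equivalent_def by auto
  have inv: "h' (h x) = x" for x
    using h(1) by (auto simp: homeomorphism_def)
  have h0: "h 0 = 0" using h(2)[of 0] by simp
  have hnz: "h x \<noteq> 0" if "x \<noteq> 0" for x
    by (metis inv h0 that)
  define x where "x = d / 2"
  have x: "0 < x" "x < d" using f by (auto simp: x_def)
  have "isCont h 0"
    using h(1) by (auto simp: homeomorphism_def continuous_on_eq_continuous_at)
  moreover have "min e \<bar>h x\<bar> > 0" using hnz x g by auto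
  ultimately obtain \<delta> where \<delta>: "\<delta> > 0" "\<And>y. \<bar>y\<bar> < \<delta> \<Longrightarrow> \<bar>h y\<bar> < min e \<bar>h x\<bar>"
    unfolding continuous_at_eps_delta h0 dist_real_def diff_0_right by metis
  \<comment> \<open>A point on the orbit of \<open>x\<close> that is mapped closer to the origin than \<open>x\<close> itself.\<close>
  define y where "y = min (\<delta>/2) (x/2)"
  have y: "0 < y" "y < x" "\<bar>y\<bar> < \<delta>" using \<delta> x by (auto simp: y_def)
  have "y \<in> forward_orbit UNIV f x"
    unfolding forward_orbit_iff[OF diff(1)] using x y f by auto
  then have *: "h y \<in> forward_orbit UNIV g (h x)" using h(3) by blast
  have hy: "0 < \<bar>h y\<bar>" "\<bar>h y\<bar> < e" "\<bar>h y\<bar> < \<bar>h x\<bar>"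
    using \<delta>(2)[of y] y hnz[of y] by auto
  have gy: "g (h y) * h y > 0" using g(3) hy by auto
  from * consider "h y = h x" | "h x < h y" "\<forall>z\<in>{h x..h y}. g z > 0"
      | "h y < h x" "\<forall>z\<in>{h y..h x}. g z < 0"
    unfolding forward_orbit_iff[OF diff(2)] by auto
  then show False
  proof cases
    case 2
    then have gpos: "g (h y) > 0" and "\<not> (h x \<le> 0 \<and> 0 \<le> h y)" using g(1) by force+
    then have "h y < 0" using 2(1) hy by linarith
    then show False using gy mult_pos_neg[OF gpos, of "h y"] by linarith
  next
    case 3
    then have gneg: "g (h y) < 0" and "\<not> (h y \<le> 0 \<and> 0 \<le> h x)" using g(1) by force+
    then have "h y > 0" using 3(1) hy by linarith
    then show False using gy mult_neg_pos[OF gneg, of "h y"] by linarith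
  qed (use hy in auto)
qed

section \<open>Stability of equilibria of scalar equations\<close>

text \<open>For a field with finitely many zeros these are the asymptotically stable equilibria. All later countings of
  stable and unstable objects are done with this set.\<close>

definition attracting :: "(real \<Rightarrow> real) \<Rightarrow> real set" where
  "attracting f = {x. f x = 0 \<and> (\<exists>e>0. \<forall>y. 0 < \<bar>y - x\<bar> \<and> \<bar>y - x\<bar> < e \<longrightarrow> f y * (y - x) < 0)}"

lemma dist_to_set_singleton [simp]: "dist_to_set dist x {r :: real} = \<bar>x - r\<bar>"
  by (simp add: dist_to_set_def dist_real_def)

lemma solution_in_forward_orbit:
  assumes "solution_on f U J \<phi>" "t \<ge> 0" "{0..t} \<subseteq> J"
  shows "\<phi> t \<in> forward_orbit U f (\<phi> 0)"
  using solution_subset[OF assms(1,3)] assms(2) unfolding forward_orbit_def by blast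

text \<open>Near \<open>x\<close> solutions move monotonically towards \<open>x\<close>, since their orbits cannot cross it.\<close>

lemma attracting_asymptotically_stable:
  assumes diff: "\<And>x. f differentiable (at x)" and x: "x \<in> attracting f"
  shows "asymptotically_stable (solution_on f UNIV) dist {x}"
proof -
  obtain e where e: "e > 0" "\<And>y. 0 < \<bar>y - x\<bar> \<Longrightarrow> \<bar>y - x\<bar> < e \<Longrightarrow> f y * (y - x) < 0" and fx: "f x = 0"
    using x by (auto simp: attracting_def)
  have between: "x \<le> \<phi> t \<and> \<phi> t \<le> \<phi> 0 \<or> \<phi> 0 \<le> \<phi> t \<and> \<phi> t \<le> x"
    if sol: "solution_on f UNIV J \<phi>" and t: "t \<ge> 0" "{0..t} \<subseteq> J" and close: "\<bar>\<phi> 0 - x\<bar> < e" for \<phi> J t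
  proof -
    consider "\<phi> t = \<phi> 0" | "\<phi> 0 < \<phi> t" "\<forall>z\<in>{\<phi> 0..\<phi> t}. f z > 0"
        | "\<phi> t < \<phi> 0" "\<forall>z\<in>{\<phi> t..\<phi> 0}. f z < 0"
      using forward_orbitD[OF solution_in_forward_orbit[OF sol t] diff] by auto
    then show ?thesis
    proof cases
      case 2
      then have *: "f (\<phi> 0) > 0" "\<not> (\<phi> 0 \<le> x \<and> x \<le> \<phi> t)" using fx by force+
      then have "\<phi> 0 \<noteq> x" using fx by auto
      then have "\<phi> 0 < x" using e(2)[of "\<phi> 0"] close * by (auto simp: mult_less_0_iff)
      then show ?thesis using 2 * by auto
    next
      case 3
      then have *: "f (\<phi> 0) < 0" "\<not> (\<phi> t \<le> x \<and> x \<le> \<phi> 0)" using fx by force+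
      then have "\<phi> 0 \<noteq> x" using fx by auto
      then have "\<phi> 0 > x" using e(2)[of "\<phi> 0"] close * by (auto simp: mult_less_0_iff)
      then show ?thesis using 3 * by auto
    qed auto
  qed
  have lyap: "lyapunov_stable (solution_on f UNIV) dist {x}"
    unfolding lyapunov_stable_def dist_to_set_singleton
  proof (intro allI impI)
    fix \<epsilon> :: real assume "\<epsilon> > 0"
    show "\<exists>\<delta>>0. \<forall>T\<ge>0. \<forall>p. solution_on f UNIV {0..T} p \<and> \<bar>p 0 - x\<bar> < \<delta> \<longrightarrow> (\<forall>t\<in>{0..T}. \<bar>p t - x\<bar> < \<epsilon>)"
    proof (intro exI[of _ "min \<epsilon> e"] conjI allI impI ballI; (elim conjE)?)
      fix T p t assume "solution_on f UNIV {0..T} p" "\<bar>p 0 - x\<bar> < min \<epsilon> e" "t \<in> {0..T}"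
      then show "\<bar>p t - x\<bar> < \<epsilon>" using between[of "{0..T}" p t] by auto
    qed (use \<open>\<epsilon> > 0\<close> e in auto)
  qed
  have conv: "((\<lambda>t. \<bar>p t - x\<bar>) \<longlongrightarrow> 0) at_top"
    if sol: "solution_on f UNIV {0..} p" and close: "\<bar>p 0 - x\<bar> < e" for p
  proof -
    have cont: "continuous_on S f" for S
      using diff by (intro continuous_at_imp_continuous_on) (auto intro: differentiable_imp_continuous_within)
    \<comment> \<open>The distance from \<open>x\<close> is nonincreasing: the solution is restarted at time \<open>s\<close>.\<close>
    have step: "\<bar>p t - x\<bar> \<le> \<bar>p s - x\<bar>" if st: "0 \<le> s" "s \<le> t" for s t
    proof -
      have "solution_on f UNIV {0..} (\<lambda>\<tau>. p (s + \<tau>))"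
        unfolding solution_on_def
      proof (intro ballI conjI)
        fix \<tau> :: real assume "\<tau> \<in> {0..}"
        have "(p has_real_derivative f (p (s + \<tau>))) (at (s + \<tau>) within (\<lambda>\<tau>. s + \<tau>) ` {0..})"
          using sol \<open>\<tau> \<in> {0..}\<close> st unfolding solution_on_def
          by (auto intro: has_field_derivative_subset)
        then show "((\<lambda>\<tau>. p (s + \<tau>)) has_real_derivative f (p (s + \<tau>))) (at \<tau> within {0..})"
          using DERIV_image_chain[of p _ "\<lambda>\<tau>. s + \<tau>" \<tau> "{0..}" 1]
            DERIV_add[OF DERIV_const[of s] DERIV_ident, of \<tau> "{0..}"]
          by (simp add: o_def)
      qed simp
      moreover have "\<bar>p s - x\<bar> < e" using between[OF sol, of s] st close by auto
      ultimately show ?thesis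
        using between[of "{0..}" "\<lambda>\<tau>. p (s + \<tau>)" "t - s"] st by auto
    qed
    show ?thesis
    proof (rule order_tendstoI)
      fix a :: real assume "0 < a"
      \<comment> \<open>Where the distance stays at least \<open>a\<close>, the speed of approach is bounded below, so this can
        last only for a bounded time.\<close>
      define S where "S = {y. a \<le> \<bar>y - x\<bar> \<and> \<bar>y - x\<bar> \<le> \<bar>p 0 - x\<bar>}"
      have "closed S" unfolding S_def
        by (intro closed_Collect_conj closed_Collect_le continuous_intros)
      moreover have "S \<subseteq> cball x \<bar>p 0 - x\<bar>"
        by (auto simp: S_def dist_real_def abs_minus_commute)
      ultimately have "compact S"
        by (meson bounded_cball bounded_subset compact_eq_bounded_closed)
      have "\<exists>m>0. \<forall>y\<in>S. m \<le> - (f y * (y - x))"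
      proof (cases "S = {}")
        case False
        have "continuous_on S (\<lambda>y. - (f y * (y - x)))"
          by (intro continuous_intros cont)
        from continuous_attains_inf[OF \<open>compact S\<close> False this]
        obtain y where y: "y \<in> S" "\<forall>z\<in>S. - (f y * (y - x)) \<le> - (f z * (z - x))" by blast
        then show ?thesis using e(2)[of y] close \<open>a > 0\<close>
          by (intro exI[of _ "- (f y * (y - x))"]) (auto simp: S_def)
      qed (auto intro: exI[of _ 1])
      then obtain m where m: "m > 0" "\<And>y. y \<in> S \<Longrightarrow> m \<le> - (f y * (y - x))" by blast
      have "\<exists>T\<ge>0. \<bar>p T - x\<bar> < a"
      proof (rule ccontr)
        assume neg: "\<not> ?thesis"
        have inS: "p t \<in> S" if "t \<ge> 0" for t
          using neg that step[of 0 t] by (auto simp: S_def not_less)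
        define T where "T = (p 0 - x)\<^sup>2 / m + 1"
        have T: "T > 0" using m by (auto simp: T_def intro: add_nonneg_pos)
        have cp: "continuous_on {0..T} p"
          using solution_continuous[OF sol] by (rule continuous_on_subset) auto
        have "(p T - x)\<^sup>2 + 2 * m * T \<le> (p 0 - x)\<^sup>2 + 2 * m * 0"
        proof (rule DERIV_nonpos_imp_decreasing_open[of 0 T "\<lambda>t. (p t - x)\<^sup>2 + 2 * m * t"])
          fix t assume t: "0 < t" "t < T"
          have "(p has_real_derivative f (p t)) (at t)"
            using sol t has_field_derivative_at_within at_within_interior[of t "{0..}"]
            by (auto simp: solution_on_def dest!: bspec[of _ _ t])
          then have "((\<lambda>t. (p t - x)\<^sup>2 + 2 * m * t) has_real_derivative 2 * (f (p t) * (p t - x) + m)) (at t)"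
            by (auto intro!: derivative_eq_intros simp: algebra_simps)
          moreover have "2 * (f (p t) * (p t - x) + m) \<le> 0" using m(2)[OF inS[of t]] t by auto
          ultimately show "\<exists>y. ((\<lambda>t. (p t - x)\<^sup>2 + 2 * m * t) has_real_derivative y) (at t) \<and> y \<le> 0" by blast
        qed (use T in \<open>auto intro!: continuous_intros cp\<close>)
        moreover have "m * T = (p 0 - x)\<^sup>2 + m" using m by (simp add: T_def field_simps)
        moreover have "0 \<le> (p T - x)\<^sup>2" "0 \<le> (p 0 - x)\<^sup>2" by simp_all
        ultimately show False using m by linarith
      qed
      then obtain T where "T \<ge> 0" "\<bar>p T - x\<bar> < a" by blast
      then have "\<forall>t\<ge>T. \<bar>p t - x\<bar> < a" using step[of T] by fastforce
      then show "\<forall>\<^sub>F t in at_top. \<bar>p t - x\<bar> < a" by (auto simp: eventually_at_top_linorder)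
    qed (auto intro: always_eventually less_le_trans)
  qed
  show ?thesis
    unfolding asymptotically_stable_def using lyap conv e(1) by auto
qed

text \<open>Zeros are isolated, so the field has a fixed sign on each side of \<open>x\<close>. If \<open>x\<close> is not attracting, it points
  away from \<open>x\<close> on one side, and points arbitrarily close to \<open>x\<close> there reach a fixed point \<open>y\<close>.\<close>

lemma not_attracting_not_stable:
  assumes diff: "\<And>x. f differentiable (at x)" and fin: "finite {x. f x = 0}"
    and x: "f x = 0" "x \<notin> attracting f"
  shows "\<not> lyapunov_stable (solution_on f UNIV) dist {x}"
proof
  assume stable: "lyapunov_stable (solution_on f UNIV) dist {x}"
  have cont: "continuous_on S f" for S
    using diff by (intro continuous_at_imp_continuous_on) (auto intro: differentiable_imp_continuous_within)
  obtain d where d: "d > 0" "\<And>z. f z = 0 \<Longrightarrow> z \<noteq> x \<Longrightarrow> d \<le> \<bar>x - z\<bar>"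
    using finite_set_avoid[OF fin, of x] by (auto simp: dist_real_def)
  obtain y where y: "0 < \<bar>y - x\<bar>" "\<bar>y - x\<bar> < d" "f y * (y - x) > 0"
  proof -
    obtain y where y: "0 < \<bar>y - x\<bar>" "\<bar>y - x\<bar> < d" "\<not> f y * (y - x) < 0"
      using x d(1) unfolding attracting_def by blast
    moreover have "f y \<noteq> 0" using d(2)[of y] y by auto
    ultimately show thesis using that[of y] by (auto simp: not_less less_le)
  qed
  \<comment> \<open>There are no zeros between \<open>x\<close> and \<open>y\<close>, so the flow moves every point of this interval to \<open>y\<close>.\<close>
  have reach: "y \<in> forward_orbit UNIV f w" if w: "x < w \<and> w \<le> y \<or> y \<le> w \<and> w < x" for w
  proof (cases "y = w")
    case True
    then show ?thesis using forward_orbit_iff[of UNIV f y w] diff by auto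
  next
    case False
    show ?thesis
    proof (cases "x < y")
      case True
      then have fy: "f y > 0" using y(3) by (simp add: zero_less_mult_iff)
      have "f z > 0" if z: "z \<in> {w..y}" for z
      proof (rule ccontr)
        assume "\<not> f z > 0"
        then have "\<exists>s\<ge>z. s \<le> y \<and> f s = 0" using fy z by (intro IVT' cont) auto
        then obtain s where "s \<ge> z" "s \<le> y" "f s = 0" by blast
        then show False using d(2)[of s] y(2) z w True by auto
      qed
      then show ?thesis using w True False by (auto simp: forward_orbit_iff[of UNIV f] diff)
    next
      case F: False
      then have xy: "y < x" using y(1) by auto
      then have fy: "f y < 0" using y(3) by (simp add: zero_less_mult_iff)
      have "f z < 0" if z: "z \<in> {y..w}" for z
      proof (rule ccontr)
        assume "\<not> f z < 0"
        then have "\<exists>s\<ge>y. s \<le> z \<and> f s = 0" using fy z by (intro IVT' cont) auto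
        then obtain s where "s \<ge> y" "s \<le> z" "f s = 0" by blast
        then show False using d(2)[of s] y(2) z w xy by auto
      qed
      then show ?thesis using w xy False by (auto simp: forward_orbit_iff[of UNIV f] diff)
    qed
  qed
  obtain \<delta> where \<delta>: "\<delta> > 0" "\<And>T p t. T \<ge> 0 \<Longrightarrow> solution_on f UNIV {0..T} p \<Longrightarrow> \<bar>p 0 - x\<bar> < \<delta> \<Longrightarrow> t \<in> {0..T}
      \<Longrightarrow> \<bar>p t - x\<bar> < \<bar>y - x\<bar>"
    using stable[unfolded lyapunov_stable_def dist_to_set_singleton, rule_format, OF y(1)] by metis
  define w where "w = (if x < y then min y (x + \<delta>/2) else max y (x - \<delta>/2))"
  have "x < w \<and> w \<le> y \<or> y \<le> w \<and> w < x" "\<bar>w - x\<bar> < \<delta>"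
    using \<delta>(1) y(1) by (auto simp: w_def min_def max_def)
  then obtain T \<phi> where "T \<ge> 0" "solution_on f UNIV {0..T} \<phi>" "\<phi> 0 = w" "\<phi> T = y"
    using reach unfolding forward_orbit_def by blast
  then show False using \<delta>(2)[of T \<phi> T] \<open>\<bar>w - x\<bar> < \<delta>\<close> by auto
qed

lemma stable_equilibria_eq:
  assumes diff: "\<And>x. f differentiable (at x)" and fin: "finite {x. f x = 0}"
  shows "stable_equilibria f = attracting f"
    and "unstable_equilibria f = {x. f x = 0} - attracting f"
proof -
  have "asymptotically_stable tr d A \<Longrightarrow> lyapunov_stable tr d A" for tr :: "real set \<Rightarrow> (real \<Rightarrow> real) \<Rightarrow> bool" and d A
    by (simp add: asymptotically_stable_def)
  moreover have "f x = 0" if "x \<in> attracting f" for x using that by (simp add: attracting_def)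
  ultimately show "stable_equilibria f = attracting f"
    and "unstable_equilibria f = {x. f x = 0} - attracting f"
    unfolding stable_equilibria_def unstable_equilibria_def
    using attracting_asymptotically_stable[OF diff] not_attracting_not_stable[OF diff fin]
    by blast+
qed

section \<open>Stability of hypertori on the leaf\<close>

lemma amplitude_differentiable [simp]: "amplitude s a differentiable (at x)"
proof -
  have "(\<lambda>r. r * (\<Sum>j\<le>s. a j * r ^ (2 * j))) differentiable (at x)"
    by (intro derivative_intros) auto
  then show ?thesis by (simp add: amplitude_def [abs_def])
qed

lemma amplitude_0 [simp]: "amplitude s a 0 = 0"
  by (simp add: amplitude_def)

lemma solution_stays_positive:
  assumes sol: "solution_on f UNIV {0..T} \<phi>" and diff: "\<And>x. f differentiable (at x)"
    and f0: "f 0 = 0" and pos: "\<phi> 0 > 0" and t: "t \<in> {0..T}"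
  shows "\<phi> t > 0"
proof (rule ccontr)
  assume "\<not> \<phi> t > 0"
  then have "\<phi> t < \<phi> 0" "0 \<in> {\<phi> t..\<phi> 0}" using pos by auto
  moreover have "\<phi> t \<in> forward_orbit UNIV f (\<phi> 0)"
    using t by (intro solution_in_forward_orbit[OF sol]) auto
  ultimately show False using f0 forward_orbitD[of "\<phi> t" UNIV f "\<phi> 0"] diff by fastforce
qed

locale leaf_geometry =
  fixes n k :: nat and \<sigma> :: "nat \<Rightarrow> nat" and c :: "nat \<Rightarrow> real"
  assumes k: "1 \<le> k" "k \<le> n" and \<sigma>: "\<sigma> \<in> shuffles_kn k n" and c: "c \<in> pos_sphere k n \<sigma>"
begin

lemma \<sigma>_permutes: "\<sigma> permutes {1..n}"
  using \<sigma> by (simp add: shuffles_kn_def)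

lemma c_pos: "i \<in> {1..k} \<Longrightarrow> c (\<sigma> i) > 0"
  and c_zero: "i \<in> {k<..n} \<Longrightarrow> c (\<sigma> i) = 0"
  and c_sum: "(\<Sum>i=1..k. (c (\<sigma> i))\<^sup>2) = 1"
  using c by (simp_all add: pos_sphere_def)

lemma ck_pos: "c (\<sigma> k) > 0"
  using c_pos k by simp

lemma leaf_norm: "p \<in> leaf n k \<sigma> c \<Longrightarrow> i \<in> {1..k} \<Longrightarrow> norm (p (\<sigma> i)) = c (\<sigma> i) / c (\<sigma> k) * norm (p (\<sigma> k))"
  and leaf_zero: "p \<in> leaf n k \<sigma> c \<Longrightarrow> i \<in> {k<..n} \<Longrightarrow> p (\<sigma> i) = (0, 0)"
  unfolding leaf_def by blast+

lemma leaf_norm_pos: "p \<in> leaf n k \<sigma> c \<Longrightarrow> norm (p (\<sigma> k)) > 0"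
  using k unfolding leaf_def by (metis (mono_tags, lifting) CollectD atLeastAtMost_iff order_refl)

text \<open>The coordinates with index beyond \<open>k\<close> vanish on the leaf.\<close>

lemma state_dist_leaf:
  assumes "p \<in> leaf n k \<sigma> c" "q \<in> leaf n k \<sigma> c"
  shows "state_dist n p q = sqrt (\<Sum>i=1..k. (dist (p (\<sigma> i)) (q (\<sigma> i)))\<^sup>2)"
proof -
  have "(\<Sum>j=1..n. (dist (p j) (q j))\<^sup>2) = (\<Sum>i=1..n. (dist (p (\<sigma> i)) (q (\<sigma> i)))\<^sup>2)"
    using sum.permute[OF \<sigma>_permutes, of "\<lambda>j. (dist (p j) (q j))\<^sup>2"] by (simp add: o_def)
  also have "\<dots> = (\<Sum>i=1..k. (dist (p (\<sigma> i)) (q (\<sigma> i)))\<^sup>2)"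
    using k assms by (intro sum.mono_neutral_right) (auto simp: leaf_zero)
  finally show ?thesis by (simp add: state_dist_def L2_set_def)
qed

text \<open>This is where the normalization of \<open>c\<close> enters: the leaf is a cone on which the norm of the vector of all
  radii is \<open>\<rho>\<^bsub>\<sigma>(k)\<^esub> / c\<^bsub>\<sigma>(k)\<^esub>\<close>.\<close>

lemma sum_scaled_c: "(\<Sum>i=1..k. (c (\<sigma> i) / c (\<sigma> k) * d)\<^sup>2) = (d / c (\<sigma> k))\<^sup>2"
proof -
  have "(\<Sum>i=1..k. (c (\<sigma> i) / c (\<sigma> k) * d)\<^sup>2) = (\<Sum>i=1..k. (c (\<sigma> i))\<^sup>2 * (d / c (\<sigma> k))\<^sup>2)"
    by (intro sum.cong) (auto simp: power_divide power_mult_distrib)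
  then show ?thesis by (simp only: c_sum mult_1 flip: sum_distrib_right)
qed

text \<open>The nearest point of the hypertorus is the radial projection; it is optimal because each component of any
  other point is at least as far away as the difference of the radii.\<close>

lemma dist_to_hypertorus:
  assumes p: "p \<in> leaf n k \<sigma> c" and r: "r > 0"
  shows "dist_to_set (state_dist n) p (hypertorus n k \<sigma> c r) = \<bar>norm (p (\<sigma> k)) - r\<bar> / c (\<sigma> k)"
proof -
  define R where "R = norm (p (\<sigma> k))"
  have R: "R > 0" using leaf_norm_pos[OF p] by (simp add: R_def)
  have pn: "norm (p (\<sigma> i)) = c (\<sigma> i) / c (\<sigma> k) * R" if "i \<in> {1..k}" for i
    using leaf_norm[OF p that] by (simp add: R_def)
  define q where "q = (\<lambda>j\<in>{1..n}. (r / R) *\<^sub>R p j)"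
  have q\<sigma>: "q (\<sigma> i) = (r / R) *\<^sub>R p (\<sigma> i)" if "i \<in> {1..n}" for i
    using that permutes_in_image[OF \<sigma>_permutes, of i] by (simp add: q_def)
  have qn: "norm (q (\<sigma> i)) = c (\<sigma> i) / c (\<sigma> k) * r" if "i \<in> {1..k}" for i
    using q\<sigma>[of i] pn[of i] that k R r by simp
  have "norm (q (\<sigma> k)) = r" using qn[of k] k ck_pos by simp
  moreover have "q \<in> leaf n k \<sigma> c"
    unfolding leaf_def
  proof (intro CollectI conjI ballI)
    show "q \<in> {1..n} \<rightarrow>\<^sub>E UNIV" by (simp add: q_def)
  next
    fix i assume "i \<in> {1..k}"
    then show "norm (q (\<sigma> i)) = c (\<sigma> i) / c (\<sigma> k) * norm (q (\<sigma> k))" "norm (q (\<sigma> i)) > 0"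
      using qn c_pos[of i] ck_pos r \<open>norm (q (\<sigma> k)) = r\<close> by auto
  next
    fix i assume "i \<in> {k<..n}"
    then show "q (\<sigma> i) = (0, 0)" using q\<sigma>[of i] leaf_zero[OF p, of i] by (simp add: zero_prod_def)
  qed
  ultimately have q: "q \<in> hypertorus n k \<sigma> c r" "q \<in> leaf n k \<sigma> c" by (auto simp: hypertorus_def)
  have "state_dist n p q = \<bar>R - r\<bar> / c (\<sigma> k)"
  proof -
    have "dist (p (\<sigma> i)) (q (\<sigma> i)) = c (\<sigma> i) / c (\<sigma> k) * \<bar>R - r\<bar>" if i: "i \<in> {1..k}" for i
    proof -
      have "p (\<sigma> i) - q (\<sigma> i) = (1 - r / R) *\<^sub>R p (\<sigma> i)"
        using q\<sigma>[of i] i k by (simp add: scaleR_diff_left)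
      then have "dist (p (\<sigma> i)) (q (\<sigma> i)) = \<bar>1 - r / R\<bar> * R * (c (\<sigma> i) / c (\<sigma> k))"
        using pn[OF i] by (simp add: dist_norm)
      also have "\<bar>1 - r / R\<bar> * R = \<bar>R - r\<bar>" 
        using R by (metis abs_mult abs_of_pos left_diff_distrib mult_1 nonzero_eq_divide_eq less_irrefl)
      finally show ?thesis by simp
    qed
    then have "state_dist n p q = sqrt (\<Sum>i=1..k. (c (\<sigma> i) / c (\<sigma> k) * \<bar>R - r\<bar>)\<^sup>2)"
      unfolding state_dist_leaf[OF p q(2)] by (intro arg_cong[where f = sqrt] sum.cong) auto
    also have "\<dots> = \<bar>R - r\<bar> / c (\<sigma> k)"
      unfolding sum_scaled_c using ck_pos by simp
    finally show ?thesis .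
  qed
  moreover have lower: "\<bar>R - r\<bar> / c (\<sigma> k) \<le> state_dist n p q'" if q': "q' \<in> hypertorus n k \<sigma> c r" for q'
  proof -
    have q'l: "q' \<in> leaf n k \<sigma> c" "norm (q' (\<sigma> k)) = r" using q' by (auto simp: hypertorus_def)
    have "(c (\<sigma> i) / c (\<sigma> k) * \<bar>R - r\<bar>)\<^sup>2 \<le> (dist (p (\<sigma> i)) (q' (\<sigma> i)))\<^sup>2" if i: "i \<in> {1..k}" for i
    proof (rule power_mono)
      have "c (\<sigma> i) / c (\<sigma> k) * \<bar>R - r\<bar> = \<bar>norm (p (\<sigma> i)) - norm (q' (\<sigma> i))\<bar>"
        unfolding pn[OF i] leaf_norm[OF q'l(1) i] q'l(2) right_diff_distrib[symmetric] abs_mult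
        using c_pos[OF i] ck_pos by simp
      then show "c (\<sigma> i) / c (\<sigma> k) * \<bar>R - r\<bar> \<le> dist (p (\<sigma> i)) (q' (\<sigma> i))"
        by (simp add: dist_norm norm_triangle_ineq3)
    qed (use c_pos[OF i] ck_pos in simp)
    then have "sqrt (\<Sum>i=1..k. (c (\<sigma> i) / c (\<sigma> k) * \<bar>R - r\<bar>)\<^sup>2) \<le> state_dist n p q'"
      unfolding state_dist_leaf[OF p q'l(1)] by (intro real_sqrt_le_mono sum_mono)
    then show ?thesis unfolding sum_scaled_c using ck_pos by simp
  qed
  ultimately show ?thesis
    unfolding dist_to_set_def R_def[symmetric]
    using q(1) by (intro cInf_eq_minimum) (auto intro: rev_image_eqI)
qed

lemma leaf_trajectory_amplitude:
  assumes "leaf_trajectory n k \<sigma> c s a \<omega> b J p"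
  shows "solution_on (amplitude s a) UNIV J (\<lambda>t. norm (p t (\<sigma> k)))"
proof -
  have kk: "k \<in> {1..k}" using k by simp
  obtain \<rho> \<theta> where *: "\<And>t. t \<in> J \<Longrightarrow> \<rho> (\<sigma> k) t > 0 \<and>
        p t (\<sigma> k) = (\<rho> (\<sigma> k) t * cos (\<theta> (\<sigma> k) t), \<rho> (\<sigma> k) t * sin (\<theta> (\<sigma> k) t)) \<and>
        (\<rho> (\<sigma> k) has_real_derivative \<rho> (\<sigma> k) t * (\<Sum>j\<le>s. a j * \<rho> (\<sigma> k) t ^ (2 * j))) (at t within J)"
    using assms kk unfolding leaf_trajectory_def by blast
  have eq: "norm (p t (\<sigma> k)) = \<rho> (\<sigma> k) t" if "t \<in> J" for t
  proof -
    have "(\<rho> (\<sigma> k) t * cos (\<theta> (\<sigma> k) t))\<^sup>2 + (\<rho> (\<sigma> k) t * sin (\<theta> (\<sigma> k) t))\<^sup>2 = (\<rho> (\<sigma> k) t)\<^sup>2"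
      by (simp add: power_mult_distrib flip: distrib_left)
    then show ?thesis using *[OF that] by (simp add: norm_prod_def)
  qed
  show ?thesis
    unfolding solution_on_def
  proof (intro ballI conjI)
    fix t assume t: "t \<in> J"
    have "(\<rho> (\<sigma> k) has_real_derivative amplitude s a (norm (p t (\<sigma> k)))) (at t within J)"
      using *[OF t] eq[OF t] by (simp add: amplitude_def)
    then show "((\<lambda>t. norm (p t (\<sigma> k))) has_real_derivative amplitude s a (norm (p t (\<sigma> k)))) (at t within J)"
      by (rule has_field_derivative_transform_within[OF _ zero_less_one t]) (simp add: eq)
  qed simp
qed

lemma leaf_trajectory_in_leaf: "leaf_trajectory n k \<sigma> c s a \<omega> b J p \<Longrightarrow> t \<in> J \<Longrightarrow> p t \<in> leaf n k \<sigma> c"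
  by (auto simp: leaf_trajectory_def)

text \<open>The angles are obtained by integrating their velocities, which depend on the radius only.\<close>

lemma leaf_trajectory_exists:
  assumes sol: "solution_on (amplitude s a) UNIV {0..T} \<phi>" and T: "T \<ge> 0"
    and pos: "\<And>t. t \<in> {0..T} \<Longrightarrow> \<phi> t > 0"
  obtains p where "leaf_trajectory n k \<sigma> c s a \<omega> b {0..T} p" "\<And>t. t \<in> {0..T} \<Longrightarrow> norm (p t (\<sigma> k)) = \<phi> t"
proof -
  have "\<exists>\<theta>. \<forall>t\<in>{0..T}. (\<theta> has_real_derivative \<omega> (\<sigma> i) + (\<Sum>j\<le>s. b i j * \<phi> t ^ (2 * j))) (at t within {0..T})" for i
  proof -
    have "continuous_on {0..T} (\<lambda>t. \<omega> (\<sigma> i) + (\<Sum>j\<le>s. b i j * \<phi> t ^ (2 * j)))"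
      by (intro continuous_intros solution_continuous[OF sol])
    from antiderivative_continuous[OF this] obtain g where
      "\<And>t. t \<in> {0..T} \<Longrightarrow> (g has_vector_derivative \<omega> (\<sigma> i) + (\<Sum>j\<le>s. b i j * \<phi> t ^ (2 * j))) (at t within {0..T})"
      by blast
    then show ?thesis
      unfolding has_real_derivative_iff_has_vector_derivative by blast
  qed
  then obtain \<Theta> where \<Theta>: "\<And>i t. t \<in> {0..T} \<Longrightarrow>
      (\<Theta> i has_real_derivative \<omega> (\<sigma> i) + (\<Sum>j\<le>s. b i j * \<phi> t ^ (2 * j))) (at t within {0..T})"
    by metis
  define \<rho> where "\<rho> j t = c j / c (\<sigma> k) * \<phi> t" for j t
  define \<theta> where "\<theta> j = \<Theta> (inv \<sigma> j)" for j
  define p where "p t = (\<lambda>j\<in>{1..n}. (\<rho> j t * cos (\<theta> j t), \<rho> j t * sin (\<theta> j t)))" for t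
  have \<rho>k: "\<rho> (\<sigma> k) t = \<phi> t" for t using ck_pos by (simp add: \<rho>_def)
  have \<rho>pos: "\<rho> (\<sigma> i) t > 0" if "i \<in> {1..k}" "t \<in> {0..T}" for i t
    using c_pos[OF that(1)] pos[OF that(2)] ck_pos by (simp add: \<rho>_def)
  have p\<sigma>: "p t (\<sigma> i) = (\<rho> (\<sigma> i) t * cos (\<theta> (\<sigma> i) t), \<rho> (\<sigma> i) t * sin (\<theta> (\<sigma> i) t))" if "i \<in> {1..n}" for i t
    using that permutes_in_image[OF \<sigma>_permutes, of i] by (simp add: p_def)
  have np: "norm (p t (\<sigma> i)) = \<rho> (\<sigma> i) t" if "i \<in> {1..k}" "t \<in> {0..T}" for i t
  proof -
    have "(\<rho> (\<sigma> i) t * cos (\<theta> (\<sigma> i) t))\<^sup>2 + (\<rho> (\<sigma> i) t * sin (\<theta> (\<sigma> i) t))\<^sup>2 = (\<rho> (\<sigma> i) t)\<^sup>2"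
      by (simp add: power_mult_distrib flip: distrib_left)
    then show ?thesis using p\<sigma>[of i t] \<rho>pos[OF that] that k by (simp add: norm_prod_def)
  qed
  have leaf: "p t \<in> leaf n k \<sigma> c" if t: "t \<in> {0..T}" for t
    unfolding leaf_def
  proof (intro CollectI conjI ballI)
    show "p t \<in> {1..n} \<rightarrow>\<^sub>E UNIV" by (simp add: p_def)
  next
    fix i assume i: "i \<in> {1..k}"
    have "norm (p t (\<sigma> k)) = \<phi> t" using np[of k t] t k \<rho>k by simp
    then show "norm (p t (\<sigma> i)) = c (\<sigma> i) / c (\<sigma> k) * norm (p t (\<sigma> k))" "norm (p t (\<sigma> i)) > 0"
      using np[OF i t] \<rho>pos[OF i t] by (simp_all add: \<rho>_def)
  next
    fix i assume "i \<in> {k<..n}"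
    then show "p t (\<sigma> i) = (0, 0)" using p\<sigma>[of i t] c_zero[of i] by (simp add: \<rho>_def)
  qed
  have "leaf_trajectory n k \<sigma> c s a \<omega> b {0..T} p"
    unfolding leaf_trajectory_def
  proof (rule conjI[OF _ exI[of _ \<rho>, OF exI[of _ \<theta>]]]; intro ballI conjI)
    fix i t assume i: "i \<in> {1..k}" and t: "t \<in> {0..T}"
    show "p t (\<sigma> i) = (\<rho> (\<sigma> i) t * cos (\<theta> (\<sigma> i) t), \<rho> (\<sigma> i) t * sin (\<theta> (\<sigma> i) t))"
      using p\<sigma> i k by simp
    have "(\<phi> has_real_derivative amplitude s a (\<phi> t)) (at t within {0..T})"
      using sol t by (auto simp: solution_on_def)
    then show "(\<rho> (\<sigma> i) has_real_derivative \<rho> (\<sigma> i) t * (\<Sum>j\<le>s. a j * \<rho> (\<sigma> k) t ^ (2 * j))) (at t within {0..T})"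
      unfolding \<rho>k using ck_pos by (auto simp: \<rho>_def[abs_def] amplitude_def intro!: derivative_eq_intros)
    show "(\<theta> (\<sigma> i) has_real_derivative \<omega> (\<sigma> i) + (\<Sum>j\<le>s. b i j * \<rho> (\<sigma> k) t ^ (2 * j))) (at t within {0..T})"
      unfolding \<rho>k \<theta>_def using \<Theta>[OF t, of i] permutes_inverses(2)[OF \<sigma>_permutes] by simp
  qed (use leaf \<rho>pos in auto)
  moreover have "norm (p t (\<sigma> k)) = \<phi> t" if "t \<in> {0..T}" for t
    using np[of k t] that k \<rho>k by simp
  ultimately show thesis using that by blast
qed

lemma asymptotically_stable_hypertorus:
  assumes r: "r > 0" and stable: "asymptotically_stable (solution_on (amplitude s a) UNIV) dist {r}"
  shows "asymptotically_stable (leaf_trajectory n k \<sigma> c s a \<omega> b) (state_dist n) (hypertorus n k \<sigma> c r)"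
proof -
  let ?d = "\<lambda>p. dist_to_set (state_dist n) p (hypertorus n k \<sigma> c r)"
  have d: "?d (p t) = \<bar>norm (p t (\<sigma> k)) - r\<bar> / c (\<sigma> k)"
    if "leaf_trajectory n k \<sigma> c s a \<omega> b J p" "t \<in> J" for p J t
    using dist_to_hypertorus[OF leaf_trajectory_in_leaf[OF that] r] .
  note sol = leaf_trajectory_amplitude
  show ?thesis
    unfolding asymptotically_stable_def lyapunov_stable_def
  proof (intro conjI allI impI)
    fix \<epsilon> :: real assume "\<epsilon> > 0"
    then have "\<epsilon> * c (\<sigma> k) > 0" using ck_pos by simp
    then obtain \<delta> where \<delta>: "\<delta> > 0" "\<And>T p t. T \<ge> 0 \<Longrightarrow> solution_on (amplitude s a) UNIV {0..T} p \<Longrightarrow>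
        \<bar>p 0 - r\<bar> < \<delta> \<Longrightarrow> t \<in> {0..T} \<Longrightarrow> \<bar>p t - r\<bar> < \<epsilon> * c (\<sigma> k)"
      using stable unfolding asymptotically_stable_def lyapunov_stable_def dist_to_set_singleton by metis
    show "\<exists>\<delta>>0. \<forall>T\<ge>0. \<forall>p. leaf_trajectory n k \<sigma> c s a \<omega> b {0..T} p \<and> ?d (p 0) < \<delta> \<longrightarrow> (\<forall>t\<in>{0..T}. ?d (p t) < \<epsilon>)"
    proof (intro exI[of _ "\<delta> / c (\<sigma> k)"] conjI allI impI ballI; (elim conjE)?)
      fix T p t assume T: "0 \<le> T" and tr: "leaf_trajectory n k \<sigma> c s a \<omega> b {0..T} p"
        and close: "?d (p 0) < \<delta> / c (\<sigma> k)" and t: "t \<in> {0..T}"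
      have "\<bar>norm (p 0 (\<sigma> k)) - r\<bar> < \<delta>"
        using close d[OF tr, of 0] T ck_pos by (simp add: divide_less_cancel)
      then have "\<bar>norm (p t (\<sigma> k)) - r\<bar> < \<epsilon> * c (\<sigma> k)"
        using \<delta>(2)[OF T sol[OF tr] _ t] by simp
      then show "?d (p t) < \<epsilon>" using d[OF tr t] ck_pos by (simp add: divide_less_eq)
    qed (use \<delta> ck_pos in simp)
  next
    obtain \<delta> where \<delta>: "\<delta> > 0" "\<And>p. solution_on (amplitude s a) UNIV {0..} p \<Longrightarrow> \<bar>p 0 - r\<bar> < \<delta> \<Longrightarrow>
        ((\<lambda>t. \<bar>p t - r\<bar>) \<longlongrightarrow> 0) at_top"
      using stable unfolding asymptotically_stable_def dist_to_set_singleton by metis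
    show "\<exists>\<delta>>0. \<forall>p. leaf_trajectory n k \<sigma> c s a \<omega> b {0..} p \<and> ?d (p 0) < \<delta> \<longrightarrow> ((\<lambda>t. ?d (p t)) \<longlongrightarrow> 0) at_top"
    proof (intro exI[of _ "\<delta> / c (\<sigma> k)"] conjI allI impI; (elim conjE)?)
      fix p assume tr: "leaf_trajectory n k \<sigma> c s a \<omega> b {0..} p"
        and close: "?d (p 0) < \<delta> / c (\<sigma> k)"
      have "\<bar>norm (p 0 (\<sigma> k)) - r\<bar> < \<delta>"
        using close d[OF tr, of 0] ck_pos by (simp add: divide_less_cancel)
      then have "((\<lambda>t. \<bar>norm (p t (\<sigma> k)) - r\<bar> / c (\<sigma> k)) \<longlongrightarrow> 0 / c (\<sigma> k)) at_top"
        using \<delta>(2)[OF sol[OF tr]] ck_pos by (intro tendsto_intros) auto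
      moreover have "\<forall>\<^sub>F t in at_top. \<bar>norm (p t (\<sigma> k)) - r\<bar> / c (\<sigma> k) = ?d (p t)"
        using eventually_ge_at_top[of 0] by eventually_elim (use d[OF tr] in simp)
      ultimately show "((\<lambda>t. ?d (p t)) \<longlongrightarrow> 0) at_top"
        using tendsto_cong by fastforce
    qed (use \<delta> ck_pos in simp)
  qed
qed

text \<open>Instability of an equilibrium is inherited by the hypertorus, because solutions that start near \<open>r\<close> stay
  positive and can therefore be lifted to the leaf.\<close>

lemma lyapunov_stable_hypertorusD:
  assumes r: "r > 0"
    and stable: "lyapunov_stable (leaf_trajectory n k \<sigma> c s a \<omega> b) (state_dist n) (hypertorus n k \<sigma> c r)"
  shows "lyapunov_stable (solution_on (amplitude s a) UNIV) dist {r}"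
  unfolding lyapunov_stable_def dist_to_set_singleton
proof (intro allI impI)
  let ?d = "\<lambda>p. dist_to_set (state_dist n) p (hypertorus n k \<sigma> c r)"
  fix \<epsilon> :: real assume "\<epsilon> > 0"
  then have "\<epsilon> / c (\<sigma> k) > 0" using ck_pos by simp
  then obtain \<delta> where \<delta>: "\<delta> > 0" "\<And>T p t. T \<ge> 0 \<Longrightarrow> leaf_trajectory n k \<sigma> c s a \<omega> b {0..T} p \<Longrightarrow>
      ?d (p 0) < \<delta> \<Longrightarrow> t \<in> {0..T} \<Longrightarrow> ?d (p t) < \<epsilon> / c (\<sigma> k)"
    using stable unfolding lyapunov_stable_def by metis
  show "\<exists>\<delta>>0. \<forall>T\<ge>0. \<forall>p. solution_on (amplitude s a) UNIV {0..T} p \<and> \<bar>p 0 - r\<bar> < \<delta> \<longrightarrow>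
      (\<forall>t\<in>{0..T}. \<bar>p t - r\<bar> < \<epsilon>)"
  proof (intro exI[of _ "min r (\<delta> * c (\<sigma> k))"] conjI allI impI ballI; (elim conjE)?)
    fix T \<phi> t assume T: "0 \<le> T" and sol: "solution_on (amplitude s a) UNIV {0..T} \<phi>"
      and close: "\<bar>\<phi> 0 - r\<bar> < min r (\<delta> * c (\<sigma> k))" and t: "t \<in> {0..T}"
    have "\<phi> t > 0" if "t \<in> {0..T}" for t
      using close by (intro solution_stays_positive[OF sol _ _ _ that]) auto
    then obtain p where tr: "leaf_trajectory n k \<sigma> c s a \<omega> b {0..T} p"
        and p: "\<And>t. t \<in> {0..T} \<Longrightarrow> norm (p t (\<sigma> k)) = \<phi> t"
      using leaf_trajectory_exists[OF sol T] by metis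
    have d: "?d (p t) = \<bar>\<phi> t - r\<bar> / c (\<sigma> k)" if "t \<in> {0..T}" for t
      using dist_to_hypertorus[OF leaf_trajectory_in_leaf[OF tr that] r] p[OF that] by simp
    have "?d (p 0) < \<delta>" using d[of 0] T close ck_pos by (simp add: divide_less_eq)
    from \<delta>(2)[OF T tr this t] show "\<bar>\<phi> t - r\<bar> < \<epsilon>"
      using d[OF t] ck_pos by (simp add: divide_less_cancel)
  qed (use r \<delta> ck_pos in simp)
qed

end

section \<open>Seven-determinacy\<close>

text \<open>The analytic core of the determinacy proof. For small \<open>\<mu>\<close> the equation \<open>y = g (B \<mu> y) - T \<mu> y\<close> has a unique
  solution \<open>y\<close> near \<open>g 0\<close>, because both terms depend on \<open>y\<close> with a Lipschitz constant of the order of \<open>\<mu>\<close>.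
  The parametrization \<open>\<psi> \<mu> = B \<mu> y\<close> is injective: two solutions with the same value \<open>\<psi>\<close> differ by
  \<open>O(\<bar>\<mu> - \<mu>'\<bar>)\<close>, and since \<open>B _ (g 0)\<close> is bounded below this forces \<open>\<mu> = \<mu>'\<close>.\<close>

lemma bilinear_fixed_point_parametrization:
  fixes B :: "'p::euclidean_space \<Rightarrow> 'x::{real_normed_vector,complete_space} \<Rightarrow> 'p"
    and T :: "'p \<Rightarrow> 'x \<Rightarrow> 'x" and g :: "'p \<Rightarrow> 'x"
  assumes B: "bounded_bilinear B" and T: "bounded_bilinear T"
    and \<rho>: "\<rho> > 0" and L: "L \<ge> 0"
    and lip: "\<And>\<nu> \<nu>'. \<nu> \<in> ball 0 \<rho> \<Longrightarrow> \<nu>' \<in> ball 0 \<rho> \<Longrightarrow> norm (g \<nu> - g \<nu>') \<le> L * norm (\<nu> - \<nu>')"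
    and inj: "inj (\<lambda>\<mu>. B \<mu> (g 0))" and \<eta>: "\<eta> > 0"
  obtains \<delta> \<psi> where "\<delta> > 0" "continuous_on (ball 0 \<delta>) \<psi>" "inj_on \<psi> (ball 0 \<delta>)" "\<psi> 0 = 0"
    "\<And>\<mu>. \<mu> \<in> ball 0 \<delta> \<Longrightarrow> \<exists>y. \<psi> \<mu> \<in> ball 0 \<rho> \<and> norm (y - g 0) \<le> \<eta> \<and> y = g (\<psi> \<mu>) - T \<mu> y \<and> \<psi> \<mu> = B \<mu> y"
proof -
  interpret B: bounded_bilinear B by (rule B)
  interpret T: bounded_bilinear T by (rule T)
  obtain b where b: "b > 0" "\<And>\<mu> y. norm (B \<mu> y) \<le> norm \<mu> * norm y * b"
    using B.pos_bounded by blast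
  obtain t where t: "t > 0" "\<And>\<mu> y. norm (T \<mu> y) \<le> norm \<mu> * norm y * t"
    using T.pos_bounded by blast
  obtain c where c: "c > 0" "\<And>\<mu>. c * norm \<mu> \<le> norm (B \<mu> (g 0))"
    using linear_inj_bounded_below_pos[OF bounded_linear.linear[OF B.bounded_linear_left] inj] by blast
  \<comment> \<open>The two error terms in the proof of injectivity have factors at most \<open>c / 4\<close>, together less than \<open>c\<close>.\<close>
  define e where "e = min \<eta> (min 1 (c / (4 * b)))"
  have e: "e > 0" "e \<le> \<eta>" "e \<le> 1" "b * e \<le> c / 4"
  proof -
    have *: "b * e \<le> b * (c / (4 * b))" unfolding e_def using b(1) by (intro mult_left_mono) auto
    then show "b * e \<le> c / 4" using b(1) by simp
    show "e > 0" "e \<le> \<eta>" "e \<le> 1" using \<eta> b(1) c(1) by (simp_all add: e_def)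
  qed
  define Y where "Y = norm (g 0) + 1"
  have Y: "Y \<ge> 1" by (simp add: Y_def)
  define A where "A = L * b + t"
  have A: "A > 0" using L b t by (simp add: A_def add_nonneg_pos)
  \<comment> \<open>The right-hand side of the equation has Lipschitz constant \<open>A * norm \<mu>\<close> in \<open>y\<close>, and \<open>Y\<close> bounds the solutions;
    \<open>M\<close> dominates all factors by which \<open>\<delta>\<close> is multiplied in the estimates below.\<close>
  define M where "M = 1 + Y * b + A * Y + A + 2 * b * A * Y"
  define \<delta> where "\<delta> = min (min \<rho> e) (min (1/2) (c / 4)) / M"
  have M: "M > 0" "Y * b \<le> M" "A * Y \<le> M" "A \<le> M" "2 * b * A * Y \<le> M"
    using Y A b by (simp_all add: M_def add_nonneg_nonneg add_nonneg_pos)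
  have \<delta>pos: "\<delta> > 0"
    unfolding \<delta>_def using \<rho> e c M by (intro divide_pos_pos) auto
  have \<delta>M: "\<delta> * X \<le> min (min \<rho> e) (min (1/2) (c / 4))" if "X \<le> M" for X
  proof -
    have "\<delta> * X \<le> \<delta> * M" using that \<delta>pos by simp
    then show ?thesis using M by (simp add: \<delta>_def)
  qed
  have \<delta>: "\<delta> * (Y * b) \<le> \<rho>" "\<delta> * (A * Y) \<le> e" "\<delta> * A \<le> 1/2" "\<delta> * (2 * b * A * Y) \<le> c / 4"
    using \<delta>M[OF M(2)] \<delta>M[OF M(3)] \<delta>M[OF M(4)] \<delta>M[OF M(5)] by auto
  have Ybd: "norm y \<le> Y" if "y \<in> cball (g 0) e" for y
    using that e norm_triangle_sub[of y "g 0"] by (auto simp: Y_def dist_norm norm_minus_commute)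
  have inball: "B \<mu> y \<in> ball 0 \<rho>" if "\<mu> \<in> ball 0 \<delta>" "y \<in> cball (g 0) e" for \<mu> y
  proof -
    have "norm (B \<mu> y) \<le> norm \<mu> * (norm y * b)" using b(2)[of \<mu> y] by (simp add: mult.assoc)
    also have "\<dots> \<le> norm \<mu> * (Y * b)"
      using Ybd[OF that(2)] b(1) by (intro mult_left_mono mult_right_mono) auto
    also have "\<dots> < \<delta> * (Y * b)"
      using that b Y by (intro mult_strict_right_mono) auto
    finally show ?thesis using \<delta>(1) by simp
  qed
  define \<Phi> where "\<Phi> \<mu> y = g (B \<mu> y) - T \<mu> y" for \<mu> y
  have diff_y: "norm (\<Phi> \<mu> y - \<Phi> \<mu> y') \<le> A * norm \<mu> * norm (y - y')"
    if "\<mu> \<in> ball 0 \<delta>" "y \<in> cball (g 0) e" "y' \<in> cball (g 0) e" for \<mu> y y'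
  proof -
    have "\<Phi> \<mu> y - \<Phi> \<mu> y' = (g (B \<mu> y) - g (B \<mu> y')) - T \<mu> (y - y')"
      by (simp add: \<Phi>_def T.diff_right)
    also have "norm \<dots> \<le> norm (g (B \<mu> y) - g (B \<mu> y')) + norm (T \<mu> (y - y'))"
      by (rule norm_triangle_ineq4)
    also have "\<dots> \<le> L * norm (B \<mu> y - B \<mu> y') + norm (T \<mu> (y - y'))"
      using lip inball that by simp
    also have "\<dots> \<le> L * (norm \<mu> * norm (y - y') * b) + norm \<mu> * norm (y - y') * t"
      using b(2)[of \<mu> "y - y'"] t(2)[of \<mu> "y - y'"] L
      by (intro add_mono mult_left_mono) (simp_all add: B.diff_right)
    finally show ?thesis by (simp add: A_def algebra_simps)
  qed
  have diff_\<mu>: "norm (\<Phi> \<mu> y - \<Phi> \<mu>' y) \<le> A * Y * norm (\<mu> - \<mu>')"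
    if "\<mu> \<in> ball 0 \<delta>" "\<mu>' \<in> ball 0 \<delta>" "y \<in> cball (g 0) e" for \<mu> \<mu>' y
  proof -
    have "\<Phi> \<mu> y - \<Phi> \<mu>' y = (g (B \<mu> y) - g (B \<mu>' y)) - T (\<mu> - \<mu>') y"
      by (simp add: \<Phi>_def T.diff_left)
    also have "norm \<dots> \<le> norm (g (B \<mu> y) - g (B \<mu>' y)) + norm (T (\<mu> - \<mu>') y)"
      by (rule norm_triangle_ineq4)
    also have "\<dots> \<le> L * norm (B \<mu> y - B \<mu>' y) + norm (T (\<mu> - \<mu>') y)"
      using lip inball that by simp
    also have "\<dots> \<le> L * (norm (\<mu> - \<mu>') * norm y * b) + norm (\<mu> - \<mu>') * norm y * t"
      using b(2)[of "\<mu> - \<mu>'" y] t(2)[of "\<mu> - \<mu>'" y] L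
      by (intro add_mono mult_left_mono) (simp_all add: B.diff_left)
    also have "\<dots> = A * norm y * norm (\<mu> - \<mu>')" by (simp add: A_def algebra_simps)
    also have "\<dots> \<le> A * Y * norm (\<mu> - \<mu>')"
      using Ybd[OF that(3)] A by (intro mult_left_mono mult_right_mono) auto
    finally show ?thesis .
  qed
  have half: "A * norm \<mu> * x \<le> x / 2" if "\<mu> \<in> ball 0 \<delta>" "x \<ge> 0" for \<mu> and x :: real
  proof -
    have "A * norm \<mu> \<le> A * \<delta>" using that A by simp
    also have "\<dots> \<le> 1/2" using \<delta>(3) by (simp add: mult.commute)
    finally show ?thesis using mult_right_mono[OF _ that(2)] by fastforce
  qed
  have g0: "g 0 \<in> cball (g 0) e" using e by simp
  have ex1: "\<exists>!y. y \<in> cball (g 0) e \<and> \<Phi> \<mu> y = y" if \<mu>: "\<mu> \<in> ball 0 \<delta>" for \<mu>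
  proof (rule Banach_fix[of "cball (g 0) e" "1/2" "\<Phi> \<mu>"])
    show "complete (cball (g 0) e)" by (simp add: complete_eq_closed)
    show "\<Phi> \<mu> ` cball (g 0) e \<subseteq> cball (g 0) e"
    proof (rule image_subsetI)
      fix y assume y: "y \<in> cball (g 0) e"
      have "\<Phi> 0 y = g 0" by (simp add: \<Phi>_def B.zero_left T.zero_left)
      then have "norm (\<Phi> \<mu> y - g 0) \<le> A * Y * norm (\<mu> - 0)"
        using diff_\<mu>[of \<mu> 0 y] \<mu> y \<delta>pos by simp
      also have "\<dots> \<le> A * Y * \<delta>" using \<mu> A Y by (intro mult_left_mono) auto
      also have "\<dots> \<le> e" using \<delta>(2) by (simp add: mult.commute)
      finally show "\<Phi> \<mu> y \<in> cball (g 0) e" by (simp add: dist_norm norm_minus_commute)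
    qed
  next
    fix y y' assume "y \<in> cball (g 0) e" "y' \<in> cball (g 0) e"
    then show "dist (\<Phi> \<mu> y) (\<Phi> \<mu> y') \<le> 1/2 * dist y y'"
      using diff_y[OF \<mu>, of y y'] half[OF \<mu>, of "norm (y - y')"] by (simp add: dist_norm)
  qed (use e in auto)
  define y where "y \<mu> = (THE y. y \<in> cball (g 0) e \<and> \<Phi> \<mu> y = y)" for \<mu>
  have y: "y \<mu> \<in> cball (g 0) e" "\<Phi> \<mu> (y \<mu>) = y \<mu>" if "\<mu> \<in> ball 0 \<delta>" for \<mu>
    using theI'[OF ex1[OF that]] by (auto simp: y_def)
  define \<psi> where "\<psi> \<mu> = B \<mu> (y \<mu>)" for \<mu>
  have ylip: "norm (y \<mu> - y \<mu>') \<le> 2 * A * Y * norm (\<mu> - \<mu>')"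
    if \<mu>: "\<mu> \<in> ball 0 \<delta>" and \<mu>': "\<mu>' \<in> ball 0 \<delta>" for \<mu> \<mu>'
  proof -
    have "norm (y \<mu> - y \<mu>') = norm ((\<Phi> \<mu> (y \<mu>) - \<Phi> \<mu> (y \<mu>')) + (\<Phi> \<mu> (y \<mu>') - \<Phi> \<mu>' (y \<mu>')))"
      using y[OF \<mu>] y[OF \<mu>'] by simp
    also have "\<dots> \<le> norm (\<Phi> \<mu> (y \<mu>) - \<Phi> \<mu> (y \<mu>')) + norm (\<Phi> \<mu> (y \<mu>') - \<Phi> \<mu>' (y \<mu>'))"
      by (rule norm_triangle_ineq)
    also have "\<dots> \<le> norm (y \<mu> - y \<mu>') / 2 + A * Y * norm (\<mu> - \<mu>')"
      using diff_y[OF \<mu> y(1)[OF \<mu>] y(1)[OF \<mu>']] diff_\<mu>[OF \<mu> \<mu>' y(1)[OF \<mu>']]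
        half[OF \<mu>, of "norm (y \<mu> - y \<mu>')"] by simp
    finally show ?thesis by simp
  qed
  have "continuous_on (ball 0 \<delta>) y"
  proof (rule lipschitz_on_continuous_on)
    show "(2 * A * Y)-lipschitz_on (ball 0 \<delta>) y"
      using ylip A Y by (intro lipschitz_onI) (auto simp: dist_norm)
  qed
  then have "continuous_on (ball 0 \<delta>) \<psi>"
    unfolding \<psi>_def by (intro B.continuous_on continuous_on_id)
  moreover have "inj_on \<psi> (ball 0 \<delta>)"
  proof (rule inj_onI)
    fix \<mu> \<mu>' assume \<mu>: "\<mu> \<in> ball 0 \<delta>" and \<mu>': "\<mu>' \<in> ball 0 \<delta>" and eq: "\<psi> \<mu> = \<psi> \<mu>'"
    define D where "D = norm (\<mu> - \<mu>')"
    \<comment> \<open>\<open>B (\<mu> - \<mu>') (g 0)\<close> is small compared with \<open>\<mu> - \<mu>'\<close>, although \<open>B _ (g 0)\<close> is bounded below.\<close>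
    have "B (\<mu> - \<mu>') (g 0) = B (\<mu> - \<mu>') (g 0 - y \<mu>) - B \<mu>' (y \<mu> - y \<mu>')"
      using eq by (simp add: \<psi>_def B.diff_left B.diff_right)
    then have "c * D \<le> norm (B (\<mu> - \<mu>') (g 0 - y \<mu>) - B \<mu>' (y \<mu> - y \<mu>'))"
      using c(2)[of "\<mu> - \<mu>'"] by (simp add: D_def)
    also have "\<dots> \<le> norm (B (\<mu> - \<mu>') (g 0 - y \<mu>)) + norm (B \<mu>' (y \<mu> - y \<mu>'))"
      by (rule norm_triangle_ineq4)
    also have "norm (B (\<mu> - \<mu>') (g 0 - y \<mu>)) \<le> D * norm (g 0 - y \<mu>) * b"
      using b(2) by (simp add: D_def)
    also have "\<dots> \<le> D * e * b"
      using y(1)[OF \<mu>] b(1) by (intro mult_left_mono mult_right_mono) (auto simp: D_def dist_norm)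
    also have "\<dots> \<le> D * (c / 4)"
      using mult_left_mono[OF e(4), of D] by (simp add: D_def mult_ac)
    also have "norm (B \<mu>' (y \<mu> - y \<mu>')) \<le> norm \<mu>' * norm (y \<mu> - y \<mu>') * b" by (rule b(2))
    also have "\<dots> \<le> \<delta> * (2 * A * Y * D) * b"
      using ylip[OF \<mu> \<mu>'] \<mu>' b(1) \<delta>pos by (intro mult_right_mono mult_mono) (auto simp: D_def)
    also have "\<dots> = (\<delta> * (2 * b * A * Y)) * D" by (simp add: mult_ac)
    also have "\<dots> \<le> c / 4 * D" using \<delta>(4) by (intro mult_right_mono) (simp_all add: D_def)
    finally have "c * D \<le> c / 2 * D" by simp
    then have "D \<le> 0" using c(1) by (simp add: mult_le_0_iff)
    then show "\<mu> = \<mu>'" by (simp add: D_def)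
  qed
  moreover have "\<psi> 0 = 0" by (simp add: \<psi>_def B.zero_left)
  moreover have "\<exists>y. \<psi> \<mu> \<in> ball 0 \<rho> \<and> norm (y - g 0) \<le> \<eta> \<and> y = g (\<psi> \<mu>) - T \<mu> y \<and> \<psi> \<mu> = B \<mu> y"
    if "\<mu> \<in> ball 0 \<delta>" for \<mu>
    using y[OF that] inball[OF that y(1)[OF that]] e(2)
    by (intro exI[of _ "y \<mu>"]) (auto simp: \<psi>_def \<Phi>_def dist_norm norm_minus_commute)
  ultimately show thesis using that \<delta>pos by blast
qed

text \<open>Bounded sequences with the supremum norm. The index type is wrapped in \<open>discrete\<close> because this makes it a
  metric space, for which the space of bounded continuous functions is complete.\<close>

type_synonym bseq = "nat discrete \<Rightarrow>\<^sub>C real"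

definition ent :: "bseq \<Rightarrow> nat \<Rightarrow> real" where
  "ent y j = apply_bcontfun y (discrete j)"

definition mk_bseq :: "(nat \<Rightarrow> real) \<Rightarrow> bseq" where
  "mk_bseq f = Bcontfun (\<lambda>x. f (of_discrete x))"

lemma continuous_on_discrete_type: "continuous_on A (f :: 'a discrete \<Rightarrow> 'b::topological_space)"
  unfolding continuous_on_open_invariant
  by (metis Int_lower2 inf.orderE inf_sup_aci(1) open_discrete)

lemma ent_mk_bseq:
  assumes "\<And>j. \<bar>f j\<bar> \<le> K"
  shows "ent (mk_bseq f) j = f j"
proof -
  have "(\<lambda>x. f (of_discrete x)) \<in> bcontfun"
    using assms by (intro bcontfun_normI[where b = K] continuous_on_discrete_type) auto
  then show ?thesis by (simp add: ent_def mk_bseq_def Bcontfun_inverse discrete_inverse)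
qed

lemma ent_le_norm: "\<bar>ent y j\<bar> \<le> norm y"
  using norm_bounded[of y "discrete j"] by (simp add: ent_def)

lemma norm_bseq_le: "(\<And>j. \<bar>ent y j\<bar> \<le> b) \<Longrightarrow> norm y \<le> b"
  by (rule norm_bound) (metis ent_def of_discrete_inverse real_norm_def)

lemma bseq_eqI: "(\<And>j. ent y j = ent z j) \<Longrightarrow> y = z"
  by (rule bcontfun_eqI) (metis ent_def of_discrete_inverse)

lemma ent_simps [simp]:
  "ent (y + z) j = ent y j + ent z j" "ent (y - z) j = ent y j - ent z j" "ent (r *\<^sub>R y) j = r * ent y j"
  by (simp_all add: ent_def)

lemma bounded_linear_ent: "bounded_linear (\<lambda>y. ent y j)"
  by (rule bounded_linear_intro[where K = 1]) (simp_all add: ent_le_norm)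

definition shift :: "nat \<Rightarrow> bseq \<Rightarrow> bseq" where
  "shift m y = mk_bseq (\<lambda>j. ent y (j + m))"

lemma ent_shift [simp]: "ent (shift m y) j = ent y (j + m)"
  unfolding shift_def by (rule ent_mk_bseq) (rule ent_le_norm)

lemma bounded_linear_shift: "bounded_linear (shift m)"
  by (rule bounded_linear_intro[where K = 1]) (auto intro!: bseq_eqI norm_bseq_le ent_le_norm)

lemma bounded_bilinear_add:
  assumes f: "bounded_bilinear f" and g: "bounded_bilinear g"
  shows "bounded_bilinear (\<lambda>x y. f x y + g x y)"
proof -
  interpret f: bounded_bilinear f by (rule f)
  interpret g: bounded_bilinear g by (rule g)
  obtain K where K: "\<And>x y. norm (f x y) \<le> norm x * norm y * K" using f.bounded by blast
  obtain K' where K': "\<And>x y. norm (g x y) \<le> norm x * norm y * K'" using g.bounded by blast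
  show ?thesis
  proof
    show "\<exists>K. \<forall>x y. norm (f x y + g x y) \<le> norm x * norm y * K"
    proof (intro exI allI)
      fix x y
      show "norm (f x y + g x y) \<le> norm x * norm y * (K + K')"
        using norm_triangle_ineq[of "f x y" "g x y"] K[of x y] K'[of x y]
        by (simp add: distrib_left)
    qed
  qed (simp_all add: f.add_left f.add_right g.add_left g.add_right f.scaleR_left f.scaleR_right
      g.scaleR_left g.scaleR_right scaleR_add_right)
qed

lemma bounded_bilinear_scaleR_comp:
  "bounded_linear \<alpha> \<Longrightarrow> bounded_linear \<beta> \<Longrightarrow> bounded_bilinear (\<lambda>x y. \<alpha> x *\<^sub>R \<beta> y)"
  using bounded_bilinear.comp[OF bounded_bilinear_scaleR] .

text \<open>A sequence \<open>y\<close> stands for the power series with coefficients \<open>w j = y j / R ^ j\<close>. The two bilinear maps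
  describe the product of this series with the cubic \<open>m\<^sub>0 + m\<^sub>1 u + m\<^sub>2 u\<^sup>2 + a u\<^sup>3\<close>: \<open>low_part\<close> consists of its coefficients
  of degree 0, 1, 2, and the coefficient of degree \<open>j + 3\<close>, multiplied by \<open>R ^ j / a\<close>, is entry \<open>j\<close> of
  \<open>y + high_part R a m y\<close>.\<close>

definition low_part :: "real \<Rightarrow> param \<Rightarrow> bseq \<Rightarrow> param" where
  "low_part R = (\<lambda>(m0, m1, m2) y.
     (m0 * ent y 0, m0 * ent y 1 / R + m1 * ent y 0,
      m0 * ent y 2 / R ^ 2 + m1 * ent y 1 / R + m2 * ent y 0))"

definition high_part :: "real \<Rightarrow> real \<Rightarrow> param \<Rightarrow> bseq \<Rightarrow> bseq" where
  "high_part R a = (\<lambda>(m0, m1, m2) y.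
     (m0 / (a * R ^ 3)) *\<^sub>R shift 3 y + (m1 / (a * R ^ 2)) *\<^sub>R shift 2 y + (m2 / (a * R)) *\<^sub>R shift 1 y)"

lemma bounded_bilinear_low_part: "bounded_bilinear (low_part R)"
proof -
  have "bounded_bilinear (\<lambda>m y. fst m *\<^sub>R (ent y 0, ent y 1 / R, ent y 2 / R ^ 2)
      + fst (snd m) *\<^sub>R (0, ent y 0, ent y 1 / R) + snd (snd m) *\<^sub>R (0, 0, ent y 0))"
    by (intro bounded_bilinear_add bounded_bilinear_scaleR_comp bounded_linear_Pair bounded_linear_zero
        bounded_linear_ent bounded_linear_divide[THEN bounded_linear_compose]
        bounded_linear_fst bounded_linear_fst_comp bounded_linear_snd_comp bounded_linear_snd)
  moreover have "low_part R = (\<lambda>m y. fst m *\<^sub>R (ent y 0, ent y 1 / R, ent y 2 / R ^ 2)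
      + fst (snd m) *\<^sub>R (0, ent y 0, ent y 1 / R) + snd (snd m) *\<^sub>R (0, 0, ent y 0))"
    by (auto simp: low_part_def fun_eq_iff)
  ultimately show ?thesis by simp
qed

lemma bounded_bilinear_high_part: "bounded_bilinear (high_part R a)"
proof -
  have "bounded_bilinear (\<lambda>m y. (fst m / (a * R ^ 3)) *\<^sub>R shift 3 y + (fst (snd m) / (a * R ^ 2)) *\<^sub>R shift 2 y
      + (snd (snd m) / (a * R)) *\<^sub>R shift 1 y :: bseq)"
    by (intro bounded_bilinear_add bounded_bilinear_scaleR_comp bounded_linear_shift
        bounded_linear_divide[THEN bounded_linear_compose]
        bounded_linear_fst bounded_linear_fst_comp bounded_linear_snd_comp bounded_linear_snd)
  moreover have "high_part R a = (\<lambda>m y. (fst m / (a * R ^ 3)) *\<^sub>R shift 3 y + (fst (snd m) / (a * R ^ 2)) *\<^sub>R shift 2 y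
      + (snd (snd m) / (a * R)) *\<^sub>R shift 1 y)"
    by (auto simp: high_part_def fun_eq_iff)
  ultimately show ?thesis by simp
qed

text \<open>The map is triangular with diagonal entries \<open>ent y 0\<close>.\<close>

lemma inj_low_part:
  assumes "ent y 0 \<noteq> 0"
  shows "inj (\<lambda>m. low_part R m y)"
  using assms by (auto intro!: injI simp: low_part_def)

text \<open>The amplitude equation in the variable \<open>u = \<rho>\<^sup>2\<close>, up to the factor \<open>\<rho>\<close>.\<close>

definition cubic :: "real \<Rightarrow> param \<Rightarrow> real \<Rightarrow> real" where
  "cubic a = (\<lambda>(m0, m1, m2) u. m0 + m1 * u + m2 * u\<^sup>2 + a * u ^ 3)"

lemma sums_cubic_times_series:
  fixes w c :: "nat \<Rightarrow> real"
  assumes w: "(\<lambda>j. w j * u ^ j) sums W"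
    and c0: "c 0 = m0 * w 0" and c1: "c 1 = m0 * w 1 + m1 * w 0" and c2: "c 2 = m0 * w 2 + m1 * w 1 + m2 * w 0"
    and c3: "\<And>j. c (j + 3) = m0 * w (j + 3) + m1 * w (j + 2) + m2 * w (j + 1) + a * w j"
  shows "(\<lambda>j. c j * u ^ j) sums (cubic a (m0, m1, m2) u * W)"
proof -
  note s = sums_split_initial_segment[OF w]
  have "(\<lambda>j. m0 * (w (j + 3) * u ^ (j + 3)) + (m1 * u) * (w (j + 2) * u ^ (j + 2))
      + (m2 * u\<^sup>2) * (w (j + 1) * u ^ (j + 1)) + (a * u ^ 3) * (w j * u ^ j))
    sums (m0 * (W - (\<Sum>i<3. w i * u ^ i)) + (m1 * u) * (W - (\<Sum>i<2. w i * u ^ i))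
      + (m2 * u\<^sup>2) * (W - (\<Sum>i<1. w i * u ^ i)) + (a * u ^ 3) * W)"
    by (intro sums_add sums_mult s w)
  also have "(\<lambda>j. m0 * (w (j + 3) * u ^ (j + 3)) + (m1 * u) * (w (j + 2) * u ^ (j + 2))
      + (m2 * u\<^sup>2) * (w (j + 1) * u ^ (j + 1)) + (a * u ^ 3) * (w j * u ^ j)) = (\<lambda>j. c (j + 3) * u ^ (j + 3))"
    by (simp add: c3 algebra_simps power_add power2_eq_square power3_eq_cube)
  also have "m0 * (W - (\<Sum>i<3. w i * u ^ i)) + (m1 * u) * (W - (\<Sum>i<2. w i * u ^ i))
      + (m2 * u\<^sup>2) * (W - (\<Sum>i<1. w i * u ^ i)) + (a * u ^ 3) * W
    = cubic a (m0, m1, m2) u * W - (\<Sum>i<3. c i * u ^ i)"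
    using c1 c2 by (simp add: cubic_def c0 eval_nat_numeral algebra_simps)
  finally show ?thesis using sums_iff_shift[of "\<lambda>j. c j * u ^ j" 3] by simp
qed

text \<open>The mean value inequality turns the bounds on the gradients into Lipschitz bounds with the same geometric
  decay.\<close>

lemma admissible_coeffsE:
  fixes N :: "'p::real_inner set"
  assumes adm: "admissible_coeffs N \<beta>" and N: "open N" "0 \<in> N"
  obtains K R \<rho> where "R > 0" "K \<ge> 0" "\<rho> > 0" "ball 0 \<rho> \<subseteq> N"
    "\<And>j \<nu>. \<nu> \<in> ball 0 \<rho> \<Longrightarrow> \<bar>\<beta> j \<nu>\<bar> * R ^ j \<le> K"
    "\<And>j \<nu> \<nu>'. \<nu> \<in> ball 0 \<rho> \<Longrightarrow> \<nu>' \<in> ball 0 \<rho> \<Longrightarrow> \<bar>\<beta> j \<nu> - \<beta> j \<nu>'\<bar> * R ^ j \<le> K * norm (\<nu> - \<nu>')"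
proof -
  obtain K R d where R: "R > 0" and d: "\<And>j \<nu>. \<nu> \<in> N \<Longrightarrow> GDERIV (\<beta> j) \<nu> :> d j \<nu>"
      "\<And>j \<nu>. \<nu> \<in> N \<Longrightarrow> \<bar>\<beta> j \<nu>\<bar> * R ^ j \<le> K" "\<And>j \<nu>. \<nu> \<in> N \<Longrightarrow> norm (d j \<nu>) * R ^ j \<le> K"
    using adm unfolding admissible_coeffs_def by blast
  obtain \<rho> where \<rho>: "\<rho> > 0" "ball 0 \<rho> \<subseteq> N"
    using N open_contains_ball by blast
  have K: "K \<ge> 0" using d(2)[OF N(2), of 0] by simp
  have "\<bar>\<beta> j \<nu> - \<beta> j \<nu>'\<bar> * R ^ j \<le> K * norm (\<nu> - \<nu>')"
    if "\<nu> \<in> ball 0 \<rho>" "\<nu>' \<in> ball 0 \<rho>" for j \<nu> \<nu>'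
  proof -
    have "norm (\<beta> j \<nu> - \<beta> j \<nu>') \<le> K / R ^ j * norm (\<nu> - \<nu>')"
    proof (rule differentiable_bound[of "ball 0 \<rho>" "\<beta> j" "\<lambda>\<nu> h. inner h (d j \<nu>)"])
      fix \<nu> :: 'p assume "\<nu> \<in> ball 0 \<rho>"
      then have \<nu>: "\<nu> \<in> N" using \<rho> by auto
      show "(\<beta> j has_derivative (\<lambda>h. inner h (d j \<nu>))) (at \<nu> within ball 0 \<rho>)"
        using d(1)[OF \<nu>] by (auto simp: gderiv_def intro: has_derivative_at_withinI)
      have le: "norm (d j \<nu>) \<le> K / R ^ j" using d(3)[OF \<nu>, of j] R by (simp add: field_simps)
      show "onorm (\<lambda>h. inner h (d j \<nu>)) \<le> K / R ^ j"
      proof (intro onorm_bound)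
        fix h
        have "\<bar>inner h (d j \<nu>)\<bar> \<le> norm h * norm (d j \<nu>)" by (rule Cauchy_Schwarz_ineq2)
        also have "\<dots> \<le> norm h * (K / R ^ j)" using le by (intro mult_left_mono) auto
        finally show "norm (inner h (d j \<nu>)) \<le> K / R ^ j * norm h" by (simp add: mult.commute)
      qed (use K R in simp)
    qed (use that in auto)
    then show ?thesis using R by (simp add: field_simps)
  qed
  then show thesis using that[OF R K \<rho>] d(2) \<rho>(2) by blast
qed

lemma amplitude_series_coeffs3: "amplitude_series (coeffs3 a) \<mu> r = r * cubic a \<mu> (r\<^sup>2)"
proof -
  have "(\<Sum>j. coeffs3 a j \<mu> * r ^ (2 * j)) = (\<Sum>j\<in>{..<4}. coeffs3 a j \<mu> * r ^ (2 * j))"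
    by (rule suminf_finite) (auto simp: coeffs3_def split: prod.splits)
  also have "\<dots> = cubic a \<mu> (r\<^sup>2)"
    by (cases \<mu>) (simp add: eval_nat_numeral coeffs3_def cubic_def algebra_simps)
  finally show ?thesis by (simp add: amplitude_series_def)
qed

lemma amplitude_series_differentiable:
  assumes R: "R > 0" and bd: "\<And>j. \<bar>\<beta> j \<nu>\<bar> * R ^ j \<le> K" and r: "r\<^sup>2 < R / 2"
  shows "amplitude_series \<beta> \<nu> differentiable (at r)"
proof -
  have "summable (\<lambda>j. \<beta> j \<nu> * (R / 2) ^ j)"
  proof (rule summable_comparison_test'[where N = 0])
    show "summable (\<lambda>j. K * (1/2) ^ j)" by (intro summable_mult summable_geometric) simp
    fix j :: nat
    show "norm (\<beta> j \<nu> * (R / 2) ^ j) \<le> K * (1/2) ^ j"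
      using mult_right_mono[OF bd[of j], of "(1/2) ^ j"] R by (simp add: abs_mult power_divide)
  qed
  then obtain D where "((\<lambda>u. \<Sum>j. \<beta> j \<nu> * u ^ j) has_real_derivative D) (at (r\<^sup>2))"
    using termdiffs_strong[of "\<lambda>j. \<beta> j \<nu>" "R / 2" "r\<^sup>2"] r R by auto
  then have "((\<lambda>r. r * (\<Sum>j. \<beta> j \<nu> * (r\<^sup>2) ^ j)) has_real_derivative (1 * (\<Sum>j. \<beta> j \<nu> * (r\<^sup>2) ^ j) + D * (2 * r) * r)) (at r)"
    by (intro DERIV_mult DERIV_ident DERIV_chain2[of _ D]) (auto intro!: derivative_eq_intros)
  moreover have "amplitude_series \<beta> \<nu> = (\<lambda>r. r * (\<Sum>j. \<beta> j \<nu> * (r\<^sup>2) ^ j))"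
    by (simp add: amplitude_series_def fun_eq_iff power_mult)
  ultimately show ?thesis by (auto simp: real_differentiable_def)
qed

text \<open>A form of the Weierstrass preparation theorem. Given a cubic with small parameter \<open>\<mu>\<close>, one looks for a parameter
  \<open>\<nu> = \<psi> \<mu>\<close> such that this cubic divides the series \<open>\<Sum>\<^sub>j \<beta>\<^sub>j(\<nu>) u\<^sup>j\<close>. The coefficients of the quotient satisfy a fixed point
  equation of the kind studied above. The quotient is positive near \<open>u = 0\<close>, so both fields have the same signs
  on a common neighbourhood and the identity is an orbit equivalence. Invariance of domain makes \<open>\<psi>\<close> a
  homeomorphism.\<close>

lemma determined_coeffs3:
  assumes a: "a \<noteq> 0"
  shows "determined 7 (coeffs3 a)"
  unfolding determined_def
proof (intro allI impI, elim conjE)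
  fix \<beta> :: "nat \<Rightarrow> param \<Rightarrow> real" and N :: "param set"
  assume N: "open N" "0 \<in> N" and adm: "admissible_coeffs N \<beta>"
    and eq: "\<forall>\<nu>\<in>N. \<forall>j. 2 * j + 1 \<le> 7 \<longrightarrow> \<beta> j \<nu> = coeffs3 a j \<nu>"
  obtain K R \<rho> where R: "R > 0" and K: "K \<ge> 0" and \<rho>: "\<rho> > 0" "ball 0 \<rho> \<subseteq> N"
    and bd: "\<And>j \<nu>. \<nu> \<in> ball 0 \<rho> \<Longrightarrow> \<bar>\<beta> j \<nu>\<bar> * R ^ j \<le> K"
    and lip: "\<And>j \<nu> \<nu>'. \<nu> \<in> ball 0 \<rho> \<Longrightarrow> \<nu>' \<in> ball 0 \<rho> \<Longrightarrow> \<bar>\<beta> j \<nu> - \<beta> j \<nu>'\<bar> * R ^ j \<le> K * norm (\<nu> - \<nu>')"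
    by (rule admissible_coeffsE[OF adm N]) blast
  define L where "L = K / (\<bar>a\<bar> * R ^ 3)"
  have L: "L \<ge> 0" using K R by (simp add: L_def)
  \<comment> \<open>The scaled coefficients of degree at least 3; entry 0 is 1, as the coefficient of degree 3 is \<open>a\<close>.\<close>
  define g where "g \<nu> = mk_bseq (\<lambda>j. \<beta> (j + 3) \<nu> * R ^ j / a)" for \<nu>
  have scale: "\<bar>x * R ^ j / a\<bar> \<le> y / (\<bar>a\<bar> * R ^ 3)" if "\<bar>x\<bar> * R ^ (j + 3) \<le> y" for x y j
    using divide_right_mono[OF that, of "\<bar>a\<bar> * R ^ 3"] a R
    by (simp add: abs_mult power_add field_simps)
  have g: "ent (g \<nu>) j = \<beta> (j + 3) \<nu> * R ^ j / a" if "\<nu> \<in> ball 0 \<rho>" for \<nu> j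
    unfolding g_def by (rule ent_mk_bseq[where K = L]) (use scale[OF bd[OF that]] in \<open>simp add: L_def\<close>)
  have coeff: "\<beta> 0 (m0, m1, m2) = m0" "\<beta> 1 (m0, m1, m2) = m1" "\<beta> 2 (m0, m1, m2) = m2" "\<beta> 3 (m0, m1, m2) = a"
    if "(m0, m1, m2) \<in> ball 0 \<rho>" for m0 m1 m2
    using that \<rho>(2) eq by (auto simp: coeffs3_def)
  have "ent (g 0) 0 = 1"
    using g[of 0 0] coeff(4)[of 0 0 0] \<rho>(1) a by (simp add: zero_prod_def)
  then have inj: "inj (\<lambda>\<mu>. low_part R \<mu> (g 0))" by (intro inj_low_part) simp
  have "norm (g \<nu> - g \<nu>') \<le> L * norm (\<nu> - \<nu>')" if "\<nu> \<in> ball 0 \<rho>" "\<nu>' \<in> ball 0 \<rho>" for \<nu> \<nu>'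
  proof (rule norm_bseq_le)
    fix j
    show "\<bar>ent (g \<nu> - g \<nu>') j\<bar> \<le> L * norm (\<nu> - \<nu>')"
      using scale[OF lip[OF that, of "j + 3"]] g that by (simp add: L_def diff_divide_distrib left_diff_distrib)
  qed
  from bilinear_fixed_point_parametrization[OF bounded_bilinear_low_part bounded_bilinear_high_part \<rho>(1) L this inj,
      of "1/2" R a]
  obtain \<delta> \<psi> where \<delta>: "\<delta> > 0" and \<psi>: "continuous_on (ball 0 \<delta>) \<psi>" "inj_on \<psi> (ball 0 \<delta>)" "\<psi> 0 = 0"
    and sol: "\<And>\<mu>. \<mu> \<in> ball 0 \<delta> \<Longrightarrow> \<exists>y. \<psi> \<mu> \<in> ball 0 \<rho> \<and> norm (y - g 0) \<le> 1/2 \<and>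
      y = g (\<psi> \<mu>) - high_part R a \<mu> y \<and> \<psi> \<mu> = low_part R \<mu> y"
    by (metis half_gt_zero_iff zero_less_one)
  define Y where "Y = norm (g 0) + 1"
  have Y: "Y > 0" by (simp add: Y_def add_nonneg_pos)
  \<comment> \<open>For \<open>u / R < 1/2\<close> and \<open>Y u / R < 1/4\<close> the terms of positive degree of the quotient add up to less than
    \<open>1/2\<close>, a lower bound of its constant term.\<close>
  define \<epsilon> where "\<epsilon> = sqrt (min (R / 2) (R / (4 * Y)))"
  have \<epsilon>: "\<epsilon> > 0" using R Y by (simp add: \<epsilon>_def)
  have factor: "\<exists>W>0. (\<Sum>j. \<beta> j (\<psi> \<mu>) * u ^ j) = cubic a \<mu> u * W"
    if \<mu>: "\<mu> \<in> ball 0 \<delta>" and u: "0 \<le> u" "u < min (R / 2) (R / (4 * Y))" for \<mu> u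
  proof -
    obtain m0 m1 m2 where m: "\<mu> = (m0, m1, m2)" by (cases \<mu>)
    obtain y where y: "\<psi> \<mu> \<in> ball 0 \<rho>" "norm (y - g 0) \<le> 1/2" "y = g (\<psi> \<mu>) - high_part R a \<mu> y" "\<psi> \<mu> = low_part R \<mu> y"
      using sol[OF \<mu>] by blast
    have y0: "ent y 0 \<ge> 1/2"
      using ent_le_norm[of "y - g 0" 0] y(2) \<open>ent (g 0) 0 = 1\<close> by simp
    have yY: "\<bar>ent y j\<bar> \<le> Y" for j
      using ent_le_norm[of y j] norm_triangle_sub[of y "g 0"] y(2) by (simp add: Y_def)
    define w where "w j = ent y j / R ^ j" for j
    define q where "q = u / R"
    have q: "0 \<le> q" "q < 1/2" "Y * q < 1/4" using u R Y by (auto simp: q_def field_simps)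
    have wu: "w j * u ^ j = ent y j * q ^ j" for j by (simp add: w_def q_def power_divide)
    have bound: "\<bar>w j * u ^ j\<bar> \<le> Y * q ^ j" for j
      unfolding wu abs_mult using yY[of j] q by (simp add: mult_right_mono)
    have geo: "(\<lambda>j. Y * q ^ j) sums (Y * (1 / (1 - q)))"
      using q by (intro sums_mult geometric_sums) auto
    have "summable (\<lambda>j. w j * u ^ j)"
      by (rule summable_comparison_test'[OF sums_summable[OF geo], of 0]) (use bound in simp)
    then obtain W where W: "(\<lambda>j. w j * u ^ j) sums W" by (auto simp: summable_def)
    have "W > 0"
    proof -
      have "(\<lambda>j. w (j + 1) * u ^ (j + 1)) sums (W - (\<Sum>i<1. w i * u ^ i))"
        by (rule sums_split_initial_segment[OF W])
      moreover have "(\<lambda>j. Y * q * q ^ j) sums (Y * q * (1 / (1 - q)))"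
        using q by (intro sums_mult geometric_sums) auto
      ultimately have "norm (W - (\<Sum>i<1. w i * u ^ i)) \<le> Y * q * (1 / (1 - q))"
        by (rule norm_sums_le) (use bound[of "Suc _"] in \<open>simp add: mult_ac\<close>)
      also have "\<dots> < 1/2" using q by (simp add: field_simps)
      finally have "\<bar>W - ent y 0\<bar> < 1/2" by (simp add: w_def)
      then show ?thesis using y0 by linarith
    qed
    have "\<psi> \<mu> = (m0 * w 0, m0 * w 1 + m1 * w 0, m0 * w 2 + m1 * w 1 + m2 * w 0)"
      unfolding y(4) by (simp add: low_part_def m w_def)
    note low = coeff[OF y(1)[unfolded this], folded this]
    have "\<beta> (j + 3) (\<psi> \<mu>) = m0 * w (j + 3) + m1 * w (j + 2) + m2 * w (j + 1) + a * w j" for j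
    proof -
      have "ent y j = ent (g (\<psi> \<mu>) - high_part R a \<mu> y) j" using y(3) by simp
      then have "ent y j = \<beta> (j + 3) (\<psi> \<mu>) * R ^ j / a - (m0 / (a * R ^ 3) * ent y (j + 3)
          + m1 / (a * R ^ 2) * ent y (j + 2) + m2 / (a * R) * ent y (j + 1))"
        by (simp add: g[OF y(1)[unfolded m]] high_part_def m)
      then have "\<beta> (j + 3) (\<psi> \<mu>) * R ^ j / a = (ent y j + m0 / (a * R ^ 3) * ent y (j + 3)
          + m1 / (a * R ^ 2) * ent y (j + 2) + m2 / (a * R) * ent y (j + 1))" by simp
      also have "\<dots> = (m0 * w (j + 3) + m1 * w (j + 2) + m2 * w (j + 1) + a * w j) * (R ^ j / a)"
      proof -
        have "ent y i = w i * R ^ i" for i using R by (simp add: w_def)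
        then show ?thesis using a R by (simp only: power_add) (simp add: field_simps eval_nat_numeral)
      qed
      finally have "\<beta> (j + 3) (\<psi> \<mu>) * (R ^ j / a)
          = (m0 * w (j + 3) + m1 * w (j + 2) + m2 * w (j + 1) + a * w j) * (R ^ j / a)" by simp
      moreover have "R ^ j / a \<noteq> 0" using a R by simp
      ultimately show ?thesis by (metis mult_right_cancel)
    qed
    from sums_cubic_times_series[OF W low(1-3) this]
    show ?thesis using \<open>W > 0\<close> by (auto simp: m sums_iff)
  qed
  obtain \<psi>' where hom: "homeomorphism (ball 0 \<delta>) (\<psi> ` ball 0 \<delta>) \<psi> \<psi>'"
    using invariance_of_domain_homeomorphism[OF open_ball \<psi>(1) _ \<psi>(2)] by auto
  show "locally_equivalent_families (amplitude_series (coeffs3 a)) (amplitude_series \<beta>)"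
    unfolding locally_equivalent_families_def
  proof (rule exI[of _ "ball 0 \<delta>"], rule exI[of _ "\<psi> ` ball 0 \<delta>"], rule exI[of _ \<psi>], rule exI[of _ \<psi>'],
      rule exI[of _ \<epsilon>], rule exI[of _ \<epsilon>], intro conjI ballI)
    show "open (\<psi> ` ball 0 \<delta>)" by (rule invariance_of_domain[OF \<psi>(1) open_ball \<psi>(2)])
    show "0 \<in> \<psi> ` ball 0 \<delta>" using \<psi>(3) \<delta> by (metis centre_in_ball imageI)
    fix \<mu> :: param assume \<mu>: "\<mu> \<in> ball 0 \<delta>"
    have small: "r\<^sup>2 < min (R / 2) (R / (4 * Y))" if "r \<in> {-\<epsilon><..<\<epsilon>}" for r
    proof -
      have "\<bar>r\<bar> < \<epsilon>" using that by auto
      then have "r\<^sup>2 < \<epsilon>\<^sup>2" by (metis abs_ge_zero power2_abs power_strict_mono zero_less_numeral)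
      then show ?thesis using R Y by (simp add: \<epsilon>_def)
    qed
    show "orbit_equivalent {-\<epsilon><..<\<epsilon>} {-\<epsilon><..<\<epsilon>} (amplitude_series (coeffs3 a) \<mu>) (amplitude_series \<beta> (\<psi> \<mu>))"
    proof (rule orbit_equivalent_if_same_sgn)
      fix r assume r: "r \<in> {-\<epsilon><..<\<epsilon>}"
      obtain m0 m1 m2 where m: "\<mu> = (m0, m1, m2)" by (cases \<mu>)
      show "amplitude_series (coeffs3 a) \<mu> differentiable (at r)"
        unfolding amplitude_series_coeffs3[abs_def] m cubic_def prod.case
        by (intro derivative_intros)
      have \<psi>\<mu>: "\<psi> \<mu> \<in> ball 0 \<rho>" using sol[OF \<mu>] by blast
      show "amplitude_series \<beta> (\<psi> \<mu>) differentiable (at r)"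
        using small[OF r] by (intro amplitude_series_differentiable[where \<beta> = \<beta> and \<nu> = "\<psi> \<mu>", OF R bd[OF \<psi>\<mu>]]) auto
      obtain W where W: "W > 0" "(\<Sum>j. \<beta> j (\<psi> \<mu>) * (r\<^sup>2) ^ j) = cubic a \<mu> (r\<^sup>2) * W"
        using factor[OF \<mu> _ small[OF r]] by auto
      then have "amplitude_series \<beta> (\<psi> \<mu>) r = r * (cubic a \<mu> (r\<^sup>2) * W)"
        by (simp add: amplitude_series_def power_mult)
      then show "sgn (amplitude_series (coeffs3 a) \<mu> r) = sgn (amplitude_series \<beta> (\<psi> \<mu>) r)"
        using W(1) by (simp add: amplitude_series_coeffs3 sgn_mult)
    qed
  qed (use hom \<psi>(3) \<delta> \<epsilon> in auto)
qed

section \<open>The amplitude equation of degree seven\<close>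

definition cubic_deriv :: "real \<Rightarrow> param \<Rightarrow> real \<Rightarrow> real" where
  "cubic_deriv a = (\<lambda>(m0, m1, m2) u. m1 + 2 * m2 * u + 3 * a * u\<^sup>2)"

lemma cubic_has_derivative: "(cubic a \<nu> has_real_derivative cubic_deriv a \<nu> u) (at u)"
  unfolding cubic_def cubic_deriv_def
  by (cases \<nu>) (auto intro!: derivative_eq_intros simp: power2_eq_square)

lemma continuous_on_cubic: "continuous_on S (cubic a \<nu>)"
  using cubic_has_derivative by (meson DERIV_isCont continuous_at_imp_continuous_on)

lemma amp3_eq: "amp3 a \<nu> x = x * cubic a \<nu> (x\<^sup>2)"
  by (cases \<nu>) (simp add: amp3_def amplitude_def coeffs3_def cubic_def eval_nat_numeral algebra_simps)

lemma amp3_uminus: "amp3 a \<nu> (- x) = - amp3 a \<nu> x"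
  by (simp add: amp3_eq)

lemma amp3_uminus_coeffs: "amp3 (- a) (- \<nu>) x = - amp3 a \<nu> x"
  by (cases \<nu>) (simp add: amp3_eq cubic_def algebra_simps)

lemma amp3_differentiable [simp]: "amp3 a \<nu> differentiable (at x)"
  by (simp add: amp3_def [abs_def])

lemma amp3_has_derivative:
  "(amp3 a \<nu> has_real_derivative cubic a \<nu> (x\<^sup>2) + 2 * x\<^sup>2 * cubic_deriv a \<nu> (x\<^sup>2)) (at x)"
proof -
  have "((\<lambda>x. x * cubic a \<nu> (x\<^sup>2)) has_real_derivative
      1 * cubic a \<nu> (x\<^sup>2) + cubic_deriv a \<nu> (x\<^sup>2) * (2 * x) * x) (at x)"
    by (intro DERIV_mult DERIV_ident DERIV_chain2[OF cubic_has_derivative]) (auto intro!: derivative_eq_intros)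
  then show ?thesis by (simp add: amp3_eq[abs_def] power2_eq_square algebra_simps)
qed

lemma finite_amp3_zeros:
  assumes "a \<noteq> 0"
  shows "finite {x. amp3 a \<nu> x = 0}"
proof -
  obtain m0 m1 m2 where \<nu>: "\<nu> = (m0, m1, m2)" by (cases \<nu>)
  have "amp3 a \<nu> x = poly [:0, m0, 0, m1, 0, m2, 0, a:] x" for x
    by (simp add: \<nu> amp3_eq cubic_def eval_nat_numeral algebra_simps)
  then show ?thesis using assms poly_roots_finite[of "[:0, m0, 0, m1, 0, m2, 0, a:]"] by simp
qed

lemma radii3_eq: "radii3 a \<nu> = {r. r > 0 \<and> amp3 a \<nu> r = 0}"
  by (simp add: radii3_def hypertorus_radii_def amp3_def)

lemma attracting_uminus: "x \<in> attracting (amp3 a \<nu>) \<Longrightarrow> - x \<in> attracting (amp3 a \<nu>)"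
proof -
  assume "x \<in> attracting (amp3 a \<nu>)"
  then obtain e where e: "e > 0" "\<And>y. 0 < \<bar>y - x\<bar> \<Longrightarrow> \<bar>y - x\<bar> < e \<Longrightarrow> amp3 a \<nu> y * (y - x) < 0" "amp3 a \<nu> x = 0"
    by (auto simp: attracting_def)
  have "amp3 a \<nu> y * (y - - x) < 0" if "0 < \<bar>y - - x\<bar>" "\<bar>y - - x\<bar> < e" for y
    using e(2)[of "- y"] that by (simp add: amp3_uminus algebra_simps abs_minus_commute abs_if split: if_splits)
  then show ?thesis using e by (auto simp: attracting_def amp3_uminus)
qed

text \<open>The field cannot point towards \<open>x\<close> and away from it at the same time.\<close>

lemma not_attracting_if_attracting_uminus:
  assumes "x \<in> attracting (\<lambda>y. - f y)" shows "x \<notin> attracting f"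
proof
  assume "x \<in> attracting f"
  then obtain e where e: "e > 0" "\<And>y. 0 < \<bar>y - x\<bar> \<Longrightarrow> \<bar>y - x\<bar> < e \<Longrightarrow> f y * (y - x) < 0"
    by (auto simp: attracting_def)
  obtain d where d: "d > 0" "\<And>y. 0 < \<bar>y - x\<bar> \<Longrightarrow> \<bar>y - x\<bar> < d \<Longrightarrow> - f y * (y - x) < 0"
    using assms by (auto simp: attracting_def)
  define y where "y = x + min d e / 2"
  have "0 < \<bar>y - x\<bar>" "\<bar>y - x\<bar> < d" "\<bar>y - x\<bar> < e" using d(1) e(1) by (auto simp: y_def)
  then show False using d(2)[of y] e(2)[of y] by simp
qed

lemma attracting_if_deriv_neg:
  assumes "f x = 0" "(f has_real_derivative D) (at x)" "D < 0"
  shows "x \<in> attracting f"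
proof -
  have "((\<lambda>y. f y / (y - x)) \<longlongrightarrow> D) (at x)"
    using assms by (simp add: has_field_derivative_iff)
  from order_tendstoD(2)[OF this assms(3)]
  obtain d where "d > 0" "\<And>y. y \<noteq> x \<Longrightarrow> \<bar>y - x\<bar> < d \<Longrightarrow> f y / (y - x) < 0"
    by (auto simp: eventually_at dist_real_def)
  then have "\<forall>y. 0 < \<bar>y - x\<bar> \<and> \<bar>y - x\<bar> < d \<longrightarrow> f y * (y - x) < 0"
    by (auto simp: divide_less_0_iff mult_less_0_iff)
  then show ?thesis using \<open>d > 0\<close> assms(1) by (auto simp: attracting_def)
qed

lemma not_attracting_if_deriv_pos:
  assumes "f x = 0" "(f has_real_derivative D) (at x)" "D > 0"
  shows "x \<notin> attracting f"
  by (rule not_attracting_if_attracting_uminus, rule attracting_if_deriv_neg[of _ _ "- D"])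
     (use assms in \<open>auto intro: DERIV_minus\<close>)

lemma amp3_attracting_iff:
  assumes "x \<noteq> 0" "cubic a \<nu> (x\<^sup>2) = 0" "cubic_deriv a \<nu> (x\<^sup>2) \<noteq> 0"
  shows "x \<in> attracting (amp3 a \<nu>) \<longleftrightarrow> cubic_deriv a \<nu> (x\<^sup>2) < 0"
proof -
  have x: "amp3 a \<nu> x = 0" "x\<^sup>2 > 0" using assms by (auto simp: amp3_eq)
  have d: "(amp3 a \<nu> has_real_derivative 2 * x\<^sup>2 * cubic_deriv a \<nu> (x\<^sup>2)) (at x)"
    using amp3_has_derivative[of a \<nu> x] assms by simp
  show ?thesis
  proof (cases "cubic_deriv a \<nu> (x\<^sup>2) < 0")
    case True
    then show ?thesis using attracting_if_deriv_neg[OF x(1) d] x(2) by (simp add: mult_pos_neg)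
  next
    case False
    then show ?thesis using not_attracting_if_deriv_pos[OF x(1) d] x(2) assms(3) by simp
  qed
qed

lemma amp3_stable_equilibria:
  assumes "a \<noteq> 0"
  shows "stable_equilibria (amp3 a \<nu>) = attracting (amp3 a \<nu>)"
    and "unstable_equilibria (amp3 a \<nu>) = {x. amp3 a \<nu> x = 0} - attracting (amp3 a \<nu>)"
  by (rule stable_equilibria_eq; simp add: finite_amp3_zeros assms)+

context leaf_geometry
begin

text \<open>Trajectories project to amplitude solutions and positive solutions lift to trajectories, so that stability can
  be decided on the amplitude axis.\<close>

lemma stable_hypertorus_iff:
  assumes "a \<noteq> 0"
  shows "stable_hypertorus n k \<sigma> c a \<omega> b \<nu> r \<longleftrightarrow> r \<in> attracting (amp3 a \<nu>) \<inter> {0<..}"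
    and "unstable_hypertorus n k \<sigma> c a \<omega> b \<nu> r \<longleftrightarrow> r \<in> ({x. amp3 a \<nu> x = 0} - attracting (amp3 a \<nu>)) \<inter> {0<..}"
proof -
  have zero: "r \<in> attracting (amp3 a \<nu>) \<Longrightarrow> amp3 a \<nu> r = 0" by (simp add: attracting_def)
  have st: "asymptotically_stable (trajectory3 n k \<sigma> c a \<omega> b \<nu>) (state_dist n) (hypertorus n k \<sigma> c r)"
    if "r > 0" "r \<in> attracting (amp3 a \<nu>)"
    unfolding trajectory3_def
    using asymptotically_stable_hypertorus[OF that(1)] attracting_asymptotically_stable[OF _ that(2)]
    by (simp add: amp3_def[abs_def])
  have unst: "\<not> lyapunov_stable (trajectory3 n k \<sigma> c a \<omega> b \<nu>) (state_dist n) (hypertorus n k \<sigma> c r)"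
    if "r > 0" "amp3 a \<nu> r = 0" "r \<notin> attracting (amp3 a \<nu>)"
    unfolding trajectory3_def
    using lyapunov_stable_hypertorusD[OF that(1)]
      not_attracting_not_stable[of "amp3 a \<nu>" r] finite_amp3_zeros[OF assms] that
    by (auto simp: amp3_def[abs_def])
  show "stable_hypertorus n k \<sigma> c a \<omega> b \<nu> r \<longleftrightarrow> r \<in> attracting (amp3 a \<nu>) \<inter> {0<..}"
    using st unst zero unfolding stable_hypertorus_def radii3_eq asymptotically_stable_def by auto
  show "unstable_hypertorus n k \<sigma> c a \<omega> b \<nu> r \<longleftrightarrow> r \<in> ({x. amp3 a \<nu> x = 0} - attracting (amp3 a \<nu>)) \<inter> {0<..}"
    using st unst zero unfolding unstable_hypertorus_def radii3_eq asymptotically_stable_def by auto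
qed

end

section \<open>Bifurcation from the origin\<close>

text \<open>The first nonvanishing coefficient of the cubic is negative.\<close>

lemma T_Psup_cubic_deriv_neg:
  assumes "\<nu> \<in> T_Psup"
  obtains d where "d > 0" "\<And>u. 0 < u \<Longrightarrow> u < d \<Longrightarrow> cubic_deriv a \<nu> u < 0"
proof -
  obtain m1 m2 where \<nu>: "\<nu> = (0, m1, m2)" and m: "m1 < 0 \<or> m1 = 0 \<and> m2 < 0"
    using assms by (auto simp: T_Psup_def)
  have "\<forall>\<^sub>F u in at_right 0. cubic_deriv a \<nu> u < 0"
    using m
  proof
    assume "m1 < 0"
    have "((\<lambda>u. m1 + 2 * m2 * u + 3 * a * u\<^sup>2) \<longlongrightarrow> m1 + 2 * m2 * 0 + 3 * a * 0\<^sup>2) (at_right 0)"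
      by (intro tendsto_intros)
    then have "\<forall>\<^sub>F u in at_right 0. m1 + 2 * m2 * u + 3 * a * u\<^sup>2 < 0"
      by (rule order_tendstoD(2)) (use \<open>m1 < 0\<close> in simp)
    then show ?thesis by (simp add: \<nu> cubic_deriv_def)
  next
    assume m: "m1 = 0 \<and> m2 < 0"
    have "((\<lambda>u. 2 * m2 + 3 * a * u) \<longlongrightarrow> 2 * m2 + 3 * a * 0) (at_right 0)"
      by (intro tendsto_intros)
    then have "\<forall>\<^sub>F u in at_right 0. 2 * m2 + 3 * a * u < 0"
      by (rule order_tendstoD(2)) (use m in simp)
    then show ?thesis
      using eventually_at_right_less[of 0]
    proof eventually_elim
      case (elim u)
      then have "u * (2 * m2 + 3 * a * u) < 0" by (intro mult_pos_neg)
      then show ?case using m by (simp add: \<nu> cubic_deriv_def algebra_simps power2_eq_square)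
    qed
  qed
  then show thesis using that unfolding eventually_at_right_field by auto
qed

lemma T_Psup_cubic_decreasing:
  assumes "\<nu> \<in> T_Psup"
  obtains d where "d > 0" "\<And>u. 0 < u \<Longrightarrow> u \<le> d \<Longrightarrow> cubic_deriv a \<nu> u < 0"
    "\<And>u w. 0 \<le> u \<Longrightarrow> u < w \<Longrightarrow> w \<le> d \<Longrightarrow> cubic a \<nu> w < cubic a \<nu> u"
proof -
  obtain d where d: "d > 0" "\<And>u. 0 < u \<Longrightarrow> u < d \<Longrightarrow> cubic_deriv a \<nu> u < 0"
    using T_Psup_cubic_deriv_neg[OF assms] by blast
  show thesis
  proof (rule that[of "d / 2"])
    fix u w assume uw: "0 \<le> u" "u < w" "w \<le> d / 2"
    show "cubic a \<nu> w < cubic a \<nu> u"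
    proof (rule DERIV_neg_imp_decreasing_open[OF uw(2)])
      fix x assume "u < x" "x < w"
      then show "\<exists>y. (cubic a \<nu> has_real_derivative y) (at x) \<and> y < 0"
        using cubic_has_derivative d uw by (intro exI[of _ "cubic_deriv a \<nu> x"]) auto
    qed (rule continuous_on_cubic)
  qed (use d in auto)
qed

lemma T_Psup_cubic_0: "\<nu> \<in> T_Psup \<Longrightarrow> cubic a \<nu> 0 = 0"
  by (auto simp: T_Psup_def cubic_def)

lemma cubic_add_constant: "cubic a (\<nu> + t *\<^sub>R (1, 0, 0)) u = cubic a \<nu> u + t"
  and cubic_deriv_add_constant: "cubic_deriv a (\<nu> + t *\<^sub>R (1, 0, 0)) u = cubic_deriv a \<nu> u"
  by (cases \<nu>; simp add: cubic_def cubic_deriv_def)+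

text \<open>The cubic vanishes at 0 and decreases near 0. Lowering its graph leaves no root near 0; raising it by \<open>t\<close>
  produces exactly one, which tends to 0 with \<open>t\<close>, and the slope there is negative.\<close>

lemma bifurcates_at_T_Psup:
  assumes \<nu>: "\<nu> \<in> T_Psup"
  obtains r where "bifurcates_from_origin a \<nu> (1, 0, 0) r"
    "\<forall>\<^sub>F t in at_right 0. r t \<in> attracting (amp3 a (\<nu> + t *\<^sub>R (1, 0, 0))) \<inter> {0<..}"
proof -
  obtain d where d: "d > 0" "\<And>u. 0 < u \<Longrightarrow> u \<le> d \<Longrightarrow> cubic_deriv a \<nu> u < 0"
    and dec: "\<And>u w. 0 \<le> u \<Longrightarrow> u < w \<Longrightarrow> w \<le> d \<Longrightarrow> cubic a \<nu> w < cubic a \<nu> u"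
    using T_Psup_cubic_decreasing[OF \<nu>] by metis
  note c0 = T_Psup_cubic_0[OF \<nu>, of a]
  define \<epsilon> where "\<epsilon> = sqrt d"
  have \<epsilon>: "\<epsilon> > 0" "\<epsilon>\<^sup>2 = d" using d by (auto simp: \<epsilon>_def)
  have sq: "0 < x\<^sup>2 \<and> x\<^sup>2 < d" if "x \<in> {0<..<\<epsilon>}" for x
    using that \<epsilon> by (metis greaterThanLessThan_iff less_imp_le power_strict_mono zero_less_numeral zero_less_power)
  have unique: "x = y" if "x \<in> {0<..<\<epsilon>}" "y \<in> {0<..<\<epsilon>}" "cubic a \<nu> (x\<^sup>2) = cubic a \<nu> (y\<^sup>2)" for x y
  proof (rule ccontr)
    assume "x \<noteq> y"
    then have "x\<^sup>2 \<noteq> y\<^sup>2" using that by (auto simp: power2_eq_iff)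
    then show False using dec[of "x\<^sup>2" "y\<^sup>2"] dec[of "y\<^sup>2" "x\<^sup>2"] sq that by (metis less_imp_le less_irrefl linorder_neqE)
  qed
  have root: "\<exists>x\<in>{0<..<e}. cubic a \<nu> (x\<^sup>2) = - t" if e: "0 < e" "e \<le> \<epsilon>" and t: "0 < t" "t < - cubic a \<nu> (e\<^sup>2)" for e t
  proof -
    have "\<exists>u\<ge>0. u \<le> e\<^sup>2 \<and> cubic a \<nu> u = - t"
      using t c0 by (intro IVT2' continuous_on_cubic) auto
    then obtain u where u: "u \<ge> 0" "u \<le> e\<^sup>2" "cubic a \<nu> u = - t" by blast
    then have "u \<noteq> 0" "u \<noteq> e\<^sup>2" using c0 t by auto
    then have "sqrt u \<in> {0<..<e}" using u e by (auto intro: real_less_lsqrt)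
    then show ?thesis using u by (intro bexI[of _ "sqrt u"]) auto
  qed
  have neg: "cubic a \<nu> (e\<^sup>2) < 0" if "0 < e" "e \<le> \<epsilon>" for e
    using dec[of 0 "e\<^sup>2"] that c0 \<epsilon> by (metis less_imp_le order_refl power_mono zero_less_power)
  define \<tau> where "\<tau> = - cubic a \<nu> (\<epsilon>\<^sup>2)"
  have \<tau>: "\<tau> > 0" using neg[of \<epsilon>] \<epsilon> by (simp add: \<tau>_def)
  define r where "r t = (SOME x. x \<in> {0<..<\<epsilon>} \<and> cubic a \<nu> (x\<^sup>2) = - t)" for t
  have r: "r t \<in> {0<..<\<epsilon>}" "cubic a \<nu> ((r t)\<^sup>2) = - t" if "t \<in> {0<..<\<tau>}" for t
  proof -
    have "\<exists>x. x \<in> {0<..<\<epsilon>} \<and> cubic a \<nu> (x\<^sup>2) = - t"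
      using root[of \<epsilon> t] that \<epsilon>(1) by (auto simp: \<tau>_def)
    from someI_ex[OF this] show "r t \<in> {0<..<\<epsilon>}" "cubic a \<nu> ((r t)\<^sup>2) = - t"
      unfolding r_def by blast+
  qed
  have ev\<tau>: "\<forall>\<^sub>F t in at_right 0. t \<in> {0<..<\<tau>}"
    unfolding eventually_at_right_field using \<tau> by auto
  have lim: "(r \<longlongrightarrow> 0) (at_right 0)"
  proof (rule order_tendstoI)
    fix e :: real assume "e < 0"
    from ev\<tau> show "\<forall>\<^sub>F t in at_right 0. e < r t"
    proof eventually_elim
      case (elim t)
      then show ?case using r(1)[of t] \<open>e < 0\<close> by simp
    qed
  next
    fix e :: real assume "0 < e"
    define e' where "e' = min e \<epsilon>"
    have e': "0 < e'" "e' \<le> \<epsilon>" using \<open>0 < e\<close> \<epsilon> by (auto simp: e'_def)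
    have "\<forall>\<^sub>F t in at_right 0. t \<in> {0<..< - cubic a \<nu> (e'\<^sup>2)}"
      unfolding eventually_at_right_field using neg[OF e'] by (intro exI[of _ "- cubic a \<nu> (e'\<^sup>2)"]) auto
    with ev\<tau> show "\<forall>\<^sub>F t in at_right 0. r t < e"
    proof eventually_elim
      case (elim t)
      then obtain x where "x \<in> {0<..<e'}" "cubic a \<nu> (x\<^sup>2) = - t" using root[OF e', of t] by auto
      then have "r t = x" using unique[of "r t" x] r[OF elim(1)] e' by auto
      then show ?case using \<open>x \<in> {0<..<e'}\<close> by (auto simp: e'_def)
    qed
  qed
  have "bifurcates_from_origin a \<nu> (1, 0, 0) r"
    unfolding bifurcates_from_origin_def
  proof (rule conjI[OF lim], rule exI[of _ \<epsilon>], rule conjI[OF \<epsilon>(1)], rule exI[of _ \<tau>], rule conjI[OF \<tau>],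
      intro conjI ballI)
    fix t assume t: "t \<in> {0<..<\<tau>}"
    have "radii3 a (\<nu> + t *\<^sub>R (1, 0, 0)) \<inter> {0<..<\<epsilon>} = {x \<in> {0<..<\<epsilon>}. cubic a \<nu> (x\<^sup>2) = - t}"
      by (auto simp: radii3_eq amp3_eq cubic_add_constant[simplified])
    also have "\<dots> = {r t}" using r[OF t] unique by auto
    finally show "radii3 a (\<nu> + t *\<^sub>R (1, 0, 0)) \<inter> {0<..<\<epsilon>} = {r t}" .
  next
    fix t assume t: "t \<in> {0..<\<tau>}"
    have "cubic a \<nu> (x\<^sup>2) < t" if "x \<in> {0<..<\<epsilon>}" for x
      using neg[of x] that t by auto
    moreover have "cubic a (\<nu> - t *\<^sub>R (1, 0, 0)) u = cubic a \<nu> u - t" for u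
      by (cases \<nu>) (simp add: cubic_def)
    ultimately show "radii3 a (\<nu> - t *\<^sub>R (1, 0, 0)) \<inter> {0<..<\<epsilon>} = {}"
      unfolding radii3_eq amp3_eq by force
  qed
  moreover have "\<forall>\<^sub>F t in at_right 0. r t \<in> attracting (amp3 a (\<nu> + t *\<^sub>R (1, 0, 0))) \<inter> {0<..}"
    using ev\<tau>
  proof eventually_elim
    case (elim t)
    have "cubic_deriv a \<nu> ((r t)\<^sup>2) < 0" using sq[OF r(1)[OF elim]] d by auto
    then show ?case
      using r[OF elim] by (auto simp: amp3_attracting_iff cubic_add_constant[simplified] cubic_deriv_add_constant[simplified])
  qed
  ultimately show thesis using that by blast
qed

lemma T_Psub_iff_uminus: "\<nu> \<in> T_Psub \<longleftrightarrow> - \<nu> \<in> T_Psup"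
  by (cases \<nu>) (auto simp: T_Psub_def T_Psup_def)

text \<open>The passage to \<open>-a\<close> and \<open>-\<nu>\<close> changes the sign of the field. It interchanges the two varieties and keeps the
  equilibria.\<close>

lemma bifurcates_at_T_Psub:
  assumes \<nu>: "\<nu> \<in> T_Psub"
  obtains r where "bifurcates_from_origin a \<nu> (-1, 0, 0) r"
    "\<forall>\<^sub>F t in at_right 0. r t \<in> ({x. amp3 a (\<nu> + t *\<^sub>R (-1, 0, 0)) x = 0}
       - attracting (amp3 a (\<nu> + t *\<^sub>R (-1, 0, 0)))) \<inter> {0<..}"
proof -
  obtain r where r: "bifurcates_from_origin (- a) (- \<nu>) (1, 0, 0) r"
    "\<forall>\<^sub>F t in at_right 0. r t \<in> attracting (amp3 (- a) (- \<nu> + t *\<^sub>R (1, 0, 0))) \<inter> {0<..}"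
    using bifurcates_at_T_Psup[of "- \<nu>" "- a"] \<nu> T_Psub_iff_uminus by blast
  have rad: "radii3 (- a) (- \<mu>) = radii3 a \<mu>" for \<mu>
    by (simp add: radii3_eq amp3_uminus_coeffs)
  have dir: "- \<nu> + t *\<^sub>R (1, 0, 0) = - (\<nu> + t *\<^sub>R (-1, 0, 0))" "- \<nu> - t *\<^sub>R (1, 0, 0) = - (\<nu> - t *\<^sub>R (-1, 0, 0))" for t
    by (cases \<nu>; simp)+
  show thesis
  proof (rule that)
    show "bifurcates_from_origin a \<nu> (-1, 0, 0) r"
      using r(1) unfolding bifurcates_from_origin_def dir rad .
    show "\<forall>\<^sub>F t in at_right 0. r t \<in> ({x. amp3 a (\<nu> + t *\<^sub>R (-1, 0, 0)) x = 0}
       - attracting (amp3 a (\<nu> + t *\<^sub>R (-1, 0, 0)))) \<inter> {0<..}"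
      using r(2) unfolding dir amp3_uminus_coeffs[abs_def]
    proof eventually_elim
      case (elim t)
      then show ?case using not_attracting_if_attracting_uminus by (auto simp: attracting_def)
    qed
  qed
qed

section \<open>Saddle-nodes and double roots\<close>

text \<open>The coefficients of \<open>a (u - u2) (u - u1)\<^sup>2\<close>.\<close>

definition double_root_param :: "real \<Rightarrow> real \<Rightarrow> real \<Rightarrow> param" where
  "double_root_param a u1 u2 = (- a * u1\<^sup>2 * u2, a * (u1\<^sup>2 + 2 * u1 * u2), - a * (2 * u1 + u2))"

text \<open>In the direction of the polynomial \<open>- a (u - u2)\<close> the double root at \<open>u1\<close> unfolds while \<open>u2\<close> stays a root. This
  direction serves for double and for triple roots alike.\<close>

lemma cubic_double_root_param:
  "cubic a (double_root_param a u1 u2 + t *\<^sub>R (a * u2, - a, 0)) u = a * (u - u2) * ((u - u1)\<^sup>2 - t)"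
  "cubic_deriv a (double_root_param a u1 u2 + t *\<^sub>R (a * u2, - a, 0)) u
     = a * ((u - u1)\<^sup>2 - t) + 2 * a * (u - u2) * (u - u1)"
  by (simp_all add: double_root_param_def cubic_def cubic_deriv_def algebra_simps power2_eq_square power3_eq_cube)

lemma double_root_param_exists:
  assumes a: "a \<noteq> 0" and z: "cubic a \<nu> u = 0" "cubic_deriv a \<nu> u = 0"
  shows "\<exists>w. \<nu> = double_root_param a u w"
proof -
  obtain m0 m1 m2 where \<nu>: "\<nu> = (m0, m1, m2)" by (cases \<nu>)
  define w where "w = - m2 / a - 2 * u"
  have m2: "m2 = - a * (2 * u + w)" using a by (simp add: w_def field_simps)
  have m1: "m1 = a * (u\<^sup>2 + 2 * u * w)"
    using z(2) by (simp add: \<nu> cubic_deriv_def m2 algebra_simps power2_eq_square)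
  have "m0 = - a * u\<^sup>2 * w"
    using z(1) by (simp add: \<nu> cubic_def m1 m2 algebra_simps power2_eq_square power3_eq_cube)
  then show ?thesis using m1 m2 \<nu> by (auto simp: double_root_param_def)
qed

text \<open>\<open>Delta\<close> is \<open>4 p\<^sup>3 + 27 q\<^sup>2\<close> for the depressed cubic \<open>w\<^sup>3 + p w + q\<close>, with \<open>p = - (u1 - u2)\<^sup>2 / 3\<close> and
  \<open>q = 2 (u1 - u2)\<^sup>3 / 27\<close>.\<close>

lemma Delta_double_root_param:
  assumes a: "a \<noteq> 0"
  shows "Delta a (double_root_param a u1 u2) = 0"
proof -
  have p: "a * (u1\<^sup>2 + 2 * u1 * u2) / a - (- a * (2 * u1 + u2))\<^sup>2 / (3 * a\<^sup>2) = - ((u1 - u2)\<^sup>2 / 3)"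
    using a by (simp add: power2_eq_square field_simps)
  have q: "2 * (- a * (2 * u1 + u2)) ^ 3 / (27 * a ^ 3) - - a * (2 * u1 + u2) * (a * (u1\<^sup>2 + 2 * u1 * u2)) / (3 * a\<^sup>2)
      + - a * u1\<^sup>2 * u2 / a = 2 * (u1 - u2) ^ 3 / 27"
    using a by (simp add: power2_eq_square power3_eq_cube field_simps)
  have "Delta a (double_root_param a u1 u2) = 4 * (- ((u1 - u2)\<^sup>2 / 3)) ^ 3 + 27 * (2 * (u1 - u2) ^ 3 / 27)\<^sup>2"
    unfolding Delta_def double_root_param_def prod.case p q ..
  also have "4 * (- ((u1 - u2)\<^sup>2 / 3)) ^ 3 + 27 * (2 * (u1 - u2) ^ 3 / 27)\<^sup>2 = 0"
    by (simp add: power_divide power_mult_distrib flip: power_mult)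
  finally show ?thesis .
qed

text \<open>If \<open>4 p\<^sup>3 + 27 q\<^sup>2 = 0\<close>, then \<open>q = 2 w\<^sup>3\<close> and \<open>p = - 3 w\<^sup>2\<close> for a real \<open>w\<close>, and the depressed cubic has the double
  root \<open>w\<close> and the root \<open>- 2 w\<close>.\<close>

lemma double_root_param_if_Delta_eq_0:
  assumes a: "a \<noteq> 0" and D: "Delta a \<nu> = 0"
  shows "\<exists>u1 u2. \<nu> = double_root_param a u1 u2"
proof -
  obtain m0 m1 m2 where \<nu>: "\<nu> = (m0, m1, m2)" by (cases \<nu>)
  define B where "B = m2 / a"
  define A where "A = m1 / a"
  define Z where "Z = m0 / a"
  define p where "p = A - B\<^sup>2 / 3"
  define q where "q = 2 * B ^ 3 / 27 - B * A / 3 + Z"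
  have "4 * p ^ 3 + 27 * q\<^sup>2 = 0"
    using D by (simp add: \<nu> Delta_def p_def q_def A_def B_def Z_def power_divide power2_eq_square mult_ac)
  define w where "w = root 3 (q / 2)"
  have "w ^ 3 = q / 2" by (simp add: w_def odd_real_root_pow)
  then have q: "q = 2 * w ^ 3" by simp
  have "p ^ 3 = (- 3 * w\<^sup>2) ^ 3"
    using \<open>4 * p ^ 3 + 27 * q\<^sup>2 = 0\<close> by (simp add: q power_mult_distrib flip: power_mult)
  then have p: "p = - 3 * w\<^sup>2"
    by (metis odd_numeral odd_real_root_power_cancel)
  have A: "A = B\<^sup>2 / 3 - 3 * w\<^sup>2" using p by (simp add: p_def)
  have Z: "Z = 2 * w ^ 3 - 2 * B ^ 3 / 27 + B * A / 3" using q by (simp add: q_def)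
  have "\<nu> = double_root_param a (w - B / 3) (- 2 * w - B / 3)"
  proof -
    have "m2 = a * B" "m1 = a * A" "m0 = a * Z" using a by (simp_all add: A_def B_def Z_def)
    then show ?thesis
      unfolding \<nu> double_root_param_def Z A
      by (simp add: power2_eq_square power3_eq_cube field_simps)
  qed
  then show ?thesis by blast
qed

text \<open>The sign conditions in the definition of the variety select the cubics whose double root is positive.\<close>

lemma T_2SN_eq:
  assumes a: "a \<noteq> 0"
  shows "T_2SN a = {double_root_param a u1 u2 | u1 u2. u1 > 0}"
proof -
  \<comment> \<open>The sign conditions, for a cubic with leading coefficient 1, in terms of its roots.\<close>
  have iff: "(- (2 * u1 + u2) < 0 \<and> u1\<^sup>2 + 2 * u1 * u2 > 0) \<or> (- (u1\<^sup>2 * u2) > 0 \<and> u1\<^sup>2 + 2 * u1 * u2 \<le> 0) \<longleftrightarrow> u1 > 0"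
    (is "?L \<longleftrightarrow> _") for u1 u2 :: real
  proof
    assume u1: "u1 > 0"
    show ?L
    proof (cases "u1 + 2 * u2 > 0")
      case True
      then have "u1 * (u1 + 2 * u2) > 0" using u1 by simp
      then show ?thesis using True u1 by (simp add: power2_eq_square algebra_simps)
    next
      case False
      then have "u1 * (u1 + 2 * u2) \<le> 0" "u2 < 0" using u1 by (auto simp: mult_le_0_iff)
      then show ?thesis using u1 by (simp add: power2_eq_square algebra_simps mult_pos_neg)
    qed
  next
    have e: "u1\<^sup>2 + 2 * u1 * u2 = u1 * (u1 + 2 * u2)" by (simp add: power2_eq_square algebra_simps)
    assume ?L
    then show "u1 > 0"
      unfolding e
      by (auto simp: zero_less_mult_iff mult_le_0_iff mult_less_0_iff not_less)
  qed
  have "double_root_param a u1 u2 \<in> T_2SN a \<longleftrightarrow> u1 > 0" for u1 u2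
    using iff[of u1 u2] Delta_double_root_param[OF a, of u1 u2] a
    by (simp add: T_2SN_def double_root_param_def)
  moreover have "Delta a \<nu> = 0" if "\<nu> \<in> T_2SN a" for \<nu>
    using that by (auto simp: T_2SN_def)
  ultimately show ?thesis
    using double_root_param_if_Delta_eq_0[OF a] by blast
qed

text \<open>For \<open>t > 0\<close> the roots \<open>u1 - \<surd>t\<close> and \<open>u1 + \<surd>t\<close> are created. If \<open>u2 \<noteq> u1\<close>, they are the only ones near \<open>u1\<close>, and
  they have opposite slopes. If \<open>u2 = u1\<close>, the root \<open>u1\<close> exists for both signs of \<open>t\<close> and changes its stability,
  while the two new roots get its old one: one stable and one unstable equilibrium are gained.\<close>

lemma pair_creation_at_double_root:
  assumes a: "a \<noteq> 0" and r: "r > 0" and u1: "u1 = r\<^sup>2"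
  shows "pair_creation (\<lambda>\<mu>. attracting (amp3 a \<mu>)) (\<lambda>\<mu>. {x. amp3 a \<mu> x = 0} - attracting (amp3 a \<mu>))
     (double_root_param a u1 u2) (a * u2, - a, 0) r"
proof -
  define f where "f t = amp3 a (double_root_param a u1 u2 + t *\<^sub>R (a * u2, - a, 0))" for t
  define P' where "P' t u = a * ((u - u1)\<^sup>2 - t) + 2 * a * (u - u2) * (u - u1)" for t u
  have f: "f t x = x * (a * (x\<^sup>2 - u2) * ((x\<^sup>2 - u1)\<^sup>2 - t))" for t x
    unfolding f_def amp3_eq cubic_double_root_param ..
  have att: "x \<in> attracting (f t) \<longleftrightarrow> P' t (x\<^sup>2) < 0" if "x > 0" "f t x = 0" "P' t (x\<^sup>2) \<noteq> 0" for x t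
    using amp3_attracting_iff[of x a "double_root_param a u1 u2 + t *\<^sub>R (a * u2, - a, 0)"] that
    unfolding f_def cubic_double_root_param P'_def amp3_eq by auto
  \<comment> \<open>For \<open>\<bar>x - r\<bar> < r\<close> one has \<open>\<bar>x\<^sup>2 - r\<^sup>2\<bar> \<le> 3 r \<bar>x - r\<bar>\<close>, so the window contains no square root of \<open>u2\<close> unless
    \<open>u1 = u2\<close>.\<close>
  define e0 where "e0 = (if u1 = u2 then r else min r (\<bar>u2 - u1\<bar> / (3 * r)))"
  have e0: "0 < e0" "e0 \<le> r" using r by (auto simp: e0_def)
  have u2_out: "x\<^sup>2 \<noteq> u2" if "u1 \<noteq> u2" "\<bar>x - r\<bar> < e0" for x
  proof
    assume "x\<^sup>2 = u2"
    have "\<bar>x - r\<bar> < r" "\<bar>x - r\<bar> < \<bar>u2 - u1\<bar> / (3 * r)" using that e0 by (auto simp: e0_def)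
    have "\<bar>u2 - u1\<bar> = \<bar>x - r\<bar> * \<bar>x + r\<bar>"
      unfolding \<open>x\<^sup>2 = u2\<close>[symmetric] u1 by (simp add: power2_eq_square algebra_simps flip: abs_mult)
    also have "\<dots> \<le> \<bar>x - r\<bar> * (3 * r)" using \<open>\<bar>x - r\<bar> < r\<close> by (intro mult_left_mono) auto
    also have "\<dots> < \<bar>u2 - u1\<bar>" using \<open>\<bar>x - r\<bar> < \<bar>u2 - u1\<bar> / (3 * r)\<close> r by (simp add: field_simps)
    finally show False by simp
  qed
  show ?thesis
    unfolding pair_creation_def
  proof (rule exI[of _ e0], intro conjI allI impI; (elim conjE)?)
    fix \<epsilon> assume \<epsilon>: "0 < \<epsilon>" "\<epsilon> < e0"
    \<comment> \<open>For \<open>\<surd>t < m\<close> the new roots lie in the window and, unless \<open>u1 = u2\<close>, on the same side of \<open>u2\<close> as \<open>u1\<close>.\<close>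
    define m where "m = (if u1 = u2 then min (u1 - (r - \<epsilon>)\<^sup>2) ((r + \<epsilon>)\<^sup>2 - u1)
      else min \<bar>u1 - u2\<bar> (min (u1 - (r - \<epsilon>)\<^sup>2) ((r + \<epsilon>)\<^sup>2 - u1)))"
    have m: "m > 0" "m \<le> u1 - (r - \<epsilon>)\<^sup>2" "m \<le> (r + \<epsilon>)\<^sup>2 - u1" "u1 \<noteq> u2 \<Longrightarrow> m \<le> \<bar>u1 - u2\<bar>"
    proof -
      have "(r - \<epsilon>)\<^sup>2 < r\<^sup>2" "r\<^sup>2 < (r + \<epsilon>)\<^sup>2" using \<epsilon> e0 r by (intro power_strict_mono; simp)+
      then show "m > 0" by (simp add: m_def u1)
    qed (auto simp: m_def)
    have mu1: "m \<le> u1" using m(2) by (smt (verit) zero_le_power2)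
    show "\<exists>\<tau>>0. \<forall>t\<in>{0<..<\<tau>}.
        card (attracting (amp3 a (double_root_param a u1 u2 + t *\<^sub>R (a * u2, - a, 0))) \<inter> {r-\<epsilon><..<r+\<epsilon>})
        = card (attracting (amp3 a (double_root_param a u1 u2 - t *\<^sub>R (a * u2, - a, 0))) \<inter> {r-\<epsilon><..<r+\<epsilon>}) + 1 \<and>
        card (({x. amp3 a (double_root_param a u1 u2 + t *\<^sub>R (a * u2, - a, 0)) x = 0}
          - attracting (amp3 a (double_root_param a u1 u2 + t *\<^sub>R (a * u2, - a, 0)))) \<inter> {r-\<epsilon><..<r+\<epsilon>})
        = card (({x. amp3 a (double_root_param a u1 u2 - t *\<^sub>R (a * u2, - a, 0)) x = 0}
          - attracting (amp3 a (double_root_param a u1 u2 - t *\<^sub>R (a * u2, - a, 0)))) \<inter> {r-\<epsilon><..<r+\<epsilon>}) + 1"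
    proof (intro exI[of _ "m\<^sup>2"] conjI ballI)
      show "m\<^sup>2 > 0" using m by simp
      fix t assume t: "t \<in> {0<..<m\<^sup>2}"
      define s where "s = sqrt t"
      have s: "0 < s" "s < m" "t = s\<^sup>2" using t m(1) by (auto simp: s_def real_less_lsqrt)
      define lo hi where "lo = sqrt (u1 - s)" and "hi = sqrt (u1 + s)"
      have sq: "lo\<^sup>2 = u1 - s" "hi\<^sup>2 = u1 + s" using s mu1 by (auto simp: lo_def hi_def)
      have lohi: "r - \<epsilon> < lo" "lo < r" "r < hi" "hi < r + \<epsilon>"
      proof -
        show "r - \<epsilon> < lo" unfolding lo_def using m s \<epsilon> e0 by (intro real_less_rsqrt) auto
        show "lo < r" unfolding lo_def using s mu1 r u1 by (intro real_less_lsqrt) auto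
        show "r < hi" unfolding hi_def using s u1 by (intro real_less_rsqrt) auto
        show "hi < r + \<epsilon>" unfolding hi_def using m s \<epsilon> r by (intro real_less_lsqrt) auto
      qed
      have pos: "x > 0" if "x \<in> {r-\<epsilon><..<r+\<epsilon>}" for x using that \<epsilon> e0 by auto
      have eqs: "x\<^sup>2 = u1 - s \<longleftrightarrow> x = lo" "x\<^sup>2 = u1 + s \<longleftrightarrow> x = hi" "x\<^sup>2 = u1 \<longleftrightarrow> x = r" if "x > 0" for x
        using that lohi r pos[of lo] pos[of hi] \<epsilon> u1 unfolding sq[symmetric] by (auto simp: power2_eq_iff)
      have split: "(x\<^sup>2 - u1)\<^sup>2 = t \<longleftrightarrow> x\<^sup>2 = u1 - s \<or> x\<^sup>2 = u1 + s" for x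
        unfolding s(3) power2_eq_iff by auto
      let ?W = "{r-\<epsilon><..<r+\<epsilon>}"
      have minus: "double_root_param a u1 u2 - t *\<^sub>R (a * u2, - a, 0)
          = double_root_param a u1 u2 + (- t) *\<^sub>R (a * u2, - a, 0)" by simp
      have W: "lo \<in> ?W" "hi \<in> ?W" "r \<in> ?W" "lo > 0" "hi > 0" using lohi \<epsilon> pos[of lo] r by auto
      have zp: "f t x = 0 \<longleftrightarrow> x\<^sup>2 = u2 \<or> x = lo \<or> x = hi" if "x \<in> ?W" for x
        using pos[OF that] eqs[OF pos[OF that]] split[of x] a by (auto simp: f)
      have zm: "f (- t) x = 0 \<longleftrightarrow> x\<^sup>2 = u2" if "x \<in> ?W" for x
      proof -
        have "(x\<^sup>2 - u1)\<^sup>2 - - t > 0" using t by (simp add: add_nonneg_pos)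
        then show ?thesis using pos[OF that] a by (auto simp: f)
      qed
      have attf: "x \<in> attracting (f t') \<Longrightarrow> f t' x = 0" for x t' by (simp add: attracting_def)
      have Plo: "P' t (lo\<^sup>2) = - 2 * s * (a * (u1 - s - u2))" and Phi: "P' t (hi\<^sup>2) = 2 * s * (a * (u1 + s - u2))"
        unfolding sq P'_def s(3) by (simp_all add: algebra_simps)
      have "card (attracting (f t) \<inter> ?W) = card (attracting (f (- t)) \<inter> ?W) + 1 \<and>
          card (({x. f t x = 0} - attracting (f t)) \<inter> ?W) = card (({x. f (- t) x = 0} - attracting (f (- t))) \<inter> ?W) + 1"
      proof (cases "u1 = u2")
        case False
        have nz: "x\<^sup>2 \<noteq> u2" if "x \<in> ?W" for x
        proof -
          have "\<bar>x - r\<bar> < e0" using that \<epsilon> by (auto simp: abs_less_iff)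
          then show ?thesis using u2_out[OF False] by blast
        qed
        have Zm: "attracting (f (- t)) \<inter> ?W = {}" "({x. f (- t) x = 0} - attracting (f (- t))) \<inter> ?W = {}"
          using zm nz attf by blast+
        have z: "f t lo = 0" "f t hi = 0" using zp W by auto
        have Zp: "\<And>x. x \<in> ?W \<Longrightarrow> f t x = 0 \<longleftrightarrow> x = lo \<or> x = hi" using zp nz by auto
        have sm: "s < \<bar>u1 - u2\<bar>" using m(4)[OF False] s by simp
        show ?thesis
        proof (cases "a * (u1 - u2) > 0")
          case True
          then have "a * (u1 - s - u2) > 0" "a * (u1 + s - u2) > 0"
            using sm s by (auto simp: zero_less_mult_iff)
          then have "P' t (lo\<^sup>2) < 0" "P' t (hi\<^sup>2) > 0" unfolding Plo Phi using s by (auto simp: mult_pos_neg)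
          then have "lo \<in> attracting (f t)" "hi \<notin> attracting (f t)" using att W z by auto
          then have "attracting (f t) \<inter> ?W = {lo}" "({x. f t x = 0} - attracting (f t)) \<inter> ?W = {hi}"
            using Zp attf W by blast+
          then show ?thesis unfolding Zm by simp
        next
          case F: False
          then have "a * (u1 - u2) < 0" using False a by (auto simp: not_less less_le)
          then have "a * (u1 - s - u2) < 0" "a * (u1 + s - u2) < 0"
            using sm s by (auto simp: mult_less_0_iff)
          then have "P' t (lo\<^sup>2) > 0" "P' t (hi\<^sup>2) < 0" unfolding Plo Phi using s by (auto simp: mult_pos_neg)
          then have "lo \<notin> attracting (f t)" "hi \<in> attracting (f t)" using att W z by auto
          then have "attracting (f t) \<inter> ?W = {hi}" "({x. f t x = 0} - attracting (f t)) \<inter> ?W = {lo}"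
            using Zp attf W by blast+
          then show ?thesis unfolding Zm by simp
        qed
      next
        case True
        have Zm: "\<And>x. x \<in> ?W \<Longrightarrow> f (- t) x = 0 \<longleftrightarrow> x = r" using zm eqs(3) pos True by auto
        have Zp: "\<And>x. x \<in> ?W \<Longrightarrow> f t x = 0 \<longleftrightarrow> x = lo \<or> x = hi \<or> x = r" using zp eqs(3) pos True by auto
        have z: "f t lo = 0" "f t hi = 0" "f t r = 0" "f (- t) r = 0" using Zp Zm W by auto
        have Pr: "P' t (r\<^sup>2) = - (a * t)" "P' (- t) (r\<^sup>2) = a * t" unfolding P'_def u1[symmetric] by simp_all
        have Plohi: "P' t (lo\<^sup>2) = 2 * a * t" "P' t (hi\<^sup>2) = 2 * a * t"
          unfolding Plo Phi using True s(3) by (simp_all add: power2_eq_square)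
        have tp: "t > 0" using t by simp
        show ?thesis
        proof (cases "a > 0")
          case pos: True
          then have "a * t > 0" using tp by simp
          then have "lo \<notin> attracting (f t)" "hi \<notin> attracting (f t)" "r \<in> attracting (f t)" "r \<notin> attracting (f (- t))"
            using att[OF W(4) z(1)] att[OF W(5) z(2)] att[OF r z(3)] att[OF r z(4)] a tp unfolding Pr Plohi by auto
          then have "attracting (f t) \<inter> ?W = {r}" "({x. f t x = 0} - attracting (f t)) \<inter> ?W = {lo, hi}"
            "attracting (f (- t)) \<inter> ?W = {}" "({x. f (- t) x = 0} - attracting (f (- t))) \<inter> ?W = {r}"
            using Zp Zm attf W by blast+
          then show ?thesis using lohi by simp
        next
          case False
          then have "a * t < 0" using tp a by (simp add: mult_less_0_iff)
          then have "lo \<in> attracting (f t)" "hi \<in> attracting (f t)" "r \<notin> attracting (f t)" "r \<in> attracting (f (- t))"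
            using att[OF W(4) z(1)] att[OF W(5) z(2)] att[OF r z(3)] att[OF r z(4)] a tp unfolding Pr Plohi by auto
          then have "attracting (f t) \<inter> ?W = {lo, hi}" "({x. f t x = 0} - attracting (f t)) \<inter> ?W = {r}"
            "attracting (f (- t)) \<inter> ?W = {r}" "({x. f (- t) x = 0} - attracting (f (- t))) \<inter> ?W = {}"
            using Zp Zm attf W by blast+
          then show ?thesis using lohi by simp
        qed
      qed
      then show "card (attracting (amp3 a (double_root_param a u1 u2 + t *\<^sub>R (a * u2, - a, 0))) \<inter> ?W)
        = card (attracting (amp3 a (double_root_param a u1 u2 - t *\<^sub>R (a * u2, - a, 0))) \<inter> ?W) + 1"
        "card (({x. amp3 a (double_root_param a u1 u2 + t *\<^sub>R (a * u2, - a, 0)) x = 0}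
          - attracting (amp3 a (double_root_param a u1 u2 + t *\<^sub>R (a * u2, - a, 0)))) \<inter> ?W)
        = card (({x. amp3 a (double_root_param a u1 u2 - t *\<^sub>R (a * u2, - a, 0)) x = 0}
          - attracting (amp3 a (double_root_param a u1 u2 - t *\<^sub>R (a * u2, - a, 0)))) \<inter> ?W) + 1"
        unfolding minus f_def by blast+
    qed
  qed (use e0 in auto)
qed

lemma pair_creation_uminus:
  assumes pc: "pair_creation Ss Us \<nu> v x"
    and sym: "\<And>\<mu> y. y \<in> Ss \<mu> \<Longrightarrow> - y \<in> Ss \<mu>" "\<And>\<mu> y. y \<in> Us \<mu> \<Longrightarrow> - y \<in> Us \<mu>"
  shows "pair_creation Ss Us \<nu> v (- x)"
proof -
  have "bij_betw uminus (A \<inter> {x-\<epsilon><..<x+\<epsilon>}) (A \<inter> {- x-\<epsilon><..<- x+\<epsilon>})"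
    if "\<And>y. y \<in> A \<Longrightarrow> - y \<in> A" for A :: "real set" and \<epsilon>
    using that by (intro bij_betwI[where g = uminus]) auto
  then have card: "card (A \<inter> {- x-\<epsilon><..<- x+\<epsilon>}) = card (A \<inter> {x-\<epsilon><..<x+\<epsilon>})"
    if "\<And>y. y \<in> A \<Longrightarrow> - y \<in> A" for A :: "real set" and \<epsilon>
    using that bij_betw_same_card by metis
  have "card (Ss \<mu> \<inter> {- x-\<epsilon><..<- x+\<epsilon>}) = card (Ss \<mu> \<inter> {x-\<epsilon><..<x+\<epsilon>})"
    "card (Us \<mu> \<inter> {- x-\<epsilon><..<- x+\<epsilon>}) = card (Us \<mu> \<inter> {x-\<epsilon><..<x+\<epsilon>})" for \<mu> \<epsilon>
    using card[of "Ss \<mu>" \<epsilon>] card[of "Us \<mu>" \<epsilon>] sym by blast+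
  then show ?thesis using pc unfolding pair_creation_def by simp
qed

lemma pair_creation_positive:
  assumes pc: "pair_creation Ss Us \<nu> v x" and x: "x > 0"
  shows "pair_creation (\<lambda>\<mu>. Ss \<mu> \<inter> {0<..}) (\<lambda>\<mu>. Us \<mu> \<inter> {0<..}) \<nu> v x"
proof -
  have eq: "A \<inter> {0<..} \<inter> {x-\<epsilon><..<x+\<epsilon>} = A \<inter> {x-\<epsilon><..<x+\<epsilon>}" if "\<epsilon> < x" for A \<epsilon>
    using that by auto
  obtain \<epsilon>0 where \<epsilon>0: "\<epsilon>0 > 0" and *: "\<And>\<epsilon>. 0 < \<epsilon> \<and> \<epsilon> < \<epsilon>0 \<Longrightarrow> \<exists>\<tau>>0. \<forall>t\<in>{0<..<\<tau>}.
        card (Ss (\<nu> + t *\<^sub>R v) \<inter> {x-\<epsilon><..<x+\<epsilon>}) = card (Ss (\<nu> - t *\<^sub>R v) \<inter> {x-\<epsilon><..<x+\<epsilon>}) + 1 \<and>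
        card (Us (\<nu> + t *\<^sub>R v) \<inter> {x-\<epsilon><..<x+\<epsilon>}) = card (Us (\<nu> - t *\<^sub>R v) \<inter> {x-\<epsilon><..<x+\<epsilon>}) + 1"
    using pc unfolding pair_creation_def by blast
  show ?thesis
    unfolding pair_creation_def
  proof (rule exI[of _ "min \<epsilon>0 x"], intro conjI allI impI)
    fix \<epsilon> assume "0 < \<epsilon> \<and> \<epsilon> < min \<epsilon>0 x"
    then have "\<epsilon> < x" "0 < \<epsilon> \<and> \<epsilon> < \<epsilon>0" by auto
    show "\<exists>\<tau>>0. \<forall>t\<in>{0<..<\<tau>}.
        card (Ss (\<nu> + t *\<^sub>R v) \<inter> {0<..} \<inter> {x-\<epsilon><..<x+\<epsilon>}) = card (Ss (\<nu> - t *\<^sub>R v) \<inter> {0<..} \<inter> {x-\<epsilon><..<x+\<epsilon>}) + 1 \<and>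
        card (Us (\<nu> + t *\<^sub>R v) \<inter> {0<..} \<inter> {x-\<epsilon><..<x+\<epsilon>}) = card (Us (\<nu> - t *\<^sub>R v) \<inter> {0<..} \<inter> {x-\<epsilon><..<x+\<epsilon>}) + 1"
      unfolding eq[OF \<open>\<epsilon> < x\<close>] by (rule *[OF \<open>0 < \<epsilon> \<and> \<epsilon> < \<epsilon>0\<close>])
  qed (use \<epsilon>0 x in auto)
qed

text \<open>Arbitrarily close to \<open>r\<close>, for parameters arbitrarily close to \<open>\<nu>\<close>, there are two different zeros, one stable and
  one unstable. The divided difference of the cubic at their squares vanishes, and in the limit it becomes
  the derivative at \<open>r\<^sup>2\<close>.\<close>

lemma pair_creation_imp_double_root:
  assumes pc: "pair_creation Ss Us \<nu> v r" and r: "r > 0"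
    and zeros: "\<And>\<mu> x. x \<in> Ss \<mu> \<union> Us \<mu> \<Longrightarrow> amp3 a \<mu> x = 0" and disj: "\<And>\<mu>. Ss \<mu> \<inter> Us \<mu> = {}"
  shows "cubic_deriv a \<nu> (r\<^sup>2) = 0"
proof -
  obtain m0 m1 m2 where \<nu>: "\<nu> = (m0, m1, m2)" by (cases \<nu>)
  obtain v0 v1 v2 where v: "v = (v0, v1, v2)" by (cases v)
  \<comment> \<open>The divided difference at \<open>p\<close> and \<open>q\<close> of the cubic with parameter \<open>\<nu> + t v\<close>.\<close>
  define D where "D t p q = (m1 + t * v1) + (m2 + t * v2) * (p + q) + a * (p\<^sup>2 + p * q + q\<^sup>2)" for t p q
  obtain \<epsilon>0 where \<epsilon>0: "\<epsilon>0 > 0" and *: "\<And>\<epsilon>. 0 < \<epsilon> \<and> \<epsilon> < \<epsilon>0 \<Longrightarrow> \<exists>\<tau>>0. \<forall>t\<in>{0<..<\<tau>}.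
        card (Ss (\<nu> + t *\<^sub>R v) \<inter> {r-\<epsilon><..<r+\<epsilon>}) = card (Ss (\<nu> - t *\<^sub>R v) \<inter> {r-\<epsilon><..<r+\<epsilon>}) + 1 \<and>
        card (Us (\<nu> + t *\<^sub>R v) \<inter> {r-\<epsilon><..<r+\<epsilon>}) = card (Us (\<nu> - t *\<^sub>R v) \<inter> {r-\<epsilon><..<r+\<epsilon>}) + 1"
    using pc unfolding pair_creation_def by blast
  have "\<exists>t x y. 0 < t \<and> t < e \<and> \<bar>x - r\<bar> < e \<and> \<bar>y - r\<bar> < e \<and> D t (x\<^sup>2) (y\<^sup>2) = 0" if e: "e > 0" for e
  proof -
    define \<epsilon> where "\<epsilon> = min (min e r) \<epsilon>0 / 2"
    have \<epsilon>: "0 < \<epsilon>" "\<epsilon> < e" "\<epsilon> < r" "\<epsilon> < \<epsilon>0" using e r \<epsilon>0 by (auto simp: \<epsilon>_def)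
    obtain \<tau> where \<tau>: "\<tau> > 0" and cards: "\<And>t. t \<in> {0<..<\<tau>} \<Longrightarrow>
        card (Ss (\<nu> + t *\<^sub>R v) \<inter> {r-\<epsilon><..<r+\<epsilon>}) = card (Ss (\<nu> - t *\<^sub>R v) \<inter> {r-\<epsilon><..<r+\<epsilon>}) + 1 \<and>
        card (Us (\<nu> + t *\<^sub>R v) \<inter> {r-\<epsilon><..<r+\<epsilon>}) = card (Us (\<nu> - t *\<^sub>R v) \<inter> {r-\<epsilon><..<r+\<epsilon>}) + 1"
      using *[of \<epsilon>] \<epsilon> by blast
    define t where "t = min e \<tau> / 2"
    have t: "0 < t" "t < e" "t \<in> {0<..<\<tau>}" using e \<tau> by (auto simp: t_def)
    have "Ss (\<nu> + t *\<^sub>R v) \<inter> {r-\<epsilon><..<r+\<epsilon>} \<noteq> {}" "Us (\<nu> + t *\<^sub>R v) \<inter> {r-\<epsilon><..<r+\<epsilon>} \<noteq> {}"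
      using cards[OF t(3)] by (metis Suc_eq_plus1 card.empty nat.distinct(1))+
    then obtain x y where x: "x \<in> Ss (\<nu> + t *\<^sub>R v)" "x \<in> {r-\<epsilon><..<r+\<epsilon>}"
      and y: "y \<in> Us (\<nu> + t *\<^sub>R v)" "y \<in> {r-\<epsilon><..<r+\<epsilon>}" by blast
    have "x \<noteq> y" using disj x y by blast
    have xy: "x > 0" "y > 0" using x y \<epsilon> by auto
    then have ne: "x\<^sup>2 \<noteq> y\<^sup>2" using \<open>x \<noteq> y\<close> by (simp add: power2_eq_iff)
    have "cubic a (\<nu> + t *\<^sub>R v) (x\<^sup>2) = 0" "cubic a (\<nu> + t *\<^sub>R v) (y\<^sup>2) = 0"
      using zeros[of x "\<nu> + t *\<^sub>R v"] zeros[of y "\<nu> + t *\<^sub>R v"] x y xy by (auto simp: amp3_eq)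
    moreover have "cubic a (\<nu> + t *\<^sub>R v) (x\<^sup>2) - cubic a (\<nu> + t *\<^sub>R v) (y\<^sup>2) = (x\<^sup>2 - y\<^sup>2) * D t (x\<^sup>2) (y\<^sup>2)"
      by (simp add: D_def \<nu> v cubic_def algebra_simps power2_eq_square power3_eq_cube)
    ultimately have "D t (x\<^sup>2) (y\<^sup>2) = 0" using ne by simp
    then show ?thesis using t x y \<epsilon> by (intro exI[of _ t] exI[of _ x] exI[of _ y]) (auto simp: abs_less_iff)
  qed
  then have "\<exists>t x y. 0 < t \<and> t < 1 / Suc n \<and> \<bar>x - r\<bar> < 1 / Suc n \<and> \<bar>y - r\<bar> < 1 / Suc n \<and> D t (x\<^sup>2) (y\<^sup>2) = 0" for n
    by simp
  then obtain t x y where seq: "\<And>n. 0 < t n" "\<And>n. t n < 1 / Suc n" "\<And>n. \<bar>x n - r\<bar> < 1 / Suc n"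
      "\<And>n. \<bar>y n - r\<bar> < 1 / Suc n" "\<And>n. D (t n) ((x n)\<^sup>2) ((y n)\<^sup>2) = 0"
    by metis
  have lim0: "(\<lambda>n. 1 / real (Suc n)) \<longlonglongrightarrow> 0"
    using LIMSEQ_inverse_real_of_nat by (simp add: inverse_eq_divide)
  have t: "t \<longlonglongrightarrow> 0"
    by (rule tendsto_sandwich[OF _ _ tendsto_const lim0]) (use seq in \<open>auto intro!: always_eventually less_imp_le\<close>)
  have "(\<lambda>n. x n - r) \<longlonglongrightarrow> 0" "(\<lambda>n. y n - r) \<longlonglongrightarrow> 0"
    using seq by (auto intro!: Lim_null_comparison[OF always_eventually lim0] less_imp_le)
  then have xy: "x \<longlonglongrightarrow> r" "y \<longlonglongrightarrow> r" by (simp_all add: LIM_zero_iff)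
  have "(\<lambda>n. D (t n) ((x n)\<^sup>2) ((y n)\<^sup>2)) \<longlonglongrightarrow> D 0 (r\<^sup>2) (r\<^sup>2)"
    unfolding D_def by (intro tendsto_intros t xy)
  then have "D 0 (r\<^sup>2) (r\<^sup>2) = 0" using seq(5) by (simp add: LIMSEQ_const_iff)
  then show ?thesis by (simp add: D_def \<nu> cubic_deriv_def algebra_simps power2_eq_square)
qed

context leaf_geometry
begin

lemma double_saddle_node_at_double_root:
  assumes a: "a \<noteq> 0" and r: "r > 0"
  shows "double_saddle_node n k \<sigma> c a \<omega> b (double_root_param a (r\<^sup>2) u2) r"
  unfolding double_saddle_node_def
proof (intro conjI exI[of _ "(a * u2, - a, 0)"] ballI)
  let ?\<nu> = "double_root_param a (r\<^sup>2) u2" and ?v = "(a * u2, - a, 0)"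
  let ?S = "\<lambda>\<mu>. attracting (amp3 a \<mu>)" and ?U = "\<lambda>\<mu>. {x. amp3 a \<mu> x = 0} - attracting (amp3 a \<mu>)"
  show "r \<in> radii3 a ?\<nu>"
    using r cubic_double_root_param(1)[of a "r\<^sup>2" u2 0 "r\<^sup>2"] by (simp add: radii3_eq amp3_eq zero_prod_def[symmetric])
  have pc: "pair_creation ?S ?U ?\<nu> ?v r"
    using pair_creation_at_double_root[OF a r refl] .
  have "pair_creation ?S ?U ?\<nu> ?v (- r)"
    using pc
  proof (rule pair_creation_uminus)
    show "- y \<in> ?U \<mu>" if "y \<in> ?U \<mu>" for \<mu> y
      using that attracting_uminus[of "- y" a \<mu>] amp3_uminus[of a \<mu> y] by simp blast
  qed (rule attracting_uminus)
  then show "pair_creation (\<lambda>\<mu>. stable_equilibria (amp3 a \<mu>)) (\<lambda>\<mu>. unstable_equilibria (amp3 a \<mu>)) ?\<nu> ?v x"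
    if "x \<in> {r, - r}" for x
    using that pc unfolding amp3_stable_equilibria[OF a] by auto
  show "pair_creation (\<lambda>\<mu>. {q. stable_hypertorus n k \<sigma> c a \<omega> b \<mu> q}) (\<lambda>\<mu>. {q. unstable_hypertorus n k \<sigma> c a \<omega> b \<mu> q}) ?\<nu> ?v r"
    using pair_creation_positive[OF pc r] unfolding stable_hypertorus_iff[OF a] Collect_mem_eq .
qed

lemma double_saddle_nodeD:
  assumes a: "a \<noteq> 0" and sn: "double_saddle_node n k \<sigma> c a \<omega> b \<nu> r"
  shows "r > 0" "\<exists>u2. \<nu> = double_root_param a (r\<^sup>2) u2"
proof -
  obtain v where r: "r \<in> radii3 a \<nu>" and pc: "pair_creation (\<lambda>\<mu>. stable_equilibria (amp3 a \<mu>))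
      (\<lambda>\<mu>. unstable_equilibria (amp3 a \<mu>)) \<nu> v r"
    using sn unfolding double_saddle_node_def by blast
  then show "r > 0" by (simp add: radii3_eq)
  have "cubic a \<nu> (r\<^sup>2) = 0" using r by (auto simp: radii3_eq amp3_eq)
  moreover have "cubic_deriv a \<nu> (r\<^sup>2) = 0"
    using pc \<open>r > 0\<close> unfolding amp3_stable_equilibria[OF a]
    by (rule pair_creation_imp_double_root) (auto simp: attracting_def)
  ultimately show "\<exists>u2. \<nu> = double_root_param a (r\<^sup>2) u2" by (rule double_root_param_exists[OF a])
qed

lemma T_2SN_eq_double_saddle_nodes:
  assumes a: "a \<noteq> 0"
  shows "T_2SN a = {\<nu>. \<exists>r. double_saddle_node n k \<sigma> c a \<omega> b \<nu> r}"
proof (intro set_eqI iffI)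
  fix \<nu> assume "\<nu> \<in> T_2SN a"
  then obtain u1 u2 where "u1 > 0" "\<nu> = double_root_param a u1 u2" unfolding T_2SN_eq[OF a] by blast
  then show "\<nu> \<in> {\<nu>. \<exists>r. double_saddle_node n k \<sigma> c a \<omega> b \<nu> r}"
    using double_saddle_node_at_double_root[OF a, of "sqrt u1" \<omega> b u2] by auto
next
  fix \<nu> assume "\<nu> \<in> {\<nu>. \<exists>r. double_saddle_node n k \<sigma> c a \<omega> b \<nu> r}"
  then obtain r where "double_saddle_node n k \<sigma> c a \<omega> b \<nu> r" by blast
  from double_saddle_nodeD[OF a this] show "\<nu> \<in> T_2SN a"
    unfolding T_2SN_eq[OF a] by fastforce
qed

end

text \<open>The second derivative at a square root of the double root is \<open>8 a x\<^sup>3 (x\<^sup>2 - u2)\<close>, and the parameter \<open>\<nu>\<^sub>0\<close> enters the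
  field with the factor \<open>x\<close>.\<close>

lemma nondegenerate_at_double_root:
  assumes a: "a \<noteq> 0" and x: "x \<noteq> 0" and ne: "x\<^sup>2 \<noteq> u2"
  shows "nondegenerate_saddle_node (amp3 a) (double_root_param a (x\<^sup>2) u2) x"
proof -
  obtain m0 m1 m2 where \<nu>: "double_root_param a (x\<^sup>2) u2 = (m0, m1, m2)" by (metis prod_cases3)
  then have m: "m0 = - a * (x\<^sup>2)\<^sup>2 * u2" "m1 = a * ((x\<^sup>2)\<^sup>2 + 2 * x\<^sup>2 * u2)" "m2 = - a * (2 * x\<^sup>2 + u2)"
    by (simp_all add: double_root_param_def)
  have f: "amp3 a (m0, m1, m2) = (\<lambda>x. m0 * x + m1 * x ^ 3 + m2 * x ^ 5 + a * x ^ 7)"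
    by (simp add: amp3_eq cubic_def fun_eq_iff eval_nat_numeral algebra_simps)
  have f': "deriv (amp3 a (m0, m1, m2)) = (\<lambda>x. m0 + 3 * m1 * x ^ 2 + 5 * m2 * x ^ 4 + 7 * a * x ^ 6)"
    unfolding f by (rule ext, rule DERIV_imp_deriv) (auto intro!: derivative_eq_intros)
  have f'': "deriv (deriv (amp3 a (m0, m1, m2))) x = 6 * m1 * x + 20 * m2 * x ^ 3 + 42 * a * x ^ 5"
    unfolding f' by (rule DERIV_imp_deriv) (auto intro!: derivative_eq_intros)
  have "amp3 a (m0, m1, m2) x = 0" "deriv (amp3 a (m0, m1, m2)) x = 0"
    unfolding f' unfolding f by (simp_all add: m eval_nat_numeral algebra_simps)
  moreover have "deriv (deriv (amp3 a (m0, m1, m2))) x = 8 * a * x ^ 3 * (x\<^sup>2 - u2)"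
    unfolding f'' by (simp add: m eval_nat_numeral algebra_simps)
  then have "deriv (deriv (amp3 a (m0, m1, m2))) x \<noteq> 0" using a x ne by simp
  moreover have "((\<lambda>t. amp3 a ((m0, m1, m2) + t *\<^sub>R (1, 0, 0)) x) has_real_derivative x) (at 0)"
    by (auto simp: amp3_eq cubic_def intro!: derivative_eq_intros)
  ultimately show ?thesis
    unfolding nondegenerate_saddle_node_def \<nu> using x by blast
qed

section \<open>Bifurcation varieties\<close>

lemma leaf_bifurcation_paramsI:
  assumes lim: "((\<lambda>t. \<nu>' t) \<longlongrightarrow> \<nu>) (at_right (0::real))"
    and ev: "\<forall>\<^sub>F t in at_right 0. \<not> orbit_equivalent UNIV UNIV (amp3 a \<nu>) (amp3 a (\<nu>' t))"
  shows "\<nu> \<in> leaf_bifurcation_params a"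
  unfolding leaf_bifurcation_params_def
proof (intro CollectI allI impI)
  fix \<delta> :: real assume "\<delta> > 0"
  then have "\<forall>\<^sub>F t in at_right 0. dist (\<nu>' t) \<nu> < \<delta> \<and> \<not> orbit_equivalent UNIV UNIV (amp3 a \<nu>) (amp3 a (\<nu>' t))"
    using tendstoD[OF lim] ev by (simp add: eventually_conj_iff)
  then show "\<exists>\<nu>'. dist \<nu>' \<nu> < \<delta> \<and> \<not> orbit_equivalent UNIV UNIV (amp3 a \<nu>) (amp3 a \<nu>')"
    using eventually_happens'[OF trivial_limit_at_right_real] by blast
qed

lemma tendsto_add_direction: "((\<lambda>t. \<nu> + t *\<^sub>R v) \<longlongrightarrow> \<nu>) (at_right (0::real))"
  for \<nu> :: "'a::real_normed_vector"
proof -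
  have "((\<lambda>t. \<nu> + t *\<^sub>R v) \<longlongrightarrow> \<nu> + 0 *\<^sub>R v) (at_right (0::real))" by (intro tendsto_intros)
  then show ?thesis by simp
qed

lemma amp3_neg_near_0:
  assumes "\<nu> \<in> T_Psup"
  obtains d where "d > 0" "\<And>x. 0 < x \<Longrightarrow> x < d \<Longrightarrow> amp3 a \<nu> x < 0"
proof -
  obtain d where d: "d > 0" "\<And>u w. 0 \<le> u \<Longrightarrow> u < w \<Longrightarrow> w \<le> d \<Longrightarrow> cubic a \<nu> w < cubic a \<nu> u"
    using T_Psup_cubic_decreasing[OF assms] by metis
  show thesis
  proof (rule that[of "sqrt d"])
    fix x assume x: "0 < x" "x < sqrt d"
    then have "x\<^sup>2 < d" using d(1) by (metis less_imp_le real_less_rsqrt real_sqrt_less_iff real_sqrt_unique)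
    then have "cubic a \<nu> (x\<^sup>2) < 0" using d(2)[of 0 "x\<^sup>2"] x T_Psup_cubic_0[OF assms] by simp
    then show "amp3 a \<nu> x < 0" using x by (simp add: amp3_eq mult_pos_neg)
  qed (use d in simp)
qed

lemma amp3_outward_near_0:
  assumes "cubic a \<mu> 0 > 0"
  obtains e where "e > 0" "\<And>x. 0 < \<bar>x\<bar> \<Longrightarrow> \<bar>x\<bar> < e \<Longrightarrow> amp3 a \<mu> x * x > 0"
proof -
  have "((\<lambda>x. cubic a \<mu> (x\<^sup>2)) \<longlongrightarrow> cubic a \<mu> (0\<^sup>2)) (at 0)"
    by (intro isCont_tendsto_compose[OF DERIV_isCont[OF cubic_has_derivative]] tendsto_intros)
  then have "\<forall>\<^sub>F x in at 0. cubic a \<mu> (x\<^sup>2) > 0"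
    by (rule order_tendstoD(1)) (use assms in simp)
  then obtain e where e: "e > 0" "\<And>x. x \<noteq> 0 \<Longrightarrow> \<bar>x\<bar> < e \<Longrightarrow> cubic a \<mu> (x\<^sup>2) > 0"
    by (auto simp: eventually_at dist_real_def)
  show thesis
  proof (rule that[OF e(1)])
    fix x :: real assume "0 < \<bar>x\<bar>" "\<bar>x\<bar> < e"
    then have "x\<^sup>2 * cubic a \<mu> (x\<^sup>2) > 0" using e(2) by simp
    then show "amp3 a \<mu> x * x > 0" by (simp add: amp3_eq power2_eq_square mult_ac)
  qed
qed

text \<open>The origin changes from attracting to repelling.\<close>

lemma T_Psup_not_orbit_equivalent:
  assumes \<nu>: "\<nu> \<in> T_Psup" and t: "t > 0"
  shows "\<not> orbit_equivalent UNIV UNIV (amp3 a \<nu>) (amp3 a (\<nu> + t *\<^sub>R (1, 0, 0)))"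
proof -
  obtain d where d: "d > 0" "\<And>x. 0 < x \<Longrightarrow> x < d \<Longrightarrow> amp3 a \<nu> x < 0"
    using amp3_neg_near_0[OF \<nu>] by blast
  have "cubic a (\<nu> + t *\<^sub>R (1, 0, 0)) 0 > 0"
    unfolding cubic_add_constant using T_Psup_cubic_0[OF \<nu>] t by simp
  from amp3_outward_near_0[OF this] obtain e where
    "e > 0" "\<And>x. 0 < \<bar>x\<bar> \<Longrightarrow> \<bar>x\<bar> < e \<Longrightarrow> amp3 a (\<nu> + t *\<^sub>R (1, 0, 0)) x * x > 0" by blast
  then show ?thesis
    using d by (intro not_orbit_equivalent_if_origin_differs[of _ _ d e]) (auto simp: amp3_eq)
qed

lemma T_Psub_not_orbit_equivalent:
  assumes \<nu>: "\<nu> \<in> T_Psub" and t: "t > 0"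
  shows "\<not> orbit_equivalent UNIV UNIV (amp3 a \<nu>) (amp3 a (\<nu> + t *\<^sub>R (-1, 0, 0)))"
proof
  let ?f = "amp3 a (\<nu> + t *\<^sub>R (-1, 0, 0))"
  assume "orbit_equivalent UNIV UNIV (amp3 a \<nu>) ?f"
  then have oe: "orbit_equivalent UNIV UNIV ?f (amp3 a \<nu>)" by (rule orbit_equivalent_sym)
  have \<nu>': "- \<nu> \<in> T_Psup" using \<nu> T_Psub_iff_uminus by blast
  obtain d where d: "d > 0" "\<And>x. 0 < x \<Longrightarrow> x < d \<Longrightarrow> amp3 (- a) (- \<nu>) x < 0"
    using amp3_neg_near_0[OF \<nu>'] by blast
  have "amp3 a \<nu> x * x > 0" if "0 < \<bar>x\<bar>" "\<bar>x\<bar> < d" for x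
    using d(2)[of "\<bar>x\<bar>"] that amp3_uminus[of a \<nu> x]
    by (auto simp: amp3_uminus_coeffs abs_if zero_less_mult_iff split: if_splits)
  have eq: "- \<nu> + t *\<^sub>R (1, 0, 0) = - (\<nu> + t *\<^sub>R (-1, 0, 0))" by (cases \<nu>) simp
  have "cubic (- a) (- \<nu> + t *\<^sub>R (1, 0, 0)) 0 > 0"
    unfolding cubic_add_constant using T_Psup_cubic_0[OF \<nu>'] t by simp
  from amp3_outward_near_0[OF this] obtain e where
    e: "e > 0" "\<And>x. 0 < \<bar>x\<bar> \<Longrightarrow> \<bar>x\<bar> < e \<Longrightarrow> - ?f x * x > 0"
    unfolding eq amp3_uminus_coeffs by blast
  have "?f x < 0" if "0 < x" "x < e" for x
    using e(2)[of x] that by (simp add: mult_less_0_iff)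
  from not_orbit_equivalent_if_origin_differs[of ?f "amp3 a \<nu>", OF _ _ e(1) this _ d(1)]
  show False using oe \<open>\<And>x. 0 < \<bar>x\<bar> \<Longrightarrow> \<bar>x\<bar> < d \<Longrightarrow> amp3 a \<nu> x * x > 0\<close> by (simp add: amp3_eq)
qed

text \<open>Splitting the positive double root into two roots \<open>u1 - s\<close> and \<open>u1 + s\<close> adds equilibria, whatever the third root
  is.\<close>

lemma double_root_not_orbit_equivalent:
  assumes a: "a \<noteq> 0" and u1: "u1 > 0" and s: "0 < s" "s < u1" "u1 \<noteq> u2 \<Longrightarrow> s < \<bar>u1 - u2\<bar>"
  shows "\<not> orbit_equivalent UNIV UNIV (amp3 a (double_root_param a u1 u2))
    (amp3 a (double_root_param a u1 u2 + s\<^sup>2 *\<^sub>R (a * u2, - a, 0)))"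
    (is "\<not> orbit_equivalent _ _ ?f ?g")
proof
  assume "orbit_equivalent UNIV UNIV ?f ?g"
  then have eq: "card {x. ?f x = 0} = card {x. ?g x = 0}"
    by (rule orbit_equivalent_card_zeros) simp_all
  define S where "S = {x. x = 0 \<or> x\<^sup>2 = u2}"
  have sqs: "{x. x\<^sup>2 = u} = {sqrt u, - sqrt u}" if "u > 0" for u :: real
    using that by (auto simp: power2_eq_iff dest: real_sqrt_unique)
  have "S \<subseteq> {0, sqrt \<bar>u2\<bar>, - sqrt \<bar>u2\<bar>}"
    by (auto simp: S_def)
  then have S: "finite S" by (rule finite_subset) simp
  have "?f x = x * (a * (x\<^sup>2 - u2) * ((x\<^sup>2 - u1)\<^sup>2 - 0))" for x
    unfolding amp3_eq cubic_double_root_param(1)[symmetric] by (simp del: scaleR_Pair)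
  then have F: "{x. ?f x = 0} = S \<union> {sqrt u1, - sqrt u1}"
    unfolding sqs[OF u1, symmetric] using a by (auto simp: S_def)
  have "card {x. ?f x = 0} \<le> card S + card {sqrt u1, - sqrt u1}"
    unfolding F by (rule card_Un_le)
  also have "\<dots> \<le> card S + 2" by (simp add: card_insert_if)
  finally have f: "card {x. ?f x = 0} \<le> card S + 2" .
  have "?g x = 0 \<longleftrightarrow> x \<in> S \<or> x\<^sup>2 = u1 - s \<or> x\<^sup>2 = u1 + s" for x
  proof -
    have "(x\<^sup>2 - u1)\<^sup>2 - s\<^sup>2 = (x\<^sup>2 - (u1 - s)) * (x\<^sup>2 - (u1 + s))"
      by (simp add: power2_eq_square algebra_simps)
    then show ?thesis
      unfolding amp3_eq cubic_double_root_param(1) using a by (simp add: S_def)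
  qed
  then have "{x. ?g x = 0} = S \<union> ({x. x\<^sup>2 = u1 - s} \<union> {x. x\<^sup>2 = u1 + s})" by blast
  also have "{x. x\<^sup>2 = u1 - s} = {sqrt (u1 - s), - sqrt (u1 - s)}" using s by (intro sqs) simp
  also have "{x. x\<^sup>2 = u1 + s} = {sqrt (u1 + s), - sqrt (u1 + s)}" using s by (intro sqs) simp
  finally have G: "{x. ?g x = 0} = S \<union> {sqrt (u1 - s), - sqrt (u1 - s), sqrt (u1 + s), - sqrt (u1 + s)}" by auto
  have ne: "u1 - s \<noteq> u2" "u1 + s \<noteq> u2" using s by (cases "u1 = u2"; auto)+
  have "S \<inter> {sqrt (u1 - s), - sqrt (u1 - s), sqrt (u1 + s), - sqrt (u1 + s)} = {}"
    using s ne by (auto simp: S_def)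
  then have "card {x. ?g x = 0} = card S + card {sqrt (u1 - s), - sqrt (u1 - s), sqrt (u1 + s), - sqrt (u1 + s)}"
    unfolding G using S by (intro card_Un_disjoint) auto
  also have "card {sqrt (u1 - s), - sqrt (u1 - s), sqrt (u1 + s), - sqrt (u1 + s)} = 4"
  proof -
    have "distinct [p, - p, q, - q]" if "0 < p" "p < q" for p q :: real
      using that by auto
    from this[of "sqrt (u1 - s)" "sqrt (u1 + s)"]
    have "distinct [sqrt (u1 - s), - sqrt (u1 - s), sqrt (u1 + s), - sqrt (u1 + s)]"
      using s by simp
    from distinct_card[OF this] show ?thesis by simp
  qed
  finally show False using eq f by simp
qed

text \<open>Near each parameter of the varieties there are parameters with another number of equilibria or with
  another stability of the origin.\<close>

lemma bifurcation_varieties_subset: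
  assumes a: "a \<noteq> 0"
  shows "T_Psup \<union> T_Psub \<union> T_2SN a \<subseteq> leaf_bifurcation_params a"
proof (intro Un_least subsetI)
  fix \<nu> assume "\<nu> \<in> T_Psup"
  then show "\<nu> \<in> leaf_bifurcation_params a"
    by (intro leaf_bifurcation_paramsI[OF tendsto_add_direction[of _ "(1, 0, 0)"]])
       (rule eventually_mono[OF eventually_at_right_less], rule T_Psup_not_orbit_equivalent)
next
  fix \<nu> assume "\<nu> \<in> T_Psub"
  then show "\<nu> \<in> leaf_bifurcation_params a"
    by (intro leaf_bifurcation_paramsI[OF tendsto_add_direction[of _ "(-1, 0, 0)"]])
       (rule eventually_mono[OF eventually_at_right_less], rule T_Psub_not_orbit_equivalent)
next
  fix \<nu> assume "\<nu> \<in> T_2SN a"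
  then obtain u1 u2 where u1: "u1 > 0" and \<nu>: "\<nu> = double_root_param a u1 u2" unfolding T_2SN_eq[OF a] by blast
  show "\<nu> \<in> leaf_bifurcation_params a"
  proof (rule leaf_bifurcation_paramsI)
    have "((\<lambda>s. \<nu> + s\<^sup>2 *\<^sub>R (a * u2, - a, 0)) \<longlongrightarrow> \<nu> + 0\<^sup>2 *\<^sub>R (a * u2, - a, 0)) (at_right (0::real))"
      by (intro tendsto_intros)
    then show "((\<lambda>s. \<nu> + s\<^sup>2 *\<^sub>R (a * u2, - a, 0)) \<longlongrightarrow> \<nu>) (at_right (0::real))" by (simp del: scaleR_Pair)
    define m where "m = (if u1 = u2 then u1 else min u1 \<bar>u1 - u2\<bar>)"
    have "\<forall>\<^sub>F s in at_right 0. 0 < s \<and> s < m"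
      using u1 by (auto simp: eventually_at_right_field m_def intro!: exI[of _ m])
    then show "\<forall>\<^sub>F s in at_right 0. \<not> orbit_equivalent UNIV UNIV (amp3 a \<nu>) (amp3 a (\<nu> + s\<^sup>2 *\<^sub>R (a * u2, - a, 0)))"
      unfolding \<nu>
    proof eventually_elim
      case (elim s)
      then show ?case
        by (intro double_root_not_orbit_equivalent[OF a u1]) (auto simp: m_def split: if_splits)
    qed
  qed
qed

section \<open>Hypertorus bifurcations\<close>

theorem theorem5p3:
  fixes n k :: nat and \<sigma> :: "nat \<Rightarrow> nat" and c :: "nat \<Rightarrow> real" and a3 :: real
    and \<omega> :: "nat \<Rightarrow> real" and b :: "nat \<Rightarrow> nat \<Rightarrow> param \<Rightarrow> real"
  assumes "2 \<le> k" and "k \<le> n"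
    and "\<sigma> \<in> shuffles_kn k n"
    and "c \<in> pos_sphere k n \<sigma>"
    and "a3 \<noteq> 0"
    and "\<And>i. i \<in> {1..n} \<Longrightarrow> \<omega> i \<noteq> 0"
    and "\<And>i j. 1 \<le> i \<Longrightarrow> i < j \<Longrightarrow> j \<le> n \<Longrightarrow> \<omega> i / \<omega> j \<notin> \<rat>"
    and "\<And>i. i \<in> {1..k} \<Longrightarrow> b i 0 0 = 0"
  shows "T_Psup \<union> T_Psub \<union> T_2SN a3 \<subseteq> leaf_bifurcation_params a3
    \<and> (\<forall>\<nu>0 \<nu>1 \<nu>2. (\<nu>0, \<nu>1, \<nu>2) \<in> T_Psup \<longrightarrow>
         (\<exists>r. bifurcates_from_origin a3 (\<nu>0, \<nu>1, \<nu>2) (1, 0, 0) r \<and>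
           (\<nu>1 < 0 \<longrightarrow> (\<forall>\<^sub>F t in at_right 0.
              stable_hypertorus n k \<sigma> c a3 \<omega> b ((\<nu>0, \<nu>1, \<nu>2) + t *\<^sub>R (1, 0, 0)) (r t)))))
    \<and> (\<forall>\<nu>0 \<nu>1 \<nu>2. (\<nu>0, \<nu>1, \<nu>2) \<in> T_Psub \<longrightarrow>
         (\<exists>r. bifurcates_from_origin a3 (\<nu>0, \<nu>1, \<nu>2) (-1, 0, 0) r \<and>
           (\<nu>1 > 0 \<longrightarrow> (\<forall>\<^sub>F t in at_right 0.
              unstable_hypertorus n k \<sigma> c a3 \<omega> b ((\<nu>0, \<nu>1, \<nu>2) + t *\<^sub>R (-1, 0, 0)) (r t)))))
    \<and> T_2SN a3 = {\<nu>. \<exists>r. double_saddle_node n k \<sigma> c a3 \<omega> b \<nu> r}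
    \<and> (\<forall>\<nu>0 \<nu>1 \<nu>2 r. double_saddle_node n k \<sigma> c a3 \<omega> b (\<nu>0, \<nu>1, \<nu>2) r \<and>
         \<nu>1 / a3 \<noteq> \<nu>2\<^sup>2 / (3 * a3\<^sup>2) \<longrightarrow>
         nondegenerate_saddle_node (amp3 a3) (\<nu>0, \<nu>1, \<nu>2) r \<and>
         nondegenerate_saddle_node (amp3 a3) (\<nu>0, \<nu>1, \<nu>2) (- r))
    \<and> determined 7 (coeffs3 a3)"
proof -
  interpret leaf_geometry n k \<sigma> c
    using assms(1-4) by unfold_locales auto
  note a3 = \<open>a3 \<noteq> 0\<close>
  show ?thesis
  proof (intro conjI allI impI)
    show "T_Psup \<union> T_Psub \<union> T_2SN a3 \<subseteq> leaf_bifurcation_params a3"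
      by (rule bifurcation_varieties_subset[OF a3])
    show "T_2SN a3 = {\<nu>. \<exists>r. double_saddle_node n k \<sigma> c a3 \<omega> b \<nu> r}"
      by (rule T_2SN_eq_double_saddle_nodes[OF a3])
    show "determined 7 (coeffs3 a3)"
      by (rule determined_coeffs3[OF a3])
  next
    fix \<nu>0 \<nu>1 \<nu>2 :: real assume "(\<nu>0, \<nu>1, \<nu>2) \<in> T_Psup"
    then obtain r where "bifurcates_from_origin a3 (\<nu>0, \<nu>1, \<nu>2) (1, 0, 0) r"
      "\<forall>\<^sub>F t in at_right 0. r t \<in> attracting (amp3 a3 ((\<nu>0, \<nu>1, \<nu>2) + t *\<^sub>R (1, 0, 0))) \<inter> {0<..}"
      using bifurcates_at_T_Psup[of "(\<nu>0, \<nu>1, \<nu>2)" a3] by blast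
    then show "\<exists>r. bifurcates_from_origin a3 (\<nu>0, \<nu>1, \<nu>2) (1, 0, 0) r \<and>
           (\<nu>1 < 0 \<longrightarrow> (\<forall>\<^sub>F t in at_right 0.
              stable_hypertorus n k \<sigma> c a3 \<omega> b ((\<nu>0, \<nu>1, \<nu>2) + t *\<^sub>R (1, 0, 0)) (r t)))"
      unfolding stable_hypertorus_iff[OF a3] by blast
  next
    fix \<nu>0 \<nu>1 \<nu>2 :: real assume "(\<nu>0, \<nu>1, \<nu>2) \<in> T_Psub"
    then obtain r where "bifurcates_from_origin a3 (\<nu>0, \<nu>1, \<nu>2) (-1, 0, 0) r"
      "\<forall>\<^sub>F t in at_right 0. r t \<in> ({x. amp3 a3 ((\<nu>0, \<nu>1, \<nu>2) + t *\<^sub>R (-1, 0, 0)) x = 0}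
        - attracting (amp3 a3 ((\<nu>0, \<nu>1, \<nu>2) + t *\<^sub>R (-1, 0, 0)))) \<inter> {0<..}"
      using bifurcates_at_T_Psub[of "(\<nu>0, \<nu>1, \<nu>2)" a3] by blast
    then show "\<exists>r. bifurcates_from_origin a3 (\<nu>0, \<nu>1, \<nu>2) (-1, 0, 0) r \<and>
           (\<nu>1 > 0 \<longrightarrow> (\<forall>\<^sub>F t in at_right 0.
              unstable_hypertorus n k \<sigma> c a3 \<omega> b ((\<nu>0, \<nu>1, \<nu>2) + t *\<^sub>R (-1, 0, 0)) (r t)))"
      unfolding stable_hypertorus_iff[OF a3] by blast
  next
    fix \<nu>0 \<nu>1 \<nu>2 r
    assume *: "double_saddle_node n k \<sigma> c a3 \<omega> b (\<nu>0, \<nu>1, \<nu>2) r \<and> \<nu>1 / a3 \<noteq> \<nu>2\<^sup>2 / (3 * a3\<^sup>2)"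
    then obtain u2 where r: "r > 0" and \<nu>: "(\<nu>0, \<nu>1, \<nu>2) = double_root_param a3 (r\<^sup>2) u2"
      using double_saddle_nodeD[OF a3] by blast
    have "r\<^sup>2 \<noteq> u2"
    proof
      assume "r\<^sup>2 = u2"
      then have "\<nu>1 = a3 * (3 * u2\<^sup>2)" "\<nu>2 = - a3 * (3 * u2)"
        using \<nu> by (simp_all add: double_root_param_def power2_eq_square)
      then have "\<nu>1 / a3 = \<nu>2\<^sup>2 / (3 * a3\<^sup>2)" using a3 by (simp add: power2_eq_square)
      with * show False by blast
    qed
    then show "nondegenerate_saddle_node (amp3 a3) (\<nu>0, \<nu>1, \<nu>2) r"
      "nondegenerate_saddle_node (amp3 a3) (\<nu>0, \<nu>1, \<nu>2) (- r)"
      unfolding \<nu> using nondegenerate_at_double_root[OF a3, of r u2] nondegenerate_at_double_root[OF a3, of "- r" u2] r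
      by simp_all
  qed
qed

end
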